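(* Let $(C,T)=(C,T_1,T_2,\ldots)$ be a sequence of non-negative random variables and suppose $\mathfrak{F}_{\Sigma}(C,T)\neq\emptyset$. Then, for every $\psi\in\mathfrak{F}_{\Sigma}(C,T)$, the disintegration $M$ of $\psi$ has a representation of the form $$M(t)=\exp(-tW^* )\,M_{\mathrm{hom}}(t)\quad\text{almost surely}\quad(t\ge0),$$ where $M_{\mathrm{hom}}$ denotes the disintegration of an element of $\mathfrak{F}_{\Sigma}(0,T)$. Conversely, for the disintegration $M_{\mathrm{hom}}$ of any element of $\mathfrak{F}_{\Sigma}(0,T)$, the function $\psi(t)=\mathbb{E}\big[\exp(-tW^* )M_{\mathrm{hom}}(t)\big]$, $t\ge0$, is the Laplace transform of an element of $\mathfrak{F}_{\Sigma}(C,T)$.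
   Context: Fixed points: $\mathfrak{F}_{\Sigma}(C,T)$ is the set of probability distributions $P$ on $[0,\infty)$ such that, if $X,X_1,X_2,\ldots$ are i.i.d. with distribution $P$ and $(X_i)_{i\ge1}$ is independent of $(C,T)$, then $X\stackrel{d}{=}C+\sum_{i\ge1}T_iX_i$. A distribution is identified with its Laplace transform $\psi(t)=\int e^{-tx}P(dx)$, $t\ge0$, so $\psi\in\mathfrak{F}_{\Sigma}(C,T)$ means that the distribution with Laplace transform $\psi$ lies in $\mathfrak{F}_{\Sigma}(C,T)$. $\mathfrak{F}_{\Sigma}(0,T)$ is the same set with $C$ replaced by $0$. Weighted branching model: $\mathbb{V}=\bigcup_{n\ge0}\mathbb{N}^n$ with $\mathbb{N}=\{1,2,\ldots\}$ and $\mathbb{N}^0=\{\varnothing\}$; $|v|=n$ iff $v\in\mathbb{N}^n$; $vi$ denotes $v$ with the entry $i$ appended. Let $(C(v),T(v))_{v\in\mathbb{V}}$, with $T(v)=(T_1(v),T_2(v),\ldots)$, be a family of i.i.d. copies of $(C,T)$ with $(C(\varnothing),T(\varnothing))=(C,T)$. Put $L(\varnothing)=1$, $L(vi)=L(v)T_i(v)$ for $v\in\mathbb{V}$, $i\in\mathbb{N}$, and $W^*=\sum_{v\in\mathbb{V}}L(v)C(v)\in[0,\infty]$. Disintegration: for $\psi\in\mathfrak{F}_{\Sigma}(C,T)$ and $t\ge0$ put $M_n(t)=\exp\big(-t\sum_{|u|<n}L(u)C(u)\big)\prod_{|v|=n}\psi(L(v)t)$, $n\ge0$. The disintegration of $\psi$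 is the process $M=(M(t))_{t\ge0}$, $M(t)=\liminf_{n\to\infty}M_n(t)$ (which is almost surely a limit for each $t$). For $\varphi\in\mathfrak{F}_{\Sigma}(0,T)$ the disintegration is defined in the same way with $C(u)$ replaced by $0$, i.e. $M_{\mathrm{hom}}(t)=\liminf_{n\to\infty}\prod_{|v|=n}\varphi(L(v)t)$, using the same weights $L(v)$. *)

theory Defs
  imports "HOL-Probability.Probability"
begin

text \<open>
  Conventions. Random sequences and words are indexed by \<^typ>\<open>nat\<close> starting from 0, so that
  \<open>T i\<close> stands for the weight $T_{i+1}$ and \<^typ>\<open>nat list\<close> for the set of finite words
  (the empty word being \<open>[]\<close>). Sums of non-negative terms are taken in \<^typ>\<open>ennreal\<close>.
\<close>

section \<open>Laplace transforms and fixed points\<close>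

definition laplace_transform :: "real measure \<Rightarrow> real \<Rightarrow> real" where
  "laplace_transform P t = (\<integral>x. exp (- t * x) \<partial>P)"

text \<open>
  On the space \<open>M \<Otimes>\<^sub>M (\<Pi>\<^sub>M i\<in>UNIV. P)\<close> the coordinates \<open>x 0, x 1, \<dots>\<close> of the second component are
  i.i.d. with distribution \<open>P\<close> and independent of \<open>(C, T)\<close>, which lives on \<open>M\<close>. The lemma
  \<open>fixed_points_iff_iid\<close> below shows that any other such sequence yields the same set. The series
  may be infinite; equality of distributions is therefore equality in [0, \<open>\<infinity>\<close>].
\<close>

definition fixed_points ::
    "'a measure \<Rightarrow> ('a \<Rightarrow> real) \<Rightarrow> (nat \<Rightarrow> 'a \<Rightarrow> real) \<Rightarrow> real measure set" where
  "fixed_points M C T =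
    {P. prob_space P \<and> sets P = sets borel \<and> (AE x in P. 0 \<le> x) \<and>
        distr P borel ennreal =
        distr (M \<Otimes>\<^sub>M (\<Pi>\<^sub>M i\<in>UNIV. P)) borel
          (\<lambda>(\<omega>, x). ennreal (C \<omega>) + (\<Sum>i. ennreal (T i \<omega>) * ennreal (x i)))}"

text \<open>
  The functions that agree on [0, \<open>\<infinity>\<close>) with the Laplace transform of a fixed point; their values at
  negative arguments are irrelevant.
\<close>

definition fixed_point_transforms ::
    "'a measure \<Rightarrow> ('a \<Rightarrow> real) \<Rightarrow> (nat \<Rightarrow> 'a \<Rightarrow> real) \<Rightarrow> (real \<Rightarrow> real) set" where
  "fixed_point_transforms M C T =
    {\<psi>. \<exists>P\<in>fixed_points M C T. \<forall>t\<ge>0. \<psi> t = laplace_transform P t}"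

lemma fixed_points_iff_iid:
  fixes M :: "'a measure" and N :: "'b measure" and P :: "real measure"
  fixes C :: "'a \<Rightarrow> real" and T :: "nat \<Rightarrow> 'a \<Rightarrow> real"
    and C' :: "'b \<Rightarrow> real" and T' :: "nat \<Rightarrow> 'b \<Rightarrow> real" and X :: "nat \<Rightarrow> 'b \<Rightarrow> real"
  defines "S \<equiv> borel \<Otimes>\<^sub>M (\<Pi>\<^sub>M i\<in>UNIV. borel)"
  assumes M: "prob_space M" and N: "prob_space N"
    and CT: "(\<lambda>\<omega>. (C \<omega>, \<lambda>i. T i \<omega>)) \<in> measurable M S"
    and CT': "(\<lambda>\<omega>. (C' \<omega>, \<lambda>i. T' i \<omega>)) \<in> measurable N S"
    and law: "distr N S (\<lambda>\<omega>. (C' \<omega>, \<lambda>i. T' i \<omega>)) = distr M S (\<lambda>\<omega>. (C \<omega>, \<lambda>i. T i \<omega>))"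
    and P: "prob_space P" "sets P = sets borel" "AE x in P. 0 \<le> x"
    and iid: "prob_space.indep_vars N (\<lambda>_. borel) X UNIV" "\<And>i. distr N borel (X i) = P"
    and indep: "prob_space.indep_set N
                  (sets (vimage_algebra (space N) (\<lambda>\<omega>. (C' \<omega>, \<lambda>i. T' i \<omega>)) S))
                  (sets (vimage_algebra (space N) (\<lambda>\<omega> i. X i \<omega>) (\<Pi>\<^sub>M i\<in>UNIV. borel)))"
  shows "P \<in> fixed_points M C T \<longleftrightarrow>
    distr P borel ennreal =
    distr N borel (\<lambda>\<omega>. ennreal (C' \<omega>) + (\<Sum>i. ennreal (T' i \<omega>) * ennreal (X i \<omega>)))"
proof -
  interpret N: prob_space N by fact
  interpret M: prob_space M by fact
  let ?B = "\<Pi>\<^sub>M i\<in>(UNIV :: nat set). (borel :: real measure)"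
  let ?Q = "\<Pi>\<^sub>M i\<in>(UNIV :: nat set). P"
  let ?f = "\<lambda>((c, s), x). ennreal c + (\<Sum>i. ennreal (s i) * ennreal (x i))"
  let ?ct = "\<lambda>\<omega>. (C \<omega>, \<lambda>i. T i \<omega>)"
  let ?ct' = "\<lambda>\<omega>. (C' \<omega>, \<lambda>i. T' i \<omega>)"
  have f: "?f \<in> borel_measurable (S \<Otimes>\<^sub>M ?B)"
    unfolding S_def case_prod_unfold by measurable
  have sQ: "sets ?Q = sets ?B" by (intro sets_PiM_cong) (simp_all add: P)
  have rv: "N.random_variable borel (X i)" for i
    using iid(1) by (auto simp: N.indep_vars_def)
  have X: "distr N ?B (\<lambda>\<omega> i. X i \<omega>) = ?Q"
    using N.indep_vars_iff_distr_eq_PiM[where I=UNIV and X=X and M'="\<lambda>_. borel"] iid rv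
    by (simp add: restrict_UNIV)
  have Xm: "(\<lambda>\<omega> i. X i \<omega>) \<in> measurable N ?B"
    by (rule measurable_PiM_single') (use rv in auto)
  have joint: "distr N S ?ct' \<Otimes>\<^sub>M distr N ?B (\<lambda>\<omega> i. X i \<omega>) =
      distr N (S \<Otimes>\<^sub>M ?B) (\<lambda>\<omega>. (?ct' \<omega>, \<lambda>i. X i \<omega>))"
  proof (rule pair_measure_eqI)
    show "sigma_finite_measure (distr N S ?ct')"
      using N.prob_space_distr[OF CT'] by (simp add: prob_space_imp_sigma_finite)
    show "sigma_finite_measure (distr N ?B (\<lambda>\<omega> i. X i \<omega>))"
      using N.prob_space_distr[OF Xm] by (simp add: prob_space_imp_sigma_finite)
    fix A B assume "A \<in> sets (distr N S ?ct')" "B \<in> sets (distr N ?B (\<lambda>\<omega> i. X i \<omega>))"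
    then have A: "A \<in> sets S" and B: "B \<in> sets ?B" by simp_all
    let ?U = "?ct' -` A \<inter> space N" and ?V = "(\<lambda>\<omega> i. X i \<omega>) -` B \<inter> space N"
    have "?U \<in> sets (vimage_algebra (space N) ?ct' S)"
      using A by (rule in_vimage_algebra)
    moreover have "?V \<in> sets (vimage_algebra (space N) (\<lambda>\<omega> i. X i \<omega>) ?B)"
      using B by (rule in_vimage_algebra)
    ultimately have "N.prob (?U \<inter> ?V) = N.prob ?U * N.prob ?V"
      by (rule N.indep_setD[OF indep])
    then have "emeasure N (?U \<inter> ?V) = emeasure N ?U * emeasure N ?V"
      by (simp add: N.emeasure_eq_measure ennreal_mult')
    moreover have "(\<lambda>\<omega>. (?ct' \<omega>, \<lambda>i. X i \<omega>)) -` (A \<times> B) \<inter> space N = ?U \<inter> ?V"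
      by auto
    ultimately show "emeasure (distr N S ?ct') A * emeasure (distr N ?B (\<lambda>\<omega> i. X i \<omega>)) B =
        emeasure (distr N (S \<Otimes>\<^sub>M ?B) (\<lambda>\<omega>. (?ct' \<omega>, \<lambda>i. X i \<omega>))) (A \<times> B)"
      using A B by (simp add: emeasure_distr CT' Xm measurable_Pair[OF CT' Xm])
  qed simp
  interpret Q: prob_space ?Q by (intro prob_space_PiM P)
  have idQ: "distr ?Q ?B (\<lambda>x. x) = ?Q"
    using distr_id2[OF sQ[symmetric]] by simp
  have idm: "(\<lambda>x. x) \<in> measurable ?Q ?B"
    by (simp add: measurable_cong_sets[OF refl sQ[symmetric]])
  have prod: "distr M S ?ct \<Otimes>\<^sub>M ?Q = distr (M \<Otimes>\<^sub>M ?Q) (S \<Otimes>\<^sub>M ?B) (\<lambda>(\<omega>, x). (?ct \<omega>, x))"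
    using pair_measure_distr[OF CT idm] idQ Q.sigma_finite_measure_axioms by simp
  have "distr N borel (\<lambda>\<omega>. ennreal (C' \<omega>) + (\<Sum>i. ennreal (T' i \<omega>) * ennreal (X i \<omega>)))
        = distr (distr N (S \<Otimes>\<^sub>M ?B) (\<lambda>\<omega>. (?ct' \<omega>, \<lambda>i. X i \<omega>))) borel ?f"
    by (subst distr_distr[OF f measurable_Pair[OF CT' Xm]]) (simp add: comp_def)
  also have "\<dots> = distr (distr (M \<Otimes>\<^sub>M ?Q) (S \<Otimes>\<^sub>M ?B) (\<lambda>(\<omega>, x). (?ct \<omega>, x))) borel ?f"
    by (simp only: joint[symmetric] X law prod)
  also have "\<dots> = distr (M \<Otimes>\<^sub>M ?Q) borel
      (\<lambda>(\<omega>, x). ennreal (C \<omega>) + (\<Sum>i. ennreal (T i \<omega>) * ennreal (x i)))"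
  proof -
    have "(\<lambda>(\<omega>, x). (?ct \<omega>, x)) \<in> measurable (M \<Otimes>\<^sub>M ?Q) (S \<Otimes>\<^sub>M ?B)"
      using measurable_Pair[OF measurable_compose[OF measurable_fst CT]
          measurable_compose[OF measurable_snd idm]]
      by (simp add: case_prod_unfold)
    then show ?thesis
      by (subst distr_distr[OF f]) (simp_all add: comp_def case_prod_unfold)
  qed
  finally show ?thesis
    using P by (simp add: fixed_points_def)
qed


section \<open>The weighted branching model\<close>

locale weighted_branching = prob_space M
  for M :: "'a measure"
    and C :: "nat list \<Rightarrow> 'a \<Rightarrow> real" and T :: "nat list \<Rightarrow> nat \<Rightarrow> 'a \<Rightarrow> real" +
  assumes C_nonneg: "\<And>v \<omega>. \<omega> \<in> space M \<Longrightarrow> 0 \<le> C v \<omega>"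
    and T_nonneg: "\<And>v i \<omega>. \<omega> \<in> space M \<Longrightarrow> 0 \<le> T v i \<omega>"
    and independent:
      "indep_vars (\<lambda>_. borel \<Otimes>\<^sub>M (\<Pi>\<^sub>M i\<in>UNIV. borel)) (\<lambda>v \<omega>. (C v \<omega>, \<lambda>i. T v i \<omega>)) UNIV"
    and identically_distributed:
      "\<And>v. distr M (borel \<Otimes>\<^sub>M (\<Pi>\<^sub>M i\<in>UNIV. borel)) (\<lambda>\<omega>. (C v \<omega>, \<lambda>i. T v i \<omega>)) =
           distr M (borel \<Otimes>\<^sub>M (\<Pi>\<^sub>M i\<in>UNIV. borel)) (\<lambda>\<omega>. (C [] \<omega>, \<lambda>i. T [] i \<omega>))"

definition branch_weight :: "(nat list \<Rightarrow> nat \<Rightarrow> 'a \<Rightarrow> real) \<Rightarrow> nat list \<Rightarrow> 'a \<Rightarrow> real" where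
  "branch_weight T v \<omega> = (\<Prod>k<length v. T (take k v) (v ! k) \<omega>)"

lemma branch_weight_Nil: "branch_weight T [] \<omega> = 1"
  by (simp add: branch_weight_def)

lemma branch_weight_snoc: "branch_weight T (v @ [i]) \<omega> = branch_weight T v \<omega> * T v i \<omega>"
  by (simp add: branch_weight_def nth_append)

definition total_weight ::
    "(nat list \<Rightarrow> 'a \<Rightarrow> real) \<Rightarrow> (nat list \<Rightarrow> nat \<Rightarrow> 'a \<Rightarrow> real) \<Rightarrow> 'a \<Rightarrow> ennreal" where
  "total_weight C T \<omega> = (\<Sum>\<^sub>\<infinity>v. ennreal (branch_weight T v \<omega>) * ennreal (C v \<omega>))"


section \<open>Disintegrations\<close>

text \<open>The function \<open>x \<mapsto> exp (- x)\<close> on [0, \<open>\<infinity>\<close>], with value 0 at \<open>\<infinity>\<close>.\<close>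

definition exp_neg :: "ennreal \<Rightarrow> real" where
  "exp_neg x = (if x = \<infinity> then 0 else exp (- enn2real x))"

text \<open>
  Unordered product, as the limit of the net of finite partial products. For factors in [0, 1] the
  limit always exists and may be 0, which is why \<^const>\<open>prodinf\<close> is not suitable here.
\<close>

definition infprod :: "('b \<Rightarrow> real) \<Rightarrow> 'b set \<Rightarrow> real" where
  "infprod f A = Lim (finite_subsets_at_top A) (prod f)"

lemma infprod_eq_INF:
  assumes "\<And>x. x \<in> A \<Longrightarrow> 0 \<le> f x" "\<And>x. x \<in> A \<Longrightarrow> f x \<le> 1"
  shows "(prod f \<longlongrightarrow> infprod f A) (finite_subsets_at_top A)"
    and "infprod f A = (INF F\<in>{F. finite F \<and> F \<subseteq> A}. prod f F)"
proof -
  let ?S = "{F. finite F \<and> F \<subseteq> A}"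
  let ?l = "INF F\<in>?S. prod f F"
  have bdd: "bdd_below (prod f ` ?S)"
    by (rule bdd_belowI2[of _ 0]) (auto intro!: prod_nonneg assms)
  have le: "?l \<le> prod f F" if "F \<in> ?S" for F
    using that by (intro cINF_lower bdd)
  have anti: "prod f G \<le> prod f F" if "finite G" "G \<subseteq> A" "F \<subseteq> G" for F G
  proof -
    have "prod f G = prod f (G - F) * prod f F"
      using that by (intro prod.subset_diff) auto
    moreover have "prod f (G - F) \<le> 1" "0 \<le> prod f F"
      using that assms by (auto intro!: prod_le_1 prod_nonneg)
    ultimately show ?thesis
      by (simp add: mult_left_le_one_le prod_nonneg assms subset_iff mult_le_cancel_right2)
  qed
  have lim: "(prod f \<longlongrightarrow> ?l) (finite_subsets_at_top A)"
  proof (rule order_tendstoI)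
    fix a assume "a < ?l"
    then show "\<forall>\<^sub>F F in finite_subsets_at_top A. a < prod f F"
      using le by (intro eventually_finite_subsets_at_top_weakI) (auto intro: less_le_trans)
  next
    fix a assume "?l < a"
    then obtain F where F: "F \<in> ?S" "prod f F < a"
      using cINF_less_iff[OF _ bdd, of a] by auto
    then show "\<forall>\<^sub>F G in finite_subsets_at_top A. prod f G < a"
      unfolding eventually_finite_subsets_at_top
      using anti by (intro exI[of _ F]) (auto intro: le_less_trans)
  qed
  have eq: "infprod f A = ?l"
    unfolding infprod_def by (rule tendsto_Lim[OF _ lim]) simp
  then show "infprod f A = ?l" .
  show "(prod f \<longlongrightarrow> infprod f A) (finite_subsets_at_top A)"
    using lim eq by simp
qed

definition disintegration_step ::
    "(nat list \<Rightarrow> 'a \<Rightarrow> real) \<Rightarrow> (nat list \<Rightarrow> nat \<Rightarrow> 'a \<Rightarrow> real) \<Rightarrow> (real \<Rightarrow> real) \<Rightarrow>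
      nat \<Rightarrow> real \<Rightarrow> 'a \<Rightarrow> real" where
  "disintegration_step C T \<psi> n t \<omega> =
    exp_neg (ennreal t * (\<Sum>\<^sub>\<infinity>u\<in>{u. length u < n}. ennreal (branch_weight T u \<omega>) * ennreal (C u \<omega>))) *
    infprod (\<lambda>v. \<psi> (branch_weight T v \<omega> * t)) {v. length v = n}"

text \<open>
  The lower limit is taken in \<^typ>\<open>ereal\<close>, since \<^typ>\<open>real\<close> is not a complete lattice; the sequence
  takes values in [0, 1].
\<close>

definition disintegration ::
    "(nat list \<Rightarrow> 'a \<Rightarrow> real) \<Rightarrow> (nat list \<Rightarrow> nat \<Rightarrow> 'a \<Rightarrow> real) \<Rightarrow> (real \<Rightarrow> real) \<Rightarrow>
      real \<Rightarrow> 'a \<Rightarrow> real" where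
  "disintegration C T \<psi> t \<omega> =
    real_of_ereal (liminf (\<lambda>n. ereal (disintegration_step C T \<psi> n t \<omega>)))"

end

theory Submission
  imports Defs
begin

text \<open>
  Let \<open>S f t = E [exp (- t C) \<Prod>\<^sub>i f (T\<^sub>i t)]\<close>; a Laplace transform belongs to a fixed point iff it is fixed
  by \<open>S\<close>. With \<open>D\<^sub>n f\<close> the disintegration step, the branching property reads
  \<open>E [D\<^sub>n\<^sub>+\<^sub>1 f | F\<^sub>n] = D\<^sub>n (S f)\<close>, so that \<open>D\<^sub>n \<psi>\<close> is a bounded martingale if \<open>S \<psi> = \<psi>\<close>, and
  \<open>\<psi> t \<le> E [exp (- t W)]\<close> shows that the total weight \<open>W\<close> is almost surely finite. Hence the
  homogeneous products \<open>\<Phi>\<^sub>n \<psi>\<close> converge almost surely, and the expectation \<open>\<phi>\<close> of their limit is the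
  limit of the iterates of \<open>\<psi>\<close> under the homogeneous operator. All these iterates dominate
  \<open>\<psi>\<close>, and \<open>\<Sum>\<^sub>i (1 - \<psi> (T\<^sub>i t)) < \<infinity>\<close> almost surely; this allows to pass to the limit in the infinite
  products, so \<open>\<phi>\<close> is a fixed point whose martingale has the same limit as \<open>\<Phi>\<^sub>n \<psi>\<close>. Conversely,
  \<open>E [exp (- t W) M\<^sub>h\<^sub>o\<^sub>m t]\<close> is the limit of the iterates of \<open>\<phi>\<close> under \<open>S\<close>, and these satisfy
  \<open>1 - S\<^sup>n \<phi> \<le> (1 - \<psi>) + (1 - \<phi>)\<close> for any \<open>\<psi>\<close> fixed by \<open>S\<close>.
\<close>

section \<open>Infinite products in the unit interval\<close>

text \<open>Two kinds of loss shape the proof. Under pointwise convergence of its factors an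
  infinite product is only upper semicontinuous, so the smoothing operator need not commute with
  limits of iterates. Likewise a pointwise limit of Laplace transforms may have lost mass at
  infinity. One majorant of the defects \<open>1 - f\<close> cures both: its summability over the
  children controls the products, and its decay at the origin gives tightness. Summability is
  obtained from positivity, because a nonzero product of factors in [0,1] forces its defects to be
  summable. The fixed-point equation is an identity of laws on [0, \<infinity>]. Laplace transforms
  with value 0 at infinity are therefore used throughout, and finiteness of each random series is
  derived from a lower bound on its transform. Conditional expectations are expressed by integrals
  against bounded test functions of the marks before generation \<open>n\<close>. On a product space
  this reduces the branching property to resampling one mark after another.\<close>

lemma exp_neg_ennreal: "0 \<le> r \<Longrightarrow> exp_neg (ennreal r) = exp (- r)"
  by (simp add: exp_neg_def)

lemma exp_neg_0 [simp]: "exp_neg 0 = 1"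
  by (simp add: exp_neg_def)

lemma exp_neg_top [simp]: "exp_neg \<infinity> = 0"
  by (simp add: exp_neg_def)

lemma exp_neg_nonneg [simp]: "0 \<le> exp_neg x"
  by (simp add: exp_neg_def)

lemma exp_neg_le_1 [simp]: "exp_neg x \<le> 1"
  by (simp add: exp_neg_def)

lemma exp_neg_eq_0_iff: "exp_neg x = 0 \<longleftrightarrow> x = \<infinity>"
  by (simp add: exp_neg_def)

lemma exp_neg_add: "exp_neg (x + y) = exp_neg x * exp_neg y"
  by (cases x; cases y) (auto simp: exp_neg_def enn2real_plus simp flip: exp_add)

lemma exp_neg_antimono: "x \<le> y \<Longrightarrow> exp_neg y \<le> exp_neg x"
proof -
  assume "x \<le> y"
  then have "exp_neg y = exp_neg x * exp_neg (y - x)"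
    by (metis exp_neg_add add_diff_inverse_ennreal)
  then show ?thesis by (simp add: mult_left_le)
qed

lemma exp_neg_sum: "exp_neg (sum f A) = (\<Prod>x\<in>A. exp_neg (f x))"
  by (induction A rule: infinite_finite_induct) (simp_all add: exp_neg_add)

text \<open>Continuity at infinity is the purpose of the value
  \<open>exp_neg \<infinity> = 0\<close>: divergent sums and vanishing products need no separate
  treatment later.\<close>

lemma tendsto_exp_neg:
  assumes "(X \<longlongrightarrow> x) F"
  shows "((\<lambda>n. exp_neg (X n)) \<longlongrightarrow> exp_neg x) F"
proof (cases x)
  case (real r)
  have ev: "\<forall>\<^sub>F n in F. X n < \<infinity>"
    using assms real by (intro order_tendstoD) auto
  have "((\<lambda>n. exp (- enn2real (X n))) \<longlongrightarrow> exp (- r)) F"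
    using real assms by (intro tendsto_intros tendsto_enn2real) auto
  moreover have "\<forall>\<^sub>F n in F. exp (- enn2real (X n)) = exp_neg (X n)"
    using ev by eventually_elim (auto simp: exp_neg_def)
  ultimately show ?thesis
    using real by (simp add: exp_neg_ennreal Lim_transform_eventually)
next
  case top
  show ?thesis
  proof (rule order_tendstoI)
    fix a assume "a < exp_neg x"
    then show "\<forall>\<^sub>F n in F. a < exp_neg (X n)"
      using top by (auto intro!: always_eventually less_le_trans[OF _ exp_neg_nonneg] simp flip: infinity_ennreal_def)
  next
    fix a assume "exp_neg x < a"
    then have a: "0 < a" using top by (simp flip: infinity_ennreal_def)
    \<comment> \<open>\<open>- ln a\<close> alone would give equality with \<open>a\<close>, hence
      the extra 1; the maximum with 0 prevents \<open>ennreal\<close> from truncating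
      \<open>K\<close>.\<close>
    define K where "K = max 0 (1 - ln a)"
    have "exp (- K) \<le> exp (ln a - 1)" unfolding K_def by simp
    also have "\<dots> < exp (ln a)" by simp
    also have "\<dots> = a" using a by simp
    finally have K: "exp_neg (ennreal K) < a" by (subst exp_neg_ennreal) (auto simp: K_def)
    have "\<forall>\<^sub>F n in F. ennreal K < X n"
      using assms top by (intro order_tendstoD) auto
    then show "\<forall>\<^sub>F n in F. exp_neg (X n) < a"
      by eventually_elim (blast intro: le_less_trans[OF exp_neg_antimono K] less_imp_le)
  qed
qed

lemma borel_measurable_exp_neg [measurable]: "exp_neg \<in> borel_measurable borel"
  unfolding exp_neg_def by measurable

text \<open>Inverse of \<open>exp_neg\<close> on [0,1]. It turns unordered products, including
  vanishing ones, into sums in [0, \<infinity>], where regrouping and Tonelli are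
  unconditional.\<close>

definition neg_ln :: "real \<Rightarrow> ennreal" where
  "neg_ln y = (if y \<le> 0 then \<infinity> else ennreal (- ln y))"

lemma exp_neg_neg_ln: "0 \<le> y \<Longrightarrow> y \<le> 1 \<Longrightarrow> exp_neg (neg_ln y) = y"
  by (auto simp: neg_ln_def exp_neg_ennreal simp flip: infinity_ennreal_def)

lemma neg_ln_exp_neg: "neg_ln (exp_neg x) = x"
  by (cases x) (auto simp: neg_ln_def exp_neg_ennreal simp flip: infinity_ennreal_def)

lemma borel_measurable_neg_ln [measurable]: "neg_ln \<in> borel_measurable borel"
  unfolding neg_ln_def by measurable

lemma one_minus_le_neg_ln: "ennreal (1 - y) \<le> neg_ln y"
  using ln_le_minus_one[of y] by (auto simp: neg_ln_def intro!: ennreal_leI)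

section \<open>Exhaustion of countable index sets by finite sets\<close>

definition first_elements :: "'b::countable set \<Rightarrow> nat \<Rightarrow> 'b set" where
  "first_elements A k = {x\<in>A. to_nat x < k}"

lemma finite_first_elements [simp]: "finite (first_elements A k)"
  by (rule finite_subset[OF _ finite_imageI[OF finite_lessThan[of k], of from_nat]])
     (force simp: first_elements_def image_iff)

lemma first_elements_subset: "first_elements A k \<subseteq> A"
  by (auto simp: first_elements_def)

text \<open>Replaces the net of finite subsets by one fixed sequence, since measurability of limits
  and dominated convergence are statements about sequences.\<close>

lemma filterlim_first_elements:
  "filterlim (first_elements A) (finite_subsets_at_top A) sequentially"
proof (subst filterlim_finite_subsets_at_top, intro allI impI)
  fix X assume X: "finite X \<and> X \<subseteq> A"
  then obtain m where m: "\<And>x. x \<in> X \<Longrightarrow> to_nat x < m"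
    using finite_nat_set_iff_bounded[of "to_nat ` X"] by auto
  show "\<forall>\<^sub>F k in sequentially. finite (first_elements A k) \<and> X \<subseteq> first_elements A k \<and> first_elements A k \<subseteq> A"
    using eventually_ge_at_top[of m]
  proof eventually_elim
    case (elim k)
    then have "X \<subseteq> first_elements A k"
      using X m by (auto simp: first_elements_def intro: less_le_trans)
    then show ?case by (simp add: first_elements_subset)
  qed
qed

lemma sum_first_elements_tendsto:
  fixes f :: "'b::countable \<Rightarrow> ennreal"
  shows "(\<lambda>k. sum f (first_elements A k)) \<longlonglongrightarrow> (\<integral>\<^sup>+x. f x \<partial>count_space A)"
proof -
  have "(\<lambda>k. \<integral>\<^sup>+x. f x * indicator (first_elements A k) x \<partial>count_space UNIV)
      \<longlonglongrightarrow> (\<integral>\<^sup>+x. f x * indicator A x \<partial>count_space UNIV)"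
  proof (rule nn_integral_LIMSEQ)
    show "incseq (\<lambda>k x. f x * indicator (first_elements A k) x)"
      by (auto simp: incseq_def le_fun_def first_elements_def indicator_def)
    fix x
    have "\<forall>\<^sub>F k in sequentially. f x * indicator (first_elements A k) x = f x * indicator A x"
      using eventually_gt_at_top[of "to_nat x"]
      by eventually_elim (auto simp: first_elements_def indicator_def)
    then show "(\<lambda>k. f x * indicator (first_elements A k) x) \<longlonglongrightarrow> f x * indicator A x"
      by (rule tendsto_eventually)
  qed auto
  moreover have "(\<integral>\<^sup>+x. f x * indicator (first_elements A k) x \<partial>count_space UNIV)
      = sum f (first_elements A k)" for k
    by (subst nn_integral_count_space'[of "first_elements A k"]) (auto simp: indicator_def)
  moreover have "(\<integral>\<^sup>+x. f x * indicator A x \<partial>count_space UNIV) = (\<integral>\<^sup>+x. f x \<partial>count_space A)"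
    by (simp add: nn_integral_count_space_indicator)
  ultimately show ?thesis by simp
qed

lemma infsum_eq_nn_integral_count_space:
  fixes f :: "'b::countable \<Rightarrow> ennreal"
  shows "infsum f A = (\<integral>\<^sup>+x. f x \<partial>count_space A)"
proof -
  have "f summable_on A"
    by (intro nonneg_summable_on_complete) simp
  then have "(sum f \<longlongrightarrow> infsum f A) (finite_subsets_at_top A)"
    using has_sum_infsum has_sum_def by blast
  from filterlim_compose[OF this filterlim_first_elements] show ?thesis
    by (rule LIMSEQ_unique) (rule sum_first_elements_tendsto)
qed

lemma prod_first_elements_tendsto:
  fixes f :: "'b::countable \<Rightarrow> real"
  assumes "\<And>x. x \<in> A \<Longrightarrow> 0 \<le> f x" "\<And>x. x \<in> A \<Longrightarrow> f x \<le> 1"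
  shows "(\<lambda>k. prod f (first_elements A k)) \<longlonglongrightarrow> infprod f A"
  using filterlim_compose[OF infprod_eq_INF(1)[OF assms] filterlim_first_elements] .

text \<open>The identity is clear for finite products; continuity of \<open>exp_neg\<close> carries
  it to the limit even if the sum is infinite and the product is 0.\<close>

lemma infprod_eq_exp_neg:
  fixes f :: "'b::countable \<Rightarrow> real"
  assumes "\<And>x. x \<in> A \<Longrightarrow> 0 \<le> f x" "\<And>x. x \<in> A \<Longrightarrow> f x \<le> 1"
  shows "infprod f A = exp_neg (\<integral>\<^sup>+x. neg_ln (f x) \<partial>count_space A)"
proof -
  have "exp_neg (\<Sum>x\<in>first_elements A k. neg_ln (f x)) = prod f (first_elements A k)" for k
    unfolding exp_neg_sum using assms first_elements_subset[of A k]
    by (intro prod.cong) (auto intro!: exp_neg_neg_ln)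
  then have "(\<lambda>k. prod f (first_elements A k)) \<longlonglongrightarrow> exp_neg (\<integral>\<^sup>+x. neg_ln (f x) \<partial>count_space A)"
    using tendsto_exp_neg[OF sum_first_elements_tendsto[of "\<lambda>x. neg_ln (f x)" A]] by simp
  with prod_first_elements_tendsto[OF assms] show ?thesis
    by (rule LIMSEQ_unique)
qed

lemma infprod_exp_neg:
  fixes f :: "'b::countable \<Rightarrow> ennreal"
  shows "infprod (\<lambda>x. exp_neg (f x)) A = exp_neg (\<integral>\<^sup>+x. f x \<partial>count_space A)"
  by (subst infprod_eq_exp_neg) (simp_all add: neg_ln_exp_neg)

lemma infprod_cong:
  assumes "\<And>x. x \<in> A \<Longrightarrow> f x = g x"
  shows "infprod f A = infprod g A"
proof -
  have "\<forall>\<^sub>F F in finite_subsets_at_top A. prod f F = prod g F"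
    using assms by (intro eventually_finite_subsets_at_top_weakI prod.cong) auto
  \<comment> \<open>\<open>Lim\<close> is a definite description, so it is enough that both nets
    have the same limits.\<close>
  then have "(prod f \<longlongrightarrow> l) (finite_subsets_at_top A) \<longleftrightarrow> (prod g \<longlongrightarrow> l) (finite_subsets_at_top A)" for l
    by (rule tendsto_cong)
  then show ?thesis
    unfolding infprod_def Topological_Spaces.Lim_def by presburger
qed

lemma infprod_bounds:
  fixes f :: "'b::countable \<Rightarrow> real"
  assumes "\<And>x. x \<in> A \<Longrightarrow> 0 \<le> f x" "\<And>x. x \<in> A \<Longrightarrow> f x \<le> 1"
  shows "0 \<le> infprod f A" "infprod f A \<le> 1"
  by (simp_all add: infprod_eq_exp_neg[OF assms])

text \<open>The telescoping bound for finite products with factors in [0,1], passed to the limit in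
  \<open>ennreal\<close>, where the right-hand side may be infinite.\<close>

lemma infprod_diff_le:
  fixes f g :: "'b::countable \<Rightarrow> real"
  assumes "\<And>x. x \<in> A \<Longrightarrow> 0 \<le> f x" "\<And>x. x \<in> A \<Longrightarrow> f x \<le> 1"
    and "\<And>x. x \<in> A \<Longrightarrow> 0 \<le> g x" "\<And>x. x \<in> A \<Longrightarrow> g x \<le> 1"
  shows "ennreal \<bar>infprod f A - infprod g A\<bar> \<le> (\<integral>\<^sup>+x. ennreal \<bar>f x - g x\<bar> \<partial>count_space A)"
proof (rule LIMSEQ_le)
  show "(\<lambda>k. ennreal \<bar>prod f (first_elements A k) - prod g (first_elements A k)\<bar>)
      \<longlonglongrightarrow> ennreal \<bar>infprod f A - infprod g A\<bar>"
    using assms by (intro tendsto_intros tendsto_ennrealI prod_first_elements_tendsto) auto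
  show "(\<lambda>k. \<Sum>x\<in>first_elements A k. ennreal \<bar>f x - g x\<bar>)
      \<longlonglongrightarrow> (\<integral>\<^sup>+x. ennreal \<bar>f x - g x\<bar> \<partial>count_space A)"
    by (rule sum_first_elements_tendsto)
  have "norm (prod f (first_elements A k) - prod g (first_elements A k))
      \<le> (\<Sum>x\<in>first_elements A k. norm (f x - g x))" for k
    using assms by (intro norm_prod_diff) (auto simp: first_elements_def)
  then show "\<exists>N. \<forall>n\<ge>N. ennreal \<bar>prod f (first_elements A n) - prod g (first_elements A n)\<bar>
      \<le> (\<Sum>x\<in>first_elements A n. ennreal \<bar>f x - g x\<bar>)"
    by (auto simp: ennreal_leI)
qed

text \<open>Convergence of the factors is not enough: if at stage \<open>n\<close> only the
  \<open>n\<close>-th factor is 0 and the others are 1, all products vanish although every factor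
  tends to 1. A summable bound on the defects excludes this.\<close>

lemma infprod_dominated_convergence:
  fixes f :: "nat \<Rightarrow> 'b::countable \<Rightarrow> real"
  assumes "\<And>n x. x \<in> A \<Longrightarrow> 0 \<le> f n x" "\<And>n x. x \<in> A \<Longrightarrow> f n x \<le> 1"
    and dom: "\<And>n x. x \<in> A \<Longrightarrow> 1 - f n x \<le> b x" "(\<integral>\<^sup>+x. ennreal (b x) \<partial>count_space A) < \<infinity>"
    and lim: "\<And>x. x \<in> A \<Longrightarrow> (\<lambda>n. f n x) \<longlonglongrightarrow> g x"
  shows "(\<lambda>n. infprod (f n) A) \<longlonglongrightarrow> infprod g A"
proof -
  have g: "0 \<le> g x" "g x \<le> 1" "1 - g x \<le> b x" if "x \<in> A" for x
  proof -
    show "0 \<le> g x" by (rule LIMSEQ_le_const[OF lim[OF that]]) (use assms that in auto)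
    show "g x \<le> 1" by (rule LIMSEQ_le_const2[OF lim[OF that]]) (use assms that in auto)
    have "1 - b x \<le> g x"
      by (rule LIMSEQ_le_const[OF lim[OF that]]) (use dom(1)[OF that] in \<open>auto simp: algebra_simps\<close>)
    then show "1 - g x \<le> b x" by simp
  qed
  have "(\<lambda>n. \<integral>\<^sup>+x. ennreal \<bar>f n x - g x\<bar> \<partial>count_space A) \<longlonglongrightarrow> (\<integral>\<^sup>+x. 0 \<partial>count_space A)"
  proof (rule nn_integral_dominated_convergence[where w="\<lambda>x. ennreal (b x)"])
    show "AE x in count_space A. ennreal \<bar>f j x - g x\<bar> \<le> ennreal (b x)" for j
    proof (rule AE_I2, rule ennreal_leI)
      fix x assume "x \<in> space (count_space A)"
      then have "x \<in> A" by simp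
      \<comment> \<open>Both values lie between \<open>1 - b x\<close> and 1.\<close>
      then show "\<bar>f j x - g x\<bar> \<le> b x"
        using g[of x] dom(1)[of x j] assms(1,2)[of x j] by simp
    qed
    show "AE x in count_space A. (\<lambda>n. ennreal \<bar>f n x - g x\<bar>) \<longlonglongrightarrow> 0"
    proof (rule AE_I2)
      fix x assume "x \<in> space (count_space A)"
      then have "(\<lambda>n. ennreal \<bar>f n x - g x\<bar>) \<longlonglongrightarrow> ennreal \<bar>g x - g x\<bar>"
        using lim by (intro tendsto_ennrealI tendsto_intros) auto
      then show "(\<lambda>n. ennreal \<bar>f n x - g x\<bar>) \<longlonglongrightarrow> 0" by simp
    qed
  qed (use dom in auto)
  then have sum_0: "(\<lambda>n. \<integral>\<^sup>+x. ennreal \<bar>f n x - g x\<bar> \<partial>count_space A) \<longlonglongrightarrow> 0" by simp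
  have le: "ennreal \<bar>infprod (f n) A - infprod g A\<bar> \<le> (\<integral>\<^sup>+x. ennreal \<bar>f n x - g x\<bar> \<partial>count_space A)" for n
    by (rule infprod_diff_le) (fact assms(1,2) g)+
  have "(\<lambda>n. ennreal \<bar>infprod (f n) A - infprod g A\<bar>) \<longlonglongrightarrow> ennreal 0"
    unfolding ennreal_0
    by (rule tendsto_sandwich[OF _ _ tendsto_const sum_0]) (simp_all add: le)
  then have "(\<lambda>n. \<bar>infprod (f n) A - infprod g A\<bar>) \<longlonglongrightarrow> 0"
    by (subst (asm) tendsto_ennreal_iff) auto
  then show ?thesis
    by (rule LIM_zero_cancel[OF tendsto_rabs_zero_cancel])
qed

text \<open>A nonzero product has a finite sum of \<open>neg_ln\<close>, and
  \<open>1 - y \<le> - ln y\<close> compares the defects with it.\<close>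

lemma sum_one_minus_finite_if_infprod_pos:
  fixes f :: "'b::countable \<Rightarrow> real"
  assumes "\<And>x. x \<in> A \<Longrightarrow> 0 \<le> f x" "\<And>x. x \<in> A \<Longrightarrow> f x \<le> 1" and pos: "infprod f A \<noteq> 0"
  shows "(\<integral>\<^sup>+x. ennreal (1 - f x) \<partial>count_space A) < \<infinity>"
proof -
  have "(\<integral>\<^sup>+x. ennreal (1 - f x) \<partial>count_space A) \<le> (\<integral>\<^sup>+x. neg_ln (f x) \<partial>count_space A)"
    by (intro nn_integral_mono one_minus_le_neg_ln)
  also have "\<dots> < \<infinity>"
    using infprod_eq_exp_neg[of A f] assms by (simp add: exp_neg_eq_0_iff top.not_eq_extremum)
  finally show ?thesis .
qed

lemma borel_measurable_nn_integral_count_space [measurable (raw)]: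
  fixes f :: "'a \<Rightarrow> 'b::countable \<Rightarrow> ennreal"
  assumes [measurable]: "\<And>x. x \<in> A \<Longrightarrow> (\<lambda>\<omega>. f \<omega> x) \<in> borel_measurable N"
  shows "(\<lambda>\<omega>. \<integral>\<^sup>+x. f \<omega> x \<partial>count_space A) \<in> borel_measurable N"
proof (rule borel_measurable_LIMSEQ_order)
  show "(\<lambda>\<omega>. \<Sum>x\<in>first_elements A i. f \<omega> x) \<in> borel_measurable N" for i
    using first_elements_subset[of A i] by (intro borel_measurable_sum) auto
qed (rule sum_first_elements_tendsto)

lemma borel_measurable_infprod:
  fixes f :: "'a \<Rightarrow> 'b::countable \<Rightarrow> real"
  assumes [measurable]: "\<And>x. x \<in> A \<Longrightarrow> (\<lambda>\<omega>. f \<omega> x) \<in> borel_measurable N"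
    and "\<And>\<omega> x. \<omega> \<in> space N \<Longrightarrow> x \<in> A \<Longrightarrow> 0 \<le> f \<omega> x"
    and "\<And>\<omega> x. \<omega> \<in> space N \<Longrightarrow> x \<in> A \<Longrightarrow> f \<omega> x \<le> 1"
  shows "(\<lambda>\<omega>. infprod (f \<omega>) A) \<in> borel_measurable N"
proof -
  have "(\<lambda>\<omega>. exp_neg (\<integral>\<^sup>+x. neg_ln (f \<omega> x) \<partial>count_space A)) \<in> borel_measurable N"
    by measurable
  then show ?thesis
    by (rule measurable_cong[THEN iffD1, rotated]) (use assms in \<open>auto simp: infprod_eq_exp_neg\<close>)
qed

section \<open>Laplace transforms on the half-line\<close>

text \<open>On a bounded interval the characteristic function is the sum of its moment series, since
  the remainder is at most \<open>2 * \<bar>t\<bar> ^ n / fact n\<close>; Levy's uniqueness theorem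
  then applies.\<close>

lemma real_distribution_eqI_moments:
  fixes P Q :: "real measure"
  assumes "real_distribution P" "real_distribution Q"
    and bounded: "AE x in P. \<bar>x\<bar> \<le> 1" "AE x in Q. \<bar>x\<bar> \<le> 1"
    and moments: "\<And>k::nat. (\<integral>x. x ^ k \<partial>P) = (\<integral>x. x ^ k \<partial>Q)"
  shows "P = Q"
proof (rule Levy_uniqueness[OF assms(1,2)], rule ext)
  fix t
  have *: "(\<lambda>n. \<Sum>k\<le>n. ((\<i> * t) ^ k / fact k) * (\<integral>x. x ^ k \<partial>R)) \<longlonglongrightarrow> char R t"
    if R: "real_distribution R" "AE x in R. \<bar>x\<bar> \<le> 1" for R :: "real measure"
  proof -
    interpret R: real_distribution R by fact
    have int: "integrable R (\<lambda>x. x ^ k)" for k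
      using R(2) by (intro R.integrable_const_bound[where B=1]) (auto elim!: eventually_mono simp: power_abs power_le_one)
    have bound: "cmod (char R t - (\<Sum>k\<le>n. ((\<i> * t) ^ k / fact k) * (\<integral>x. x ^ k \<partial>R)))
        \<le> 2 * (\<bar>t\<bar> ^ n / fact n)" for n
    proof -
      have "(\<integral>x. \<bar>x\<bar> ^ n \<partial>R) \<le> 1"
      proof (rule R.integral_le_const)
        show "integrable R (\<lambda>x. \<bar>x\<bar> ^ n)"
          using integrable_abs[OF int[of n]] by (simp add: power_abs)
        show "AE x in R. \<bar>x\<bar> ^ n \<le> 1"
          using R(2) by eventually_elim (simp add: power_le_one)
      qed
      then have "(2 * \<bar>t\<bar> ^ n / fact n) * (\<integral>x. \<bar>x\<bar> ^ n \<partial>R) \<le> 2 * \<bar>t\<bar> ^ n / fact n"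
        by (intro mult_left_le) auto
      with R.char_approx1[where n=n and t=t, OF int] show ?thesis by simp
    qed
    have "(\<lambda>n. 2 * (\<bar>t\<bar> ^ n / fact n)) \<longlonglongrightarrow> 0"
      using tendsto_mult[OF tendsto_const[of 2] summable_LIMSEQ_zero[OF summable_exp[of "\<bar>t\<bar>"]]]
      by (simp add: field_simps)
    then have "(\<lambda>n. char R t - (\<Sum>k\<le>n. ((\<i> * t) ^ k / fact k) * (\<integral>x. x ^ k \<partial>R))) \<longlonglongrightarrow> 0"
      by (rule Lim_null_comparison[OF always_eventually[OF allI[OF bound]]])
    from tendsto_diff[OF tendsto_const[of "char R t"] this] show ?thesis by simp
  qed
  show "char P t = char Q t"
    using *[OF assms(1) bounded(1)] *[OF assms(2) bounded(2)]
    unfolding moments by (rule LIMSEQ_unique)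
qed

lemma exp_neg_of_nat_mult: "exp_neg (of_nat k * x) = exp_neg x ^ k"
  by (induction k) (simp_all add: exp_neg_add distrib_right)

text \<open>
  Under \<^const>\<open>exp_neg\<close>, the values of the Laplace transform at the natural numbers become the
  moments of a distribution on [0, 1].
\<close>
lemma prob_space_ennreal_eqI:
  fixes P Q :: "ennreal measure"
  assumes P: "prob_space P" "sets P = sets borel" and Q: "prob_space Q" "sets Q = sets borel"
    and eq: "\<And>t. 0 \<le> t \<Longrightarrow> (\<integral>x. exp_neg (ennreal t * x) \<partial>P) = (\<integral>x. exp_neg (ennreal t * x) \<partial>Q)"
  shows "P = Q"
proof -
  have meas [measurable]: "exp_neg \<in> borel_measurable R" if "sets R = sets borel" for R
    using that by (simp cong: measurable_cong_sets)
  \<comment> \<open>\<open>neg_ln\<close> is a measurable left inverse of \<open>exp_neg\<close>, so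
    a law on [0, \<infinity>] is recovered from its image on [0,1]; mass at infinity becomes an atom
    at 0.\<close>
  have recover: "R = distr (distr R borel exp_neg) borel neg_ln" if R: "sets R = sets borel" for R
  proof -
    have "distr (distr R borel exp_neg) borel neg_ln = distr R borel (\<lambda>x. x)"
      by (subst distr_distr) (simp_all add: meas R comp_def neg_ln_exp_neg)
    also have "\<dots> = R" using R distr_id2 by metis
    finally show ?thesis ..
  qed
  have "distr P borel exp_neg = distr Q borel exp_neg"
  proof (rule real_distribution_eqI_moments)
    show "real_distribution (distr P borel exp_neg)" "real_distribution (distr Q borel exp_neg)"
      by (rule prob_space.real_distribution_distr[OF P(1) meas[OF P(2)]])
         (rule prob_space.real_distribution_distr[OF Q(1) meas[OF Q(2)]])
    show "AE x in distr P borel exp_neg. \<bar>x\<bar> \<le> 1" "AE x in distr Q borel exp_neg. \<bar>x\<bar> \<le> 1"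
      using P Q by (auto simp: AE_distr_iff meas)
    fix k :: nat
    have "(\<integral>x. x ^ k \<partial>distr R borel exp_neg) = (\<integral>x. exp_neg (ennreal (real k) * x) \<partial>R)"
      if "sets R = sets borel" for R
      using meas[OF that] by (simp add: integral_distr exp_neg_of_nat_mult flip: ennreal_of_nat_eq_real_of_nat)
    then show "(\<integral>x. x ^ k \<partial>distr P borel exp_neg) = (\<integral>x. x ^ k \<partial>distr Q borel exp_neg)"
      using P Q eq[of "real k"] by simp
  qed
  then show ?thesis using recover P(2) Q(2) by metis
qed

section \<open>Elementary estimates for Laplace transforms of laws on the half-line\<close>

locale nonneg_distribution = real_distribution P for P :: "real measure" +
  assumes AE_nonneg: "AE x in P. 0 \<le> x"
begin

lemma laplace_transform_eq:
  assumes "0 \<le> t"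
  shows "laplace_transform P t = (\<integral>x. exp_neg (ennreal t * ennreal x) \<partial>P)"
  unfolding laplace_transform_def
  using AE_nonneg assms
  by (intro integral_cong_AE) (auto elim!: eventually_mono simp: exp_neg_ennreal simp flip: ennreal_mult)

lemma laplace_transform_nonneg: "0 \<le> laplace_transform P t"
  by (simp add: laplace_transform_def)

lemma integrable_exp: "0 \<le> t \<Longrightarrow> integrable P (\<lambda>x. exp (- t * x))"
  using AE_nonneg by (intro integrable_const_bound[where B=1]) (auto elim!: eventually_mono)

lemma laplace_transform_le_1:
  assumes "0 \<le> t"
  shows "laplace_transform P t \<le> 1"
  unfolding laplace_transform_def
  using AE_nonneg assms by (intro integral_le_const integrable_exp) (auto elim!: eventually_mono)

lemma borel_measurable_laplace_transform [measurable]: "laplace_transform P \<in> borel_measurable borel"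
  unfolding laplace_transform_def[abs_def] by measurable

text \<open>From \<open>2 * y - 1 \<le> y\<^sup>2\<close> with \<open>y = exp (- t * x)\<close>. It
  makes divergence of a sum of defects at scale \<open>t\<close> persist at all scales
  \<open>t / 2 ^ k\<close>.\<close>

lemma laplace_transform_double:
  assumes "0 \<le> t"
  shows "1 - laplace_transform P (2 * t) \<le> 2 * (1 - laplace_transform P t)"
proof -
  have "laplace_transform P (2 * t) \<ge> (\<integral>x. 2 * exp (- t * x) - 1 \<partial>P)"
    unfolding laplace_transform_def
  proof (rule integral_mono)
    show "integrable P (\<lambda>x. exp (- (2 * t) * x))" using assms by (intro integrable_exp) simp
    show "integrable P (\<lambda>x. 2 * exp (- t * x) - 1)" using integrable_exp[OF assms] by simp
    fix x
    have "0 \<le> (exp (- t * x) - 1)\<^sup>2" by simp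
    then show "2 * exp (- t * x) - 1 \<le> exp (- (2 * t) * x)"
      by (simp add: power2_eq_square algebra_simps flip: exp_add)
  qed
  then show ?thesis
    using integrable_exp[OF assms] by (simp add: laplace_transform_def prob_space[simplified])
qed

lemma laplace_transform_tendsto_1: "(\<lambda>k. laplace_transform P (t / 2 ^ k)) \<longlonglongrightarrow> 1" if "0 \<le> t"
proof -
  have "(\<lambda>k. \<integral>x. exp (- (t / 2 ^ k) * x) \<partial>P) \<longlonglongrightarrow> (\<integral>x. 1 \<partial>P)"
  proof (rule integral_dominated_convergence[where w="\<lambda>_. 1"])
    have "(\<lambda>k. t / 2 ^ k) \<longlonglongrightarrow> 0"
      by (rule LIMSEQ_divide_realpow_zero) simp
    then have "(\<lambda>k. exp (- (t / 2 ^ k) * x)) \<longlonglongrightarrow> exp (- 0 * x)" for x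
      by (intro tendsto_intros)
    then show "AE x in P. (\<lambda>k. exp (- (t / 2 ^ k) * x)) \<longlonglongrightarrow> 1"
      by simp
    show "AE x in P. norm (exp (- (t / 2 ^ k) * x)) \<le> 1" for k
      using AE_nonneg that by (auto elim!: eventually_mono)
  qed auto
  then show ?thesis by (simp add: laplace_transform_def prob_space[simplified])
qed

text \<open>Beyond \<open>1 / t\<close> the exponential is at most
  \<open>exp (- 1) \<le> 1 / 2\<close>; this is the origin of the factor 2.\<close>

lemma tail_le_laplace_transform:
  assumes "0 < t"
  shows "measure P {1 / t<..} \<le> 2 * (1 - laplace_transform P t)"
proof -
  have "measure P {1 / t<..} = (\<integral>x. indicator {1 / t<..} x \<partial>P)" by simp
  also have "\<dots> \<le> (\<integral>x. 2 * (1 - exp (- t * x)) \<partial>P)"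
  proof (rule integral_mono_AE)
    show "integrable P (indicator {1 / t<..} :: real \<Rightarrow> real)"
      by (intro integrable_const_bound[where B=1]) (auto simp: indicator_def)
    show "integrable P (\<lambda>x. 2 * (1 - exp (- t * x)))"
      using integrable_exp[of t] assms by simp
    show "AE x in P. indicator {1 / t<..} x \<le> 2 * (1 - exp (- t * x))"
      using AE_nonneg
    proof eventually_elim
      case (elim x)
      have "exp (- t * x) \<le> 1 / 2" if "1 / t < x"
      proof -
        have "exp (- t * x) \<le> exp (- 1)" using that assms by (simp add: field_simps)
        also have "\<dots> \<le> 1 / 2" using exp_ge_add_one_self[of 1] by (simp add: exp_minus field_simps)
        finally show ?thesis .
      qed
      then show ?case using elim assms by (auto simp: indicator_def)
    qed
  qed
  also have "\<dots> = 2 * (1 - laplace_transform P t)"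
    using integrable_exp[of t] assms by (simp add: laplace_transform_def prob_space[simplified])
  finally show ?thesis .
qed

end

text \<open>The continuity theorem for Laplace transforms. The lower bound \<open>h\<close> is
  uniform in \<open>n\<close> and close to 1 near the origin, which yields tightness; a weakly
  convergent subsequence suffices, since the transforms converge along the whole sequence.\<close>

lemma laplace_transform_limit:
  fixes P :: "nat \<Rightarrow> real measure" and g h :: "real \<Rightarrow> real"
  assumes P: "\<And>n. nonneg_distribution (P n)"
    and lower: "\<And>n t. 0 \<le> t \<Longrightarrow> h t \<le> laplace_transform (P n) t"
    and h: "(\<lambda>k. h (1 / 2 ^ k)) \<longlonglongrightarrow> 1"
    and lim: "\<And>t. 0 \<le> t \<Longrightarrow> (\<lambda>n. laplace_transform (P n) t) \<longlonglongrightarrow> g t"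
  shows "\<exists>Q. nonneg_distribution Q \<and> (\<forall>t\<ge>0. g t = laplace_transform Q t)"
proof -
  interpret P: nonneg_distribution "P n" for n by fact
  have "tight P"
    unfolding tight_def
  proof (intro conjI allI impI)
    show "real_distribution (P n)" for n by unfold_locales
    fix \<epsilon> :: real assume "0 < \<epsilon>"
    then have "\<forall>\<^sub>F k in sequentially. 1 - \<epsilon> / 2 < h (1 / 2 ^ k)"
      using h by (intro order_tendstoD) auto
    then obtain k where k: "1 - \<epsilon> / 2 < h (1 / 2 ^ k)"
      using eventually_happens sequentially_bot by blast
    \<comment> \<open>The tail bound at \<open>t = 1 / 2 ^ k\<close> costs a factor 2, which
      explains \<open>\<epsilon> / 2\<close> above; the left end \<open>-1\<close> keeps an atom at
      0 inside the half-open interval.\<close>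
    have "measure (P n) {-1<..2 ^ k} > 1 - \<epsilon>" for n
    proof -
      have "1 - measure (P n) {2 ^ k<..} = measure (P n) (UNIV - {2 ^ k<..})"
        using P.prob_compl[of "{2 ^ k<..}" n] by simp
      also have "\<dots> = measure (P n) {-1<..2 ^ k}"
        using P.AE_nonneg[of n] by (intro P.finite_measure_eq_AE) (auto elim!: eventually_mono)
      finally show ?thesis
        using P.tail_le_laplace_transform[of "1 / 2 ^ k" n] lower[of "1 / 2 ^ k" n] k by simp
    qed
    moreover have "(- 1 :: real) < 2 ^ k" by (rule less_trans[of _ 0]) auto
    ultimately show "\<exists>a b. a < b \<and> (\<forall>n. 1 - \<epsilon> < measure (P n) {a<..b})" by blast
  qed
  from tight_imp_convergent_subsubsequence[OF this strict_mono_id]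
  obtain r Q where r: "strict_mono r" and Q: "real_distribution Q" and conv: "weak_conv_m (P \<circ> r) Q"
    by auto
  interpret Q: real_distribution Q by fact
  have conv: "(\<lambda>n. \<integral>x. f x \<partial>P (r n)) \<longlonglongrightarrow> (\<integral>x. f x \<partial>Q)"
    if "\<And>x. isCont f x" "\<And>x. norm (f x) \<le> 1" for f :: "real \<Rightarrow> real"
    using weak_conv_imp_integral_bdd_continuous_conv[OF _ Q conv that]
      P.real_distribution_axioms by simp
  have Q_nonneg: "AE x in Q. 0 \<le> x"
  proof -
    \<comment> \<open>Weak convergence only tests bounded continuous functions; this one vanishes
      exactly on the half-line.\<close>
    let ?f = "\<lambda>x::real. min 1 (max 0 (- x))"
    have [measurable]: "?f \<in> borel_measurable borel" by measurable
    have "(\<integral>x. ?f x \<partial>P n) = (\<integral>x. 0 \<partial>P n)" for n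
      using P.AE_nonneg[of n] by (intro integral_cong_AE) (auto elim!: eventually_mono)
    moreover have "(\<lambda>n. \<integral>x. ?f x \<partial>P (r n)) \<longlonglongrightarrow> (\<integral>x. ?f x \<partial>Q)"
      by (intro conv continuous_intros) auto
    ultimately have "(\<integral>x. ?f x \<partial>Q) = 0"
      by (simp add: LIMSEQ_const_iff)
    moreover have "integrable Q ?f"
      by (intro Q.integrable_const_bound[where B=1]) auto
    ultimately have "AE x in Q. ?f x = 0"
      by (subst (asm) integral_nonneg_eq_0_iff_AE) auto
    then show ?thesis by eventually_elim (auto simp: min_def max_def split: if_splits)
  qed
  then interpret Q: nonneg_distribution Q by unfold_locales
  have "g t = laplace_transform Q t" if t: "0 \<le> t" for t
  proof -
    \<comment> \<open>The exponential is unbounded on the negative axis for \<open>t > 0\<close>.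
      Truncating its argument gives a bounded continuous test function without affecting laws on the
      half-line.\<close>
    let ?f = "\<lambda>x::real. exp (- t * max 0 x)"
    have eq: "(\<integral>x. ?f x \<partial>R) = laplace_transform R t" if "nonneg_distribution R" for R
    proof -
      interpret R: nonneg_distribution R by fact
      show ?thesis
        unfolding laplace_transform_def
      proof (rule integral_cong_AE)
        show "AE x in R. ?f x = exp (- t * x)"
          using R.AE_nonneg by eventually_elim (simp add: max_def)
      qed auto
    qed
    have "(\<lambda>n. \<integral>x. ?f x \<partial>P (r n)) \<longlonglongrightarrow> (\<integral>x. ?f x \<partial>Q)"
      using t by (intro conv) (auto intro!: continuous_intros)
    then have "(\<lambda>n. laplace_transform (P (r n)) t) \<longlonglongrightarrow> laplace_transform Q t"
      by (simp only: eq[OF P] eq[OF Q.nonneg_distribution_axioms])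
    moreover have "(\<lambda>n. laplace_transform (P (r n)) t) \<longlonglongrightarrow> g t"
      using LIMSEQ_subseq_LIMSEQ[OF lim[OF t] r] by (simp add: comp_def)
    ultimately show ?thesis by (rule LIMSEQ_unique[rotated])
  qed
  then show ?thesis using Q.nonneg_distribution_axioms by blast
qed

section \<open>The smoothing operator\<close>

text \<open>Independence factorizes the mean for finitely many terms. The passage to the series
  allows divergence, because \<open>exp_neg\<close> is continuous at infinity.\<close>

lemma (in nonneg_distribution) laplace_transform_weighted_sum:
  assumes a: "\<And>i. 0 \<le> a i"
  shows "(\<integral>x. exp_neg (\<Sum>i. ennreal (a i) * ennreal (x i)) \<partial>(\<Pi>\<^sub>M i\<in>(UNIV :: nat set). P))
    = infprod (\<lambda>i. laplace_transform P (a i)) UNIV"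
proof -
  let ?Q = "\<Pi>\<^sub>M i\<in>(UNIV :: nat set). P"
  interpret Q: prob_space ?Q
    by (intro prob_space_PiM) unfold_locales
  have sets_Q: "sets ?Q = sets (\<Pi>\<^sub>M i\<in>(UNIV :: nat set). borel)"
    by (intro sets_PiM_cong) simp_all
  have coordinate [measurable]: "(\<lambda>x. x i) \<in> borel_measurable ?Q" for i
    using measurable_component_singleton[of i UNIV "\<lambda>_. P"] by simp
  have "distr ?Q borel (\<lambda>x. x i) = distr ?Q P (\<lambda>x. x i)" for i
    by (intro distr_cong) simp_all
  also have "\<dots> i = P" for i
    by (rule distr_PiM_component) (simp_all, unfold_locales)
  finally have marginal: "distr ?Q borel (\<lambda>x. x i) = P" for i .
  have "distr ?Q (\<Pi>\<^sub>M i\<in>UNIV. borel) (\<lambda>x. x) = ?Q"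
    using distr_id2[OF sets_Q[symmetric]] by simp
  then have "Q.indep_vars (\<lambda>_. borel) (\<lambda>i x. x i) UNIV"
    by (subst Q.indep_vars_iff_distr_eq_PiM') (simp_all add: marginal restrict_UNIV)
  then have "Q.indep_vars (\<lambda>_. borel) (\<lambda>i x. exp_neg (ennreal (a i) * ennreal (x i))) UNIV"
    by (rule Q.indep_vars_compose2) measurable
  then have indep: "Q.indep_vars (\<lambda>_. borel) (\<lambda>i x. exp_neg (ennreal (a i) * ennreal (x i))) {..<k}" for k
    by (rule Q.indep_vars_subset) simp
  have one: "(\<integral>x. exp_neg (ennreal (a i) * ennreal (x i)) \<partial>?Q) = laplace_transform P (a i)" for i
  proof -
    have "(\<integral>x. exp_neg (ennreal (a i) * ennreal (x i)) \<partial>?Q)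
        = (\<integral>y. exp_neg (ennreal (a i) * ennreal y) \<partial>distr ?Q borel (\<lambda>x. x i))"
      by (subst integral_distr) measurable
    then show ?thesis by (simp add: marginal laplace_transform_eq[OF a])
  qed
  have "(\<integral>x. exp_neg (\<Sum>i<k. ennreal (a i) * ennreal (x i)) \<partial>?Q)
      = (\<Prod>i<k. laplace_transform P (a i))" for k
    unfolding exp_neg_sum one[symmetric]
    by (rule Q.indep_vars_lebesgue_integral[OF _ indep])
       (auto intro!: Q.integrable_const_bound[where B=1])
  moreover have "(\<lambda>k. \<Prod>i<k. laplace_transform P (a i))
      \<longlonglongrightarrow> infprod (\<lambda>i. laplace_transform P (a i)) UNIV"
    using a laplace_transform_nonneg laplace_transform_le_1
    by (intro filterlim_compose[OF infprod_eq_INF(1) filterlim_lessThan_at_top]) auto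
  moreover have "(\<lambda>k. \<integral>x. exp_neg (\<Sum>i<k. ennreal (a i) * ennreal (x i)) \<partial>?Q)
      \<longlonglongrightarrow> (\<integral>x. exp_neg (\<Sum>i. ennreal (a i) * ennreal (x i)) \<partial>?Q)"
    by (rule integral_dominated_convergence[where w="\<lambda>_. 1"])
       (auto intro!: tendsto_exp_neg summable_LIMSEQ)
  ultimately show ?thesis
    using LIMSEQ_unique by fastforce
qed

definition unit_function :: "(real \<Rightarrow> real) \<Rightarrow> bool" where
  "unit_function f \<longleftrightarrow> f \<in> borel_measurable borel \<and> (\<forall>s. 0 \<le> f s \<and> f s \<le> 1)"

lemma unit_functionD:
  assumes "unit_function f"
  shows "f \<in> borel_measurable borel" "0 \<le> f s" "f s \<le> 1"
  using assms by (auto simp: unit_function_def)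

text \<open>At negative arguments the transform may exceed 1, or take the value 0 that the integral
  assigns to a non-integrable function. The absolute value repairs this and changes nothing at the
  non-negative arguments that occur.\<close>

lemma (in nonneg_distribution) unit_function_laplace_transform:
  "unit_function (\<lambda>s. laplace_transform P \<bar>s\<bar>)"
  using laplace_transform_nonneg laplace_transform_le_1 by (auto simp: unit_function_def)

text \<open>If \<open>f\<close> is the Laplace transform of the i.i.d. variables in the fixed-point
  equation, this is the conditional Laplace transform of the right-hand side given the
  weights.\<close>

definition smoothing_kernel ::
    "('a \<Rightarrow> real) \<Rightarrow> (nat \<Rightarrow> 'a \<Rightarrow> real) \<Rightarrow> (real \<Rightarrow> real) \<Rightarrow> real \<Rightarrow> 'a \<Rightarrow> real" where
  "smoothing_kernel c \<tau> f t \<omega> = exp_neg (ennreal t * ennreal (c \<omega>)) * infprod (\<lambda>i. f (\<tau> i \<omega> * t)) UNIV"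

definition smoothing ::
    "'a measure \<Rightarrow> ('a \<Rightarrow> real) \<Rightarrow> (nat \<Rightarrow> 'a \<Rightarrow> real) \<Rightarrow> (real \<Rightarrow> real) \<Rightarrow> real \<Rightarrow> real" where
  "smoothing N c \<tau> f t = (\<integral>\<omega>. smoothing_kernel c \<tau> f t \<omega> \<partial>N)"

lemma smoothing_kernel_bounds:
  assumes "\<And>i. 0 \<le> f (\<tau> i \<omega> * t)" "\<And>i. f (\<tau> i \<omega> * t) \<le> 1"
  shows "0 \<le> smoothing_kernel c \<tau> f t \<omega>" "smoothing_kernel c \<tau> f t \<omega> \<le> 1"
  using infprod_bounds[of UNIV "\<lambda>i. f (\<tau> i \<omega> * t)"] assms
  by (auto simp: smoothing_kernel_def intro!: mult_le_one)

text \<open>The data at one node of the tree. Interpreting the locale a second time with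
  \<open>c = 0\<close>, as \<open>hom\<close>, makes every result available for the homogeneous
  equation.\<close>

locale random_weights = prob_space N
  for N :: "'a measure" and c :: "'a \<Rightarrow> real" and \<tau> :: "nat \<Rightarrow> 'a \<Rightarrow> real" +
  assumes c_measurable [measurable]: "c \<in> borel_measurable N"
    and \<tau>_measurable [measurable]: "\<And>i. \<tau> i \<in> borel_measurable N"
    and c_nonneg: "\<And>\<omega>. \<omega> \<in> space N \<Longrightarrow> 0 \<le> c \<omega>"
    and \<tau>_nonneg: "\<And>i \<omega>. \<omega> \<in> space N \<Longrightarrow> 0 \<le> \<tau> i \<omega>"
begin

lemma smoothing_kernel_measurable:
  assumes f: "unit_function f"
  shows "(\<lambda>(s, \<omega>). smoothing_kernel c \<tau> f s \<omega>) \<in> borel_measurable (borel \<Otimes>\<^sub>M N)"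
proof -
  note [measurable] = unit_functionD(1)[OF f]
  have [measurable]: "(\<lambda>x. infprod (\<lambda>i. f (\<tau> i (snd x) * fst x)) UNIV) \<in> borel_measurable (borel \<Otimes>\<^sub>M N)"
    by (rule borel_measurable_infprod) (simp_all add: unit_functionD[OF f])
  show ?thesis
    unfolding smoothing_kernel_def case_prod_beta by measurable
qed

lemma smoothing_kernel_measurable' [measurable (raw)]:
  assumes "unit_function f" "X \<in> borel_measurable R" "Y \<in> measurable R N"
  shows "(\<lambda>\<omega>. smoothing_kernel c \<tau> f (X \<omega>) (Y \<omega>)) \<in> borel_measurable R"
  using measurable_compose[OF measurable_Pair[OF assms(2,3)] smoothing_kernel_measurable[OF assms(1)]]
  by simp

lemma integrable_smoothing_kernel: "unit_function f \<Longrightarrow> integrable N (smoothing_kernel c \<tau> f t)"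
  by (intro integrable_const_bound[where B=1])
     (auto simp: abs_of_nonneg smoothing_kernel_bounds unit_functionD)

lemma unit_function_smoothing:
  assumes f: "unit_function f"
  shows "unit_function (smoothing N c \<tau> f)"
  unfolding unit_function_def
proof (intro conjI allI)
  show "smoothing N c \<tau> f \<in> borel_measurable borel"
    unfolding smoothing_def[abs_def]
    using smoothing_kernel_measurable[OF f] by (rule borel_measurable_lebesgue_integral)
  show "0 \<le> smoothing N c \<tau> f s" for s
    unfolding smoothing_def by (simp add: smoothing_kernel_bounds unit_functionD[OF f])
  show "smoothing N c \<tau> f s \<le> 1" for s
    unfolding smoothing_def
    by (intro integral_le_const integrable_smoothing_kernel[OF f])
       (simp add: smoothing_kernel_bounds unit_functionD[OF f])
qed

lemma smoothing_cong:
  assumes "\<And>s. 0 \<le> s \<Longrightarrow> f s = g s" "0 \<le> t"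
  shows "smoothing N c \<tau> f t = smoothing N c \<tau> g t"
  unfolding smoothing_def smoothing_kernel_def
  by (intro Bochner_Integration.integral_cong refl arg_cong2[where f="(*)"] infprod_cong assms(1)
      mult_nonneg_nonneg \<tau>_nonneg assms(2))

lemma smoothing_dominated_convergence:
  assumes f: "\<And>n. unit_function (f n)" and g: "unit_function g" and t: "0 \<le> t"
    and lim: "\<And>s. 0 \<le> s \<Longrightarrow> (\<lambda>n. f n s) \<longlonglongrightarrow> g s"
    and dom: "\<And>n s. 0 \<le> s \<Longrightarrow> 1 - f n s \<le> b s"
    and finite: "AE \<omega> in N. (\<integral>\<^sup>+i. ennreal (b (\<tau> i \<omega> * t)) \<partial>count_space UNIV) < \<infinity>"
  shows "(\<lambda>n. smoothing N c \<tau> (f n) t) \<longlonglongrightarrow> smoothing N c \<tau> g t"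
  unfolding smoothing_def
proof (rule integral_dominated_convergence[where w="\<lambda>_. 1"])
  show "AE \<omega> in N. (\<lambda>n. smoothing_kernel c \<tau> (f n) t \<omega>) \<longlonglongrightarrow> smoothing_kernel c \<tau> g t \<omega>"
    using finite AE_space
  proof eventually_elim
    case (elim \<omega>)
    show ?case
      unfolding smoothing_kernel_def
      using elim t \<tau>_nonneg
      by (intro tendsto_intros infprod_dominated_convergence[where b="\<lambda>i. b (\<tau> i \<omega> * t)"] lim dom)
         (auto simp: unit_functionD[OF f])
  qed
  show "AE \<omega> in N. norm (smoothing_kernel c \<tau> (f n) t \<omega>) \<le> 1" for n
    by (simp add: abs_of_nonneg smoothing_kernel_bounds unit_functionD[OF f])
qed (use integrable_smoothing_kernel f g in \<open>auto dest: borel_measurable_integrable\<close>)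

end

text \<open>
  The product over \<open>v\<close> vanishes where the series diverges. By concavity the set of divergence does
  not depend on \<open>t > 0\<close>, and its probability is at most \<open>1 - laplace_transform P t \<rightarrow> 0\<close>.
\<close>
lemma (in prob_space) sum_one_minus_laplace_transform_finite:
  fixes L :: "'b::countable \<Rightarrow> 'a \<Rightarrow> real"
  assumes P: "nonneg_distribution P" and t: "0 \<le> t"
    and L [measurable]: "\<And>v. v \<in> A \<Longrightarrow> L v \<in> borel_measurable M"
    and L_nonneg: "\<And>v \<omega>. v \<in> A \<Longrightarrow> \<omega> \<in> space M \<Longrightarrow> 0 \<le> L v \<omega>"
    and lower: "\<And>s. 0 \<le> s \<Longrightarrow>
      laplace_transform P s \<le> (\<integral>\<omega>. infprod (\<lambda>v. laplace_transform P (L v \<omega> * s)) A \<partial>M)"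
  shows "AE \<omega> in M. (\<integral>\<^sup>+v. ennreal (1 - laplace_transform P (L v \<omega> * t)) \<partial>count_space A) < \<infinity>"
proof -
  interpret P: nonneg_distribution P by fact
  define S where "S s \<omega> = (\<integral>\<^sup>+v. ennreal (1 - laplace_transform P (L v \<omega> * s)) \<partial>count_space A)" for s \<omega>
  have [measurable]: "S s \<in> borel_measurable M" for s
    unfolding S_def by measurable
  define B where "B = {\<omega> \<in> space M. S t \<omega> = \<infinity>}"
  have [measurable]: "B \<in> sets M"
    unfolding B_def by measurable
  have double: "S (2 * s) \<omega> \<le> 2 * S s \<omega>" if "0 \<le> s" "\<omega> \<in> space M" for s \<omega>
  proof -
    have "S (2 * s) \<omega> \<le> (\<integral>\<^sup>+v. 2 * ennreal (1 - laplace_transform P (L v \<omega> * s)) \<partial>count_space A)"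
      unfolding S_def
    proof (rule nn_integral_mono)
      fix v assume "v \<in> space (count_space A)"
      then have "0 \<le> L v \<omega> * s" using that L_nonneg by simp
      then have "1 - laplace_transform P (L v \<omega> * (2 * s)) \<le> 2 * (1 - laplace_transform P (L v \<omega> * s))"
        using P.laplace_transform_double[of "L v \<omega> * s"] by (simp add: mult.left_commute)
      then have "ennreal (1 - laplace_transform P (L v \<omega> * (2 * s)))
          \<le> ennreal (2 * (1 - laplace_transform P (L v \<omega> * s)))"
        by (rule ennreal_leI)
      also have "\<dots> = 2 * ennreal (1 - laplace_transform P (L v \<omega> * s))"
        using P.laplace_transform_le_1[OF \<open>0 \<le> L v \<omega> * s\<close>] by (subst ennreal_mult) simp_all
      finally show "ennreal (1 - laplace_transform P (L v \<omega> * (2 * s)))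
          \<le> 2 * ennreal (1 - laplace_transform P (L v \<omega> * s))" .
    qed
    also have "\<dots> = 2 * S s \<omega>"
      unfolding S_def by (rule nn_integral_cmult) simp
    finally show ?thesis .
  qed
  have scaled: "S (t / 2 ^ k) \<omega> = \<infinity>" if "\<omega> \<in> B" for k \<omega>
  proof (induction k)
    case 0
    then show ?case using that by (simp add: B_def)
  next
    case (Suc k)
    then show ?case
      using double[of "t / 2 ^ Suc k" \<omega>] t that
      by (auto simp: B_def ennreal_mult_eq_top_iff top_unique)
  qed
  \<comment> \<open>On \<open>B\<close> the product vanishes at every scale
    \<open>t / 2 ^ k\<close>, so its mean is at most the probability of the complement.\<close>
  have "prob B \<le> 1 - laplace_transform P (t / 2 ^ k)" for k
  proof -
    define s where "s = t / 2 ^ k"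
    have s: "0 \<le> s" using t by (simp add: s_def)
    have bounds: "0 \<le> laplace_transform P (L v \<omega> * s)" "laplace_transform P (L v \<omega> * s) \<le> 1"
      if "v \<in> A" "\<omega> \<in> space M" for v \<omega>
      using that s L_nonneg by (simp_all add: P.laplace_transform_nonneg P.laplace_transform_le_1)
    have [measurable]: "(\<lambda>\<omega>. infprod (\<lambda>v. laplace_transform P (L v \<omega> * s)) A) \<in> borel_measurable M"
      by (rule borel_measurable_infprod) (use bounds in auto)
    have "laplace_transform P s \<le> (\<integral>\<omega>. infprod (\<lambda>v. laplace_transform P (L v \<omega> * s)) A \<partial>M)"
      by (rule lower[OF s])
    also have "\<dots> \<le> (\<integral>\<omega>. 1 - indicator B \<omega> \<partial>M)"
    proof (rule integral_mono)
      show "integrable M (\<lambda>\<omega>. infprod (\<lambda>v. laplace_transform P (L v \<omega> * s)) A)"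
        by (intro integrable_const_bound[where B=1] AE_I2)
           (simp_all add: abs_of_nonneg infprod_bounds bounds)
      show "integrable M (\<lambda>\<omega>. 1 - indicator B \<omega> :: real)"
        by (intro integrable_const_bound[where B=1]) (auto simp: indicator_def)
      fix \<omega> assume \<omega>: "\<omega> \<in> space M"
      show "infprod (\<lambda>v. laplace_transform P (L v \<omega> * s)) A \<le> 1 - indicator B \<omega>"
      proof (cases "\<omega> \<in> B")
        case True
        then have "infprod (\<lambda>v. laplace_transform P (L v \<omega> * s)) A = 0"
          using sum_one_minus_finite_if_infprod_pos[OF bounds[OF _ \<omega>]] scaled[of \<omega> k, folded s_def]
          by (force simp: S_def)
        then show ?thesis using True by simp
      qed (use infprod_bounds[OF bounds[OF _ \<omega>]] in simp)
    qed
    also have "\<dots> = 1 - prob B"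
      by (subst Bochner_Integration.integral_diff)
         (auto simp: prob_space emeasure_eq_measure intro!: integrable_real_indicator)
    finally show ?thesis by (simp add: s_def)
  qed
  moreover have "(\<lambda>k. 1 - laplace_transform P (t / 2 ^ k)) \<longlonglongrightarrow> 1 - 1"
    by (intro tendsto_intros P.laplace_transform_tendsto_1 t)
  ultimately have "prob B \<le> 0"
    by (intro LIMSEQ_le_const[where X="\<lambda>k. 1 - laplace_transform P (t / 2 ^ k)"]) auto
  then have "prob B = 0" by (simp add: measure_le_0_iff)
  then have "AE \<omega> in M. \<omega> \<notin> B"
    by (subst prob_eq_0[symmetric]) auto
  with AE_space show ?thesis
    by eventually_elim (auto simp: B_def S_def less_top)
qed

text \<open>Where \<open>Y\<close> is infinite the integrand is 0 at every positive scale, so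
  \<open>h (1 / 2 ^ k)\<close> is at most the probability that \<open>Y\<close> is finite.\<close>

lemma (in prob_space) AE_finite_if_laplace_transform_tendsto_1:
  fixes Y :: "'a \<Rightarrow> ennreal"
  assumes [measurable]: "Y \<in> borel_measurable M"
    and lower: "\<And>k. h (1 / 2 ^ k) \<le> (\<integral>z. exp_neg (ennreal (1 / 2 ^ k) * Y z) \<partial>M)"
    and h: "(\<lambda>k. h (1 / 2 ^ k)) \<longlonglongrightarrow> 1"
  shows "AE z in M. Y z < \<infinity>"
proof -
  let ?B = "{z \<in> space M. Y z = \<infinity>}"
  have "h (1 / 2 ^ k) \<le> 1 - prob ?B" for k
  proof -
    have "h (1 / 2 ^ k) \<le> (\<integral>z. 1 - indicator ?B z \<partial>M)"
    proof (rule order_trans[OF lower integral_mono])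
      show "integrable M (\<lambda>z. exp_neg (ennreal (1 / 2 ^ k) * Y z))"
        by (intro integrable_const_bound[where B=1]) auto
      show "integrable M (\<lambda>z. 1 - indicator ?B z :: real)"
        by (intro integrable_const_bound[where B=1]) (auto simp: indicator_def)
      show "exp_neg (ennreal (1 / 2 ^ k) * Y z) \<le> 1 - indicator ?B z" for z
        by (auto simp: indicator_def ennreal_mult_top exp_neg_top[unfolded infinity_ennreal_def])
    qed
    also have "\<dots> = 1 - prob ?B"
      by (subst Bochner_Integration.integral_diff)
         (auto simp: prob_space emeasure_eq_measure intro!: integrable_real_indicator)
    finally show ?thesis .
  qed
  then have "1 \<le> 1 - prob ?B"
    by (intro LIMSEQ_le_const2[OF h]) auto
  then have "prob ?B = 0"
    using measure_nonneg[of M ?B] by linarith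
  then show ?thesis
    by (subst (asm) prob_eq_0) (auto elim!: AE_mp simp: less_top)
qed

context random_weights
begin

lemma smoothing_laplace_transform:
  assumes P: "nonneg_distribution P" and t: "0 \<le> t"
  shows "(\<integral>(\<omega>, x). exp_neg (ennreal t * (ennreal (c \<omega>) + (\<Sum>i. ennreal (\<tau> i \<omega>) * ennreal (x i))))
      \<partial>(N \<Otimes>\<^sub>M (\<Pi>\<^sub>M i\<in>UNIV. P))) = smoothing N c \<tau> (laplace_transform P) t"
proof -
  interpret P: nonneg_distribution P by fact
  let ?Q = "\<Pi>\<^sub>M i\<in>(UNIV :: nat set). P"
  interpret Q: prob_space ?Q
    by (intro prob_space_PiM) unfold_locales
  interpret NQ: pair_prob_space N ?Q ..
  have [measurable]: "(\<lambda>x. x i) \<in> borel_measurable ?Q" for i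
    using measurable_component_singleton[of i UNIV "\<lambda>_. P"] by simp
  let ?F = "\<lambda>(\<omega>, x). exp_neg (ennreal t * (ennreal (c \<omega>) + (\<Sum>i. ennreal (\<tau> i \<omega>) * ennreal (x i))))"
  have [measurable]: "?F \<in> borel_measurable (N \<Otimes>\<^sub>M ?Q)"
    by measurable
  have "integrable (N \<Otimes>\<^sub>M ?Q) ?F"
    by (intro NQ.integrable_const_bound[where B=1]) auto
  then have "(\<integral>z. ?F z \<partial>(N \<Otimes>\<^sub>M ?Q)) = (\<integral>\<omega>. \<integral>x. ?F (\<omega>, x) \<partial>?Q \<partial>N)"
    by (rule NQ.integral_fst'[symmetric])
  also have "\<dots> = (\<integral>\<omega>. smoothing_kernel c \<tau> (laplace_transform P) t \<omega> \<partial>N)"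
  proof (rule Bochner_Integration.integral_cong[OF refl])
    fix \<omega> assume \<omega>: "\<omega> \<in> space N"
    have "ennreal t * (ennreal (c \<omega>) + (\<Sum>i. ennreal (\<tau> i \<omega>) * ennreal (x i)))
        = ennreal t * ennreal (c \<omega>) + (\<Sum>i. ennreal (\<tau> i \<omega> * t) * ennreal (x i))" for x
      using t \<tau>_nonneg[OF \<omega>]
      by (simp add: distrib_left ennreal_suminf_cmult[symmetric] ennreal_mult mult.assoc mult.left_commute
          del: ennreal_suminf_cmult)
    then show "(\<integral>x. ?F (\<omega>, x) \<partial>?Q) = smoothing_kernel c \<tau> (laplace_transform P) t \<omega>"
      using P.laplace_transform_weighted_sum[of "\<lambda>i. \<tau> i \<omega> * t"] t \<tau>_nonneg[OF \<omega>]
      by (simp add: exp_neg_add smoothing_kernel_def)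
  qed
  finally show ?thesis by (simp add: smoothing_def)
qed

text \<open>Laws on [0, \<infinity>] are determined by their \<open>exp_neg\<close> integrals,
  possible mass at infinity included. Thus the functional equation also forces the random series to
  be finite almost surely.\<close>

lemma fixed_points_iff_smoothing:
  "P \<in> fixed_points N c \<tau> \<longleftrightarrow>
    nonneg_distribution P \<and> (\<forall>t\<ge>0. smoothing N c \<tau> (laplace_transform P) t = laplace_transform P t)"
proof -
  have "nonneg_distribution P \<longleftrightarrow> prob_space P \<and> sets P = sets borel \<and> (AE x in P. 0 \<le> x)"
    by (auto simp: nonneg_distribution_def nonneg_distribution_axioms_def real_distribution_def
        real_distribution_axioms_def)
  moreover have "distr P borel ennreal = distr (N \<Otimes>\<^sub>M (\<Pi>\<^sub>M i\<in>UNIV. P)) borel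
        (\<lambda>(\<omega>, x). ennreal (c \<omega>) + (\<Sum>i. ennreal (\<tau> i \<omega>) * ennreal (x i)))
      \<longleftrightarrow> (\<forall>t\<ge>0. smoothing N c \<tau> (laplace_transform P) t = laplace_transform P t)"
    (is "?L = ?R \<longleftrightarrow> _") if P: "nonneg_distribution P"
  proof -
    interpret P: nonneg_distribution P by fact
    let ?Q = "\<Pi>\<^sub>M i\<in>(UNIV :: nat set). P"
    interpret Q: prob_space ?Q
      by (intro prob_space_PiM) unfold_locales
    interpret NQ: pair_prob_space N ?Q ..
    have [measurable]: "(\<lambda>x. x i) \<in> borel_measurable ?Q" for i
      using measurable_component_singleton[of i UNIV "\<lambda>_. P"] by simp
    have L: "(\<integral>x. exp_neg (ennreal t * x) \<partial>?L) = laplace_transform P t" if "0 \<le> t" for t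
      using that by (subst integral_distr) (simp_all add: P.laplace_transform_eq)
    have R: "(\<integral>x. exp_neg (ennreal t * x) \<partial>?R) = smoothing N c \<tau> (laplace_transform P) t"
      if "0 \<le> t" for t
      unfolding smoothing_laplace_transform[OF P that, symmetric]
      by (subst integral_distr) (auto simp: case_prod_unfold)
    have "prob_space ?L" "prob_space ?R"
      by (auto intro!: P.prob_space_distr NQ.prob_space_distr)
    then have "?L = ?R \<longleftrightarrow> (\<forall>t\<ge>0. (\<integral>x. exp_neg (ennreal t * x) \<partial>?R) = (\<integral>x. exp_neg (ennreal t * x) \<partial>?L))"
      using prob_space_ennreal_eqI[of ?L ?R] by auto
    then show ?thesis by (simp add: L R)
  qed
  ultimately show ?thesis
    unfolding fixed_points_def by blast
qed

text \<open>The smoothed law could charge infinity; the lower bound \<open>h\<close> excludes this,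
  so that passing to reals by \<open>enn2real\<close> alters it only on a null set.\<close>

lemma smoothing_is_laplace_transform:
  assumes P: "nonneg_distribution P"
    and h: "\<And>t. 0 \<le> t \<Longrightarrow> h t \<le> smoothing N c \<tau> (laplace_transform P) t"
      "(\<lambda>k. h (1 / 2 ^ k)) \<longlonglongrightarrow> 1"
  shows "\<exists>P'. nonneg_distribution P' \<and>
    (\<forall>t\<ge>0. laplace_transform P' t = smoothing N c \<tau> (laplace_transform P) t)"
proof -
  interpret P: nonneg_distribution P by fact
  let ?Q = "\<Pi>\<^sub>M i\<in>(UNIV :: nat set). P"
  interpret Q: prob_space ?Q
    by (intro prob_space_PiM) unfold_locales
  interpret NQ: pair_prob_space N ?Q ..
  have [measurable]: "(\<lambda>x. x i) \<in> borel_measurable ?Q" for i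
    using measurable_component_singleton[of i UNIV "\<lambda>_. P"] by simp
  define Y where "Y z = ennreal (c (fst z)) + (\<Sum>i. ennreal (\<tau> i (fst z)) * ennreal (snd z i))" for z
  have [measurable]: "Y \<in> borel_measurable (N \<Otimes>\<^sub>M ?Q)"
    unfolding Y_def by measurable
  have Y: "(\<integral>z. exp_neg (ennreal t * Y z) \<partial>(N \<Otimes>\<^sub>M ?Q)) = smoothing N c \<tau> (laplace_transform P) t"
    if "0 \<le> t" for t
    unfolding smoothing_laplace_transform[OF P that, symmetric] Y_def by (simp add: case_prod_unfold)
  have "AE z in N \<Otimes>\<^sub>M ?Q. Y z < \<infinity>"
    using h(1) by (intro NQ.AE_finite_if_laplace_transform_tendsto_1[OF _ _ h(2)]) (simp_all add: Y)
  then have Y_finite: "AE z in N \<Otimes>\<^sub>M ?Q. ennreal (enn2real (Y z)) = Y z"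
    by eventually_elim simp
  define P' where "P' = distr (N \<Otimes>\<^sub>M ?Q) borel (\<lambda>z. enn2real (Y z))"
  have "real_distribution P'"
    unfolding P'_def by (rule NQ.real_distribution_distr) measurable
  moreover have "AE x in P'. 0 \<le> x"
    unfolding P'_def by (subst AE_distr_iff) auto
  ultimately interpret P': nonneg_distribution P'
    by (simp add: nonneg_distribution_def nonneg_distribution_axioms_def)
  have "laplace_transform P' t = smoothing N c \<tau> (laplace_transform P) t" if t: "0 \<le> t" for t
  proof -
    have "laplace_transform P' t = (\<integral>z. exp_neg (ennreal t * ennreal (enn2real (Y z))) \<partial>(N \<Otimes>\<^sub>M ?Q))"
      unfolding P'.laplace_transform_eq[OF t] by (subst P'_def, subst integral_distr) auto
    also have "\<dots> = (\<integral>z. exp_neg (ennreal t * Y z) \<partial>(N \<Otimes>\<^sub>M ?Q))"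
      using Y_finite by (intro integral_cong_AE) (auto elim!: eventually_mono)
    finally show ?thesis by (simp add: Y[OF t])
  qed
  then show ?thesis using P'.nonneg_distribution_axioms by blast
qed

text \<open>
  The bound \<open>b\<close> gives tightness of the iterates and allows to pass to the limit in the
  infinite product defining \<^const>\<open>smoothing\<close>.
\<close>
lemma limit_of_iterates_is_fixed_point:
  assumes P: "nonneg_distribution P"
    and b: "(\<lambda>k. b (1 / 2 ^ k)) \<longlonglongrightarrow> 0"
      "\<And>t. 0 \<le> t \<Longrightarrow> AE \<omega> in N. (\<integral>\<^sup>+i. ennreal (b (\<tau> i \<omega> * t)) \<partial>count_space UNIV) < \<infinity>"
    and f: "\<And>s. f s = laplace_transform P \<bar>s\<bar>"
    and dom: "\<And>n t. 0 \<le> t \<Longrightarrow> 1 - (smoothing N c \<tau> ^^ n) f t \<le> b t"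
    and lim: "\<And>t. 0 \<le> t \<Longrightarrow> (\<lambda>n. (smoothing N c \<tau> ^^ n) f t) \<longlonglongrightarrow> g t"
  shows "\<exists>Q\<in>fixed_points N c \<tau>. \<forall>t\<ge>0. g t = laplace_transform Q t"
proof -
  interpret P: nonneg_distribution P by fact
  let ?h = "\<lambda>t. 1 - b t"
  have h: "(\<lambda>k. ?h (1 / 2 ^ k)) \<longlonglongrightarrow> 1"
    using tendsto_diff[OF tendsto_const[of 1] b(1)] by simp
  have unit: "unit_function ((smoothing N c \<tau> ^^ n) f)" for n
  proof (induction n)
    case 0
    show ?case using P.unit_function_laplace_transform by (simp add: f[abs_def])
  qed (simp add: unit_function_smoothing)
  \<comment> \<open>The continuity theorem requires every iterate to be a proper Laplace transform.
    The bound for stage \<open>Suc n\<close> rules out mass at infinity created by that smoothing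
    step.\<close>
  have "\<exists>P'. nonneg_distribution P' \<and> (\<forall>t\<ge>0. laplace_transform P' t = (smoothing N c \<tau> ^^ n) f t)" for n
  proof (induction n)
    case 0
    show ?case using P by (intro exI[of _ P]) (simp add: f)
  next
    case (Suc n)
    then obtain P' where P': "nonneg_distribution P'"
      and eq: "\<And>t. 0 \<le> t \<Longrightarrow> laplace_transform P' t = (smoothing N c \<tau> ^^ n) f t"
      by blast
    have "smoothing N c \<tau> (laplace_transform P') t = (smoothing N c \<tau> ^^ Suc n) f t" if "0 \<le> t" for t
      using smoothing_cong[OF eq that] by simp
    with smoothing_is_laplace_transform[OF P', of ?h] dom[of _ "Suc n"] h show ?case
      by (simp add: algebra_simps)
  qed
  then obtain P' where P': "\<And>n. nonneg_distribution (P' n)"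
    and eq: "\<And>n t. 0 \<le> t \<Longrightarrow> laplace_transform (P' n) t = (smoothing N c \<tau> ^^ n) f t"
    by metis
  have "\<exists>Q. nonneg_distribution Q \<and> (\<forall>t\<ge>0. g t = laplace_transform Q t)"
  proof (rule laplace_transform_limit[OF P', of ?h])
    show "1 - b t \<le> laplace_transform (P' n) t" if "0 \<le> t" for n t
      using eq[OF that] dom[OF that, of n] by simp
    show "(\<lambda>n. laplace_transform (P' n) t) \<longlonglongrightarrow> g t" if "0 \<le> t" for t
      using lim[OF that] by (simp add: eq[OF that])
  qed (rule h)
  then obtain Q where Q: "nonneg_distribution Q" and g: "\<And>t. 0 \<le> t \<Longrightarrow> g t = laplace_transform Q t"
    by blast
  interpret Q: nonneg_distribution Q by fact
  have "smoothing N c \<tau> (laplace_transform Q) t = laplace_transform Q t" if t: "0 \<le> t" for t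
  proof -
    \<comment> \<open>The same sequence has two limits: one by continuity of the operator under the
      majorant, the other by shifting the index.\<close>
    have "(\<lambda>n. smoothing N c \<tau> ((smoothing N c \<tau> ^^ n) f) t) \<longlonglongrightarrow> smoothing N c \<tau> (\<lambda>s. laplace_transform Q \<bar>s\<bar>) t"
      by (rule smoothing_dominated_convergence[OF unit Q.unit_function_laplace_transform t _ dom b(2)[OF t]])
         (use lim g in auto)
    moreover have "(\<lambda>n. smoothing N c \<tau> ((smoothing N c \<tau> ^^ n) f) t) \<longlonglongrightarrow> laplace_transform Q t"
      using LIMSEQ_Suc[OF lim[OF t]] by (simp add: g[OF t])
    ultimately have "smoothing N c \<tau> (\<lambda>s. laplace_transform Q \<bar>s\<bar>) t = laplace_transform Q t"
      by (rule LIMSEQ_unique)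
    then show ?thesis
      using smoothing_cong[of "\<lambda>s. laplace_transform Q \<bar>s\<bar>" "laplace_transform Q" t] t by simp
  qed
  then show ?thesis
    using Q g fixed_points_iff_smoothing by blast
qed

end

section \<open>Convergence of bounded martingales\<close>

text \<open>
  Kolmogorov's maximal inequality for the increments after time \<open>n\<close> yields almost sure
  Cauchyness, since the second moments of a bounded martingale increase to a finite limit.
\<close>
lemma (in prob_space) bounded_martingale_AE_convergent:
  fixes X :: "nat \<Rightarrow> 'a \<Rightarrow> real" and F :: "nat \<Rightarrow> 'a measure"
  assumes sub: "\<And>n. subalgebra M (F n)" and filt: "\<And>n. subalgebra (F (Suc n)) (F n)"
    and X: "\<And>n. X n \<in> borel_measurable (F n)"
    and bounds: "\<And>n \<omega>. \<omega> \<in> space M \<Longrightarrow> 0 \<le> X n \<omega>" "\<And>n \<omega>. \<omega> \<in> space M \<Longrightarrow> X n \<omega> \<le> 1"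
    and martingale: "\<And>n G. G \<in> borel_measurable (F n) \<Longrightarrow> (\<And>\<omega>. \<omega> \<in> space M \<Longrightarrow> \<bar>G \<omega>\<bar> \<le> 1) \<Longrightarrow>
      (\<integral>\<omega>. G \<omega> * X (Suc n) \<omega> \<partial>M) = (\<integral>\<omega>. G \<omega> * X n \<omega> \<partial>M)"
  shows "AE \<omega> in M. convergent (\<lambda>n. X n \<omega>)"
proof -
  have space_F: "space (F n) = space M" for n
    using sub by (simp add: subalgebra_def)
  have F_mono: "subalgebra (F m) (F n)" if "n \<le> m" for n m
    using that
  proof (induction m rule: dec_induct)
    case base
    show ?case by (simp add: subalgebra_def)
  next
    case (step m)
    then show ?case using filt[of m] by (auto simp: subalgebra_def)
  qed
  have F_meas: "G \<in> borel_measurable (F m)" if "n \<le> m" "G \<in> borel_measurable (F n)" for n m and G :: "'a \<Rightarrow> real"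
    using measurable_from_subalg[OF F_mono[OF that(1)] that(2)] .
  have X_M [measurable]: "X n \<in> borel_measurable M" for n by (rule measurable_from_subalg[OF sub X])
  have diff_le_1: "\<bar>X m \<omega> - X n \<omega>\<bar> \<le> 1" if "\<omega> \<in> space M" for m n \<omega>
    using bounds[OF that, of m] bounds[OF that, of n] by linarith
  have int: "integrable M f" if "f \<in> borel_measurable M" "\<And>\<omega>. \<omega> \<in> space M \<Longrightarrow> \<bar>f \<omega>\<bar> \<le> 1" for f :: "'a \<Rightarrow> real"
    using that by (intro integrable_const_bound[where B=1]) auto
  have martingale': "(\<integral>\<omega>. G \<omega> * X m \<omega> \<partial>M) = (\<integral>\<omega>. G \<omega> * X n \<omega> \<partial>M)"
    if "n \<le> m" and G: "G \<in> borel_measurable (F n)" "\<And>\<omega>. \<omega> \<in> space M \<Longrightarrow> \<bar>G \<omega>\<bar> \<le> 1" for n m G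
    using that(1)
  proof (induction m rule: dec_induct)
    case (step m)
    then show ?case using martingale[OF F_meas[OF _ G(1)] G(2), of m] by simp
  qed simp
  have orthogonal: "(\<integral>\<omega>. G \<omega> * (X m \<omega> - X n \<omega>) \<partial>M) = 0"
    if "n \<le> m" and G: "G \<in> borel_measurable (F n)" "\<And>\<omega>. \<omega> \<in> space M \<Longrightarrow> \<bar>G \<omega>\<bar> \<le> 1" for n m G
  proof -
    have [measurable]: "G \<in> borel_measurable M" by (rule measurable_from_subalg[OF sub G(1)])
    have "integrable M (\<lambda>\<omega>. G \<omega> * X k \<omega>)" for k
      using G(2) bounds by (intro int) (auto simp: abs_mult intro!: mult_le_one)
    then show ?thesis
      using martingale'[OF that] by (simp add: right_diff_distrib)
  qed
  define a where "a n = (\<integral>\<omega>. (X n \<omega>)\<^sup>2 \<partial>M)" for n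
  have a_diff: "(\<integral>\<omega>. (X m \<omega> - X n \<omega>)\<^sup>2 \<partial>M) = a m - a n" if "n \<le> m" for n m
  proof -
    have "(\<integral>\<omega>. (X m \<omega> - X n \<omega>)\<^sup>2 \<partial>M) = (\<integral>\<omega>. (X m \<omega>)\<^sup>2 - (X n \<omega>)\<^sup>2 - 2 * (X n \<omega> * (X m \<omega> - X n \<omega>)) \<partial>M)"
      by (intro Bochner_Integration.integral_cong) (auto simp: power2_eq_square algebra_simps)
    also have "\<dots> = a m - a n - 2 * (\<integral>\<omega>. X n \<omega> * (X m \<omega> - X n \<omega>) \<partial>M)"
    proof -
      have "integrable M (\<lambda>\<omega>. (X k \<omega>)\<^sup>2)" for k
        using bounds by (intro int) (auto simp: power_le_one)
      moreover have "integrable M (\<lambda>\<omega>. X n \<omega> * (X m \<omega> - X n \<omega>))"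
        using bounds diff_le_1 by (intro int) (auto simp: abs_mult intro!: mult_le_one)
      ultimately show ?thesis by (simp add: a_def)
    qed
    also have "\<dots> = a m - a n"
      using orthogonal[OF that X] bounds by simp
    finally show ?thesis .
  qed
  have "incseq a"
  proof (rule incseq_SucI)
    fix n
    have "0 \<le> (\<integral>\<omega>. (X (Suc n) \<omega> - X n \<omega>)\<^sup>2 \<partial>M)" by simp
    then show "a n \<le> a (Suc n)" using a_diff[of n "Suc n"] by simp
  qed
  moreover have "a n \<le> 1" for n
    unfolding a_def using bounds
    by (intro integral_le_const int) (auto simp: power_le_one)
  ultimately obtain l where l: "a \<longlonglongrightarrow> l" and a_le: "\<And>n. a n \<le> l"
    using incseq_convergent[of a 1] by blast
  define B where "B \<epsilon> n m = {\<omega> \<in> space M. \<exists>k\<in>{n..m}. \<epsilon> \<le> \<bar>X k \<omega> - X n \<omega>\<bar>}" for \<epsilon> n m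
  have [measurable]: "B \<epsilon> n m \<in> sets M" for \<epsilon> n m
    unfolding B_def by measurable
  have maximal: "\<epsilon>\<^sup>2 * prob (B \<epsilon> n m) \<le> a m - a n" if "n \<le> m" "0 < \<epsilon>" for \<epsilon> n m
  proof -
    \<comment> \<open>The event that \<open>k\<close> is the first time from \<open>n\<close> on at
      which the deviation from \<open>X n\<close> reaches \<open>\<epsilon>\<close>. It is known at
      time \<open>k\<close>, so later increments are orthogonal to it.\<close>
    define A where "A k = {\<omega> \<in> space M. \<epsilon> \<le> \<bar>X k \<omega> - X n \<omega>\<bar> \<and> (\<forall>j\<in>{n..<k}. \<bar>X j \<omega> - X n \<omega>\<bar> < \<epsilon>)}" for k
    have A_F: "A k \<in> sets (F k)" if "k \<in> {n..m}" for k
    proof -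
      note X_M [measurable del]
      \<comment> \<open>In the range of the quantifier below \<open>min j k = j\<close>; the minimum
        makes the value measurable with respect to \<open>F k\<close> for all \<open>j\<close> at
        once.\<close>
      have [measurable]: "X (min j k) \<in> borel_measurable (F k)" for j
        using F_meas[OF _ X] by simp
      note X [measurable]
      have "A k = {\<omega> \<in> space (F k). \<epsilon> \<le> \<bar>X k \<omega> - X (min n k) \<omega>\<bar> \<and>
          (\<forall>j\<in>{n..<k}. \<bar>X (min j k) \<omega> - X (min n k) \<omega>\<bar> < \<epsilon>)}"
        using that by (auto simp: A_def space_F min_def)
      also have "\<dots> \<in> sets (F k)" by measurable
      finally show ?thesis .
    qed
    then have A [measurable]: "A k \<in> sets M" if "k \<in> {n..m}" for k
      using that sub by (auto simp: subalgebra_def)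
    have disj: "disjoint_family_on A {n..m}"
      unfolding disjoint_family_on_def
    proof (intro ballI impI)
      have *: "A i \<inter> A j = {}" if "i < j" "n \<le> i" for i j
        using that by (force simp: A_def)
      fix i j assume "i \<in> {n..m}" "j \<in> {n..m}" "i \<noteq> j"
      then show "A i \<inter> A j = {}"
        using *[of i j] *[of j i] by (cases "i < j") (auto simp: Int_commute)
    qed
    have B_eq: "B \<epsilon> n m = (\<Union>k\<in>{n..m}. A k)"
    proof (intro equalityI subsetI)
      fix \<omega> assume "\<omega> \<in> B \<epsilon> n m"
      then obtain k where k: "\<omega> \<in> space M" "k \<in> {n..m}" "\<epsilon> \<le> \<bar>X k \<omega> - X n \<omega>\<bar>"
        by (auto simp: B_def)
      define q where "q k \<longleftrightarrow> n \<le> k \<and> \<epsilon> \<le> \<bar>X k \<omega> - X n \<omega>\<bar>" for k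
      have "q k" using k by (simp add: q_def)
      then have "q (Least q)" "Least q \<le> k"
        by (rule LeastI, rule Least_le)
      moreover have "\<bar>X j \<omega> - X n \<omega>\<bar> < \<epsilon>" if "j \<in> {n..<Least q}" for j
      proof -
        have "\<not> q j" using that by (intro not_less_Least) auto
        then show ?thesis using that by (auto simp: q_def)
      qed
      ultimately show "\<omega> \<in> (\<Union>k\<in>{n..m}. A k)"
        using k by (auto simp: A_def q_def intro!: bexI[of _ "Least q"])
    qed (auto simp: A_def B_def)
    have step: "\<epsilon>\<^sup>2 * prob (A k) \<le> (\<integral>\<omega>. indicator (A k) \<omega> * (X m \<omega> - X n \<omega>)\<^sup>2 \<partial>M)" if k: "k \<in> {n..m}" for k
    proof -
      note [measurable] = A[OF k]
      have bd: "\<bar>indicator (A k) \<omega> * f\<bar> \<le> 1" if "\<bar>f\<bar> \<le> 1" for f :: real and \<omega> :: 'a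
        using that by (auto simp: indicator_def)
      let ?D = "\<lambda>\<omega>. indicator (A k) \<omega> * (X k \<omega> - X n \<omega>)"
      have D: "?D \<in> borel_measurable (F k)"
      proof -
        note X_M [measurable del]
        have [measurable]: "A k \<in> sets (F k)" "X k \<in> borel_measurable (F k)" "X n \<in> borel_measurable (F k)"
          using A_F[OF k] X F_meas[OF _ X] k by auto
        show ?thesis by measurable
      qed
      \<comment> \<open>The cross term in the expansion of \<open>(X m - X n)\<^sup>2\<close> around
        \<open>X k\<close>. With its mean zero, only the non-negative square
        \<open>(X m - X k)\<^sup>2\<close> has to be dropped.\<close>
      have "(\<integral>\<omega>. ?D \<omega> * (X m \<omega> - X k \<omega>) \<partial>M) = 0"
        using k diff_le_1 by (intro orthogonal D) (auto intro!: bd)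
      moreover have "integrable M (\<lambda>\<omega>. ?D \<omega> * (X m \<omega> - X k \<omega>))"
        using diff_le_1 by (intro int) (auto simp: mult.assoc abs_mult[of "X k _ - X n _"] intro!: bd mult_le_one)
      moreover have sq: "integrable M (\<lambda>\<omega>. indicator (A k) \<omega> * (X i \<omega> - X j \<omega>)\<^sup>2)" for i j
        by (rule int) (measurable, rule bd, simp add: abs_square_le_1 diff_le_1)
      ultimately have "(\<integral>\<omega>. indicator (A k) \<omega> * (X k \<omega> - X n \<omega>)\<^sup>2 \<partial>M)
          = (\<integral>\<omega>. indicator (A k) \<omega> * (X k \<omega> - X n \<omega>)\<^sup>2 + 2 * (?D \<omega> * (X m \<omega> - X k \<omega>)) \<partial>M)"
        by simp
      also have "\<dots> \<le> (\<integral>\<omega>. indicator (A k) \<omega> * (X m \<omega> - X n \<omega>)\<^sup>2 \<partial>M)"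
      proof (rule integral_mono)
        fix \<omega>
        have "0 \<le> (X m \<omega> - X k \<omega>)\<^sup>2" by simp
        then show "indicator (A k) \<omega> * (X k \<omega> - X n \<omega>)\<^sup>2 + 2 * (?D \<omega> * (X m \<omega> - X k \<omega>))
            \<le> indicator (A k) \<omega> * (X m \<omega> - X n \<omega>)\<^sup>2"
          by (auto simp: indicator_def power2_eq_square algebra_simps)
      qed (use sq \<open>integrable M (\<lambda>\<omega>. ?D \<omega> * (X m \<omega> - X k \<omega>))\<close> in auto)
      finally have le: "(\<integral>\<omega>. indicator (A k) \<omega> * (X k \<omega> - X n \<omega>)\<^sup>2 \<partial>M)
          \<le> (\<integral>\<omega>. indicator (A k) \<omega> * (X m \<omega> - X n \<omega>)\<^sup>2 \<partial>M)" .
      have "\<epsilon>\<^sup>2 * prob (A k) = (\<integral>\<omega>. \<epsilon>\<^sup>2 * indicator (A k) \<omega> \<partial>M)" by simp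
      also have "\<dots> \<le> (\<integral>\<omega>. indicator (A k) \<omega> * (X k \<omega> - X n \<omega>)\<^sup>2 \<partial>M)"
      proof (rule integral_mono[OF _ sq])
        fix \<omega>
        have "\<epsilon>\<^sup>2 \<le> (X k \<omega> - X n \<omega>)\<^sup>2" if "\<omega> \<in> A k"
          using that \<open>0 < \<epsilon>\<close> by (subst abs_le_square_iff[symmetric]) (auto simp: A_def)
        then show "\<epsilon>\<^sup>2 * indicator (A k) \<omega> \<le> indicator (A k) \<omega> * (X k \<omega> - X n \<omega>)\<^sup>2"
          by (auto simp: indicator_def)
      qed (auto simp: emeasure_eq_measure intro!: integrable_real_indicator integrable_mult_right)
      finally show ?thesis using le by simp
    qed
    have int_A: "integrable M (\<lambda>\<omega>. indicator (A k) \<omega> * (X m \<omega> - X n \<omega>)\<^sup>2)" if "k \<in> {n..m}" for k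
      using A[OF that] diff_le_1 by (intro int) (auto simp: indicator_def abs_square_le_1)
    have "\<epsilon>\<^sup>2 * prob (B \<epsilon> n m) = (\<Sum>k\<in>{n..m}. \<epsilon>\<^sup>2 * prob (A k))"
      unfolding B_eq sum_distrib_left[symmetric]
      by (subst finite_measure_finite_Union) (use A disj in auto)
    also have "\<dots> \<le> (\<Sum>k\<in>{n..m}. \<integral>\<omega>. indicator (A k) \<omega> * (X m \<omega> - X n \<omega>)\<^sup>2 \<partial>M)"
      by (intro sum_mono step)
    also have "\<dots> = (\<integral>\<omega>. (\<Sum>k\<in>{n..m}. indicator (A k) \<omega> * (X m \<omega> - X n \<omega>)\<^sup>2) \<partial>M)"
      by (rule Bochner_Integration.integral_sum[symmetric]) (rule int_A)
    also have "\<dots> \<le> (\<integral>\<omega>. (X m \<omega> - X n \<omega>)\<^sup>2 \<partial>M)"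
    proof (rule integral_mono)
      show "integrable M (\<lambda>\<omega>. \<Sum>k\<in>{n..m}. indicator (A k) \<omega> * (X m \<omega> - X n \<omega>)\<^sup>2)"
        by (intro Bochner_Integration.integrable_sum int_A)
      show "integrable M (\<lambda>\<omega>. (X m \<omega> - X n \<omega>)\<^sup>2)"
        using diff_le_1 by (intro int) (auto simp: abs_square_le_1)
      fix \<omega>
      have "(\<Sum>k\<in>{n..m}. indicator (A k) \<omega> :: real) = indicator (\<Union>k\<in>{n..m}. A k) \<omega>"
        using disj by (intro indicator_UN_disjoint[symmetric]) auto
      then show "(\<Sum>k\<in>{n..m}. indicator (A k) \<omega> * (X m \<omega> - X n \<omega>)\<^sup>2) \<le> (X m \<omega> - X n \<omega>)\<^sup>2"
        by (simp add: sum_distrib_right[symmetric] mult_left_le_one_le indicator_def)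
    qed
    finally show ?thesis by (simp add: a_diff[OF \<open>n \<le> m\<close>])
  qed
  define B' where "B' \<epsilon> n = (\<Union>m. B \<epsilon> n m)" for \<epsilon> n
  have [measurable]: "B' \<epsilon> n \<in> sets M" for \<epsilon> n
    unfolding B'_def by measurable
  have B'_le: "\<epsilon>\<^sup>2 * prob (B' \<epsilon> n) \<le> l - a n" if "0 < \<epsilon>" for \<epsilon> n
  proof -
    have "incseq (B \<epsilon> n)" by (auto simp: incseq_def B_def)
    then have "(\<lambda>m. prob (B \<epsilon> n m)) \<longlonglongrightarrow> prob (B' \<epsilon> n)"
      unfolding B'_def by (intro finite_Lim_measure_incseq) auto
    then have "(\<lambda>m. \<epsilon>\<^sup>2 * prob (B \<epsilon> n m)) \<longlonglongrightarrow> \<epsilon>\<^sup>2 * prob (B' \<epsilon> n)"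
      by (intro tendsto_intros)
    moreover have "\<forall>m\<ge>n. \<epsilon>\<^sup>2 * prob (B \<epsilon> n m) \<le> l - a n"
      using maximal[OF _ that] a_le by (meson diff_right_mono order_trans)
    ultimately show ?thesis by (intro LIMSEQ_le_const2) auto
  qed
  \<comment> \<open>If the Cauchy property fails, then for some \<open>j\<close> every
    \<open>n\<close> is followed by a deviation of at least \<open>1 / Suc j\<close> from
    \<open>X n\<close>. The bound \<open>l - a n\<close> holds for every \<open>n\<close> and tends
    to 0.\<close>
  define E where "E j = (\<Inter>n. B' (1 / Suc j) n)" for j
  have "E j \<in> null_sets M" for j
  proof -
    have [measurable]: "E j \<in> sets M" unfolding E_def by measurable
    let ?\<epsilon> = "1 / Suc j"
    have "?\<epsilon>\<^sup>2 * prob (E j) \<le> l - a n" for n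
    proof -
      have "prob (E j) \<le> prob (B' ?\<epsilon> n)"
        by (intro finite_measure_mono) (auto simp: E_def)
      then have "?\<epsilon>\<^sup>2 * prob (E j) \<le> ?\<epsilon>\<^sup>2 * prob (B' ?\<epsilon> n)"
        by (intro mult_left_mono) auto
      also have "\<dots> \<le> l - a n" by (rule B'_le) simp
      finally show ?thesis .
    qed
    moreover have "(\<lambda>n. l - a n) \<longlonglongrightarrow> l - l"
      by (intro tendsto_intros l)
    ultimately have "?\<epsilon>\<^sup>2 * prob (E j) \<le> 0"
      by (intro LIMSEQ_le_const[where X="\<lambda>n. l - a n"]) auto
    then have "prob (E j) = 0"
      using measure_nonneg[of M "E j"] by (simp add: mult_le_0_iff)
    then show ?thesis by (auto simp: null_sets_def emeasure_eq_measure)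
  qed
  then have "AE \<omega> in M. \<forall>j. \<omega> \<notin> E j"
    by (subst AE_all_countable) (auto intro: AE_not_in)
  with AE_space show ?thesis
  proof eventually_elim
    case (elim \<omega>)
    have "Cauchy (\<lambda>n. X n \<omega>)"
      unfolding Cauchy_altdef2
    proof (intro allI impI)
      fix e :: real assume "0 < e"
      then obtain j where j: "1 / Suc j < e"
        using nat_approx_posE by blast
      from elim obtain n where "\<omega> \<notin> B' (1 / Suc j) n" by (auto simp: E_def)
      then have "\<omega> \<notin> B (1 / Suc j) n k" for k by (auto simp: B'_def)
      then have "\<bar>X k \<omega> - X n \<omega>\<bar> < 1 / Suc j" if "n \<le> k" for k
        using that elim(1) unfolding B_def by (force simp: not_le)
      then show "\<exists>N. \<forall>n\<ge>N. dist (X n \<omega>) (X N \<omega>) < e"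
        using j by (auto simp: dist_real_def intro: less_trans)
    qed
    then show ?case by (rule Cauchy_convergent)
  qed
qed

section \<open>The branching property\<close>

lemma nn_integral_count_space_Un_disjoint:
  assumes "A \<inter> B = {}"
  shows "(\<integral>\<^sup>+x. f x \<partial>count_space (A \<union> B)) = (\<integral>\<^sup>+x. f x \<partial>count_space A) + (\<integral>\<^sup>+x. f x \<partial>count_space B)"
  using assms
  by (auto simp: nn_integral_count_space_indicator[of "A \<union> B"] nn_integral_count_space_indicator[of A]
      nn_integral_count_space_indicator[of B] nn_integral_add[symmetric] indicator_def
      intro!: nn_integral_cong)

text \<open>Tonelli along the bijection between words of length \<open>Suc n\<close> and pairs of a
  parent word and a last letter.\<close>

lemma nn_integral_count_space_snoc:
  "(\<integral>\<^sup>+w. g w \<partial>count_space {w. length w = Suc n}) =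
    (\<integral>\<^sup>+v. (\<integral>\<^sup>+i. g (v @ [i]) \<partial>count_space UNIV) \<partial>count_space {v. length v = n})"
proof -
  let ?A = "{v. length v = n}"
  have "bij_betw (\<lambda>(v, i). v @ [i]) (?A \<times> UNIV) {w. length w = Suc n}"
    by (rule bij_betwI[where g="\<lambda>w. (butlast w, last w)"]) (auto intro!: append_butlast_last_id)
  then have "(\<integral>\<^sup>+w. g w \<partial>count_space {w. length w = Suc n})
      = (\<integral>\<^sup>+x. g (fst x @ [snd x]) \<partial>count_space (?A \<times> UNIV))"
    by (subst nn_integral_bij_count_space[symmetric]) (auto simp: case_prod_unfold)
  also have "\<dots> = (\<integral>\<^sup>+x. g (fst x @ [snd x]) * indicator ?A (fst x) \<partial>count_space UNIV)"
    by (subst nn_integral_count_space_indicator) (auto intro!: nn_integral_cong simp: indicator_def)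
  also have "\<dots> = (\<integral>\<^sup>+v. (\<integral>\<^sup>+i. g (v @ [i]) * indicator ?A v \<partial>count_space UNIV) \<partial>count_space UNIV)"
    by (subst nn_integral_fst_count_space[symmetric]) simp
  also have "\<dots> = (\<integral>\<^sup>+v. (\<integral>\<^sup>+i. g (v @ [i]) \<partial>count_space UNIV) * indicator ?A v \<partial>count_space UNIV)"
    by (intro nn_integral_cong nn_integral_multc) simp
  also have "\<dots> = (\<integral>\<^sup>+v. (\<integral>\<^sup>+i. g (v @ [i]) \<partial>count_space UNIV) \<partial>count_space ?A)"
    by (subst nn_integral_count_space_indicator[of ?A]) auto
  finally show ?thesis .
qed

context random_weights
begin

text \<open>
  The branching model is realised on the space of families of marks \<open>z v = (C(v), T(v))\<close>;
  \<open>\<F> n\<close> is generated by the marks of the generations before \<open>n\<close>.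
\<close>
definition marks :: "(nat list \<Rightarrow> 'a) measure" where
  "marks = (\<Pi>\<^sub>M v\<in>UNIV. N)"

definition \<F> :: "nat \<Rightarrow> (nat list \<Rightarrow> 'a) measure" where
  "\<F> n = vimage_algebra (space marks) (\<lambda>z. restrict z {u. length u < n}) (\<Pi>\<^sub>M u\<in>{u. length u < n}. N)"

abbreviation weight :: "nat list \<Rightarrow> (nat list \<Rightarrow> 'a) \<Rightarrow> real" where
  "weight \<equiv> branch_weight (\<lambda>v i z. \<tau> i (z v))"

abbreviation partial_weight :: "nat \<Rightarrow> (nat list \<Rightarrow> 'a) \<Rightarrow> ennreal" where
  "partial_weight n z \<equiv> (\<integral>\<^sup>+u. ennreal (weight u z) * ennreal (c (z u)) \<partial>count_space {u. length u < n})"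

abbreviation D :: "nat \<Rightarrow> (real \<Rightarrow> real) \<Rightarrow> real \<Rightarrow> (nat list \<Rightarrow> 'a) \<Rightarrow> real" where
  "D n f \<equiv> disintegration_step (\<lambda>v z. c (z v)) (\<lambda>v i z. \<tau> i (z v)) f n"

lemma D_eq: "D n f t z = exp_neg (ennreal t * partial_weight n z)
    * infprod (\<lambda>v. f (weight v z * t)) {v. length v = n}"
  by (simp add: disintegration_step_def infsum_eq_nn_integral_count_space)

lemma space_marks: "z \<in> space marks \<longleftrightarrow> (\<forall>v. z v \<in> space N)"
  by (auto simp: marks_def space_PiM)

sublocale marks: prob_space marks
  unfolding marks_def by (intro prob_space_PiM) unfold_locales

lemma coordinate_measurable [measurable]: "(\<lambda>z. z v) \<in> measurable marks N"
  unfolding marks_def by (rule measurable_component_singleton) simp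

lemma weight_nonneg:
  assumes "z \<in> space marks"
  shows "0 \<le> weight v z"
  unfolding branch_weight_def using assms by (intro prod_nonneg) (auto simp: space_marks \<tau>_nonneg)

text \<open>The sigma-algebra \<open>R\<close> is left open so that one proof covers both
  measurability on \<open>marks\<close> and adaptedness to \<open>\<F> n\<close>.\<close>

lemma weight_measurable:
  assumes "\<And>u. length u < length v \<Longrightarrow> (\<lambda>z. z u) \<in> measurable R N"
  shows "weight v \<in> borel_measurable R"
  unfolding branch_weight_def[abs_def]
  by (intro borel_measurable_prod measurable_compose[OF assms \<tau>_measurable]) auto

lemma partial_weight_measurable:
  assumes "\<And>u. length u < n \<Longrightarrow> (\<lambda>z. z u) \<in> measurable R N"
  shows "partial_weight n \<in> borel_measurable R"
proof (rule borel_measurable_nn_integral_count_space)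
  fix u :: "nat list" assume "u \<in> {u. length u < n}"
  then have [measurable]: "(\<lambda>z. z u) \<in> measurable R N" "weight u \<in> borel_measurable R"
    using assms by (auto intro!: weight_measurable)
  show "(\<lambda>z. ennreal (weight u z) * ennreal (c (z u))) \<in> borel_measurable R"
    by measurable
qed

lemma D_measurable:
  assumes "\<And>u. length u < n \<Longrightarrow> (\<lambda>z. z u) \<in> measurable R N" and f: "unit_function f"
  shows "D n f t \<in> borel_measurable R"
proof -
  note [measurable] = partial_weight_measurable[OF assms(1)] unit_functionD(1)[OF f]
  have [measurable]: "weight v \<in> borel_measurable R" if "length v = n" for v
    using assms(1) that by (intro weight_measurable) auto
  have [measurable]: "(\<lambda>z. infprod (\<lambda>v. f (weight v z * t)) {v. length v = n}) \<in> borel_measurable R"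
    by (rule borel_measurable_infprod) (auto simp: unit_functionD[OF f])
  show ?thesis unfolding D_eq[abs_def] by measurable
qed

lemma D_bounds:
  assumes "unit_function f"
  shows "0 \<le> D n f t z" "D n f t z \<le> 1"
  using infprod_bounds[of "{v. length v = n}" "\<lambda>v. f (weight v z * t)"] unit_functionD[OF assms]
  by (auto simp: D_eq intro!: mult_le_one)

lemma D_cong:
  assumes "\<And>s. 0 \<le> s \<Longrightarrow> f s = g s" "0 \<le> t" "z \<in> space marks"
  shows "D n f t z = D n g t z"
  unfolding D_eq using assms
  by (intro arg_cong2[where f="(*)"] infprod_cong refl) (auto simp: weight_nonneg)

lemma D_0: "D 0 f t z = f t"
proof -
  have "infprod (\<lambda>v. f (weight v z * t)) {[]} = f t"
    unfolding infprod_def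
    using tendsto_Lim[OF _ tendsto_principal_singleton[of "prod (\<lambda>v. f (weight v z * t))" "{[]}"]]
    by (simp add: principal_eq_bot_iff finite_subsets_at_top_finite branch_weight_Nil)
  then show ?thesis by (simp add: D_eq nn_integral_count_space_finite)
qed

text \<open>Generation \<open>Suc n\<close> is grouped by parents. After \<open>neg_ln\<close> this
  is a double sum in [0, \<infinity>], and the contribution of \<open>c\<close> at a parent joins
  the kernel of that parent.\<close>

lemma D_Suc:
  assumes f: "unit_function f" and t: "0 \<le> t" and z: "z \<in> space marks"
  shows "D (Suc n) f t z = exp_neg (ennreal t * partial_weight n z)
    * infprod (\<lambda>v. smoothing_kernel c \<tau> f (weight v z * t) (z v)) {v. length v = n}"
proof -
  let ?A = "{v. length v = n}"
  have eq: "{u. length u < Suc n} = {u. length u < n} \<union> ?A"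
    by (auto simp: less_Suc_eq)
  have "partial_weight (Suc n) z = partial_weight n z + (\<integral>\<^sup>+v. ennreal (weight v z) * ennreal (c (z v)) \<partial>count_space ?A)"
    unfolding eq by (rule nn_integral_count_space_Un_disjoint) auto
  then have "ennreal t * partial_weight (Suc n) z
      = ennreal t * partial_weight n z + (\<integral>\<^sup>+v. ennreal (weight v z * t) * ennreal (c (z v)) \<partial>count_space ?A)"
    using t weight_nonneg[OF z]
    by (simp add: distrib_left nn_integral_cmult[symmetric] ennreal_mult mult_ac)
  moreover have "infprod (\<lambda>w. f (weight w z * t)) {w. length w = Suc n}
      = exp_neg (\<integral>\<^sup>+v. (\<integral>\<^sup>+i. neg_ln (f (\<tau> i (z v) * (weight v z * t))) \<partial>count_space UNIV) \<partial>count_space ?A)"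
    by (subst infprod_eq_exp_neg)
       (simp_all add: unit_functionD[OF f] nn_integral_count_space_snoc branch_weight_snoc mult_ac)
  moreover have "infprod (\<lambda>v. smoothing_kernel c \<tau> f (weight v z * t) (z v)) ?A
      = exp_neg (\<integral>\<^sup>+v. ennreal (weight v z * t) * ennreal (c (z v))
        + (\<integral>\<^sup>+i. neg_ln (f (\<tau> i (z v) * (weight v z * t))) \<partial>count_space UNIV) \<partial>count_space ?A)"
    unfolding infprod_exp_neg[symmetric]
    by (simp add: smoothing_kernel_def exp_neg_add infprod_eq_exp_neg unit_functionD[OF f])
  ultimately show ?thesis
    by (simp add: D_eq exp_neg_add nn_integral_add mult.assoc)
qed

section \<open>The filtration by generations and resampling of marks\<close>

lemma space_\<F> [simp]: "space (\<F> n) = space marks"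
  by (simp add: \<F>_def)

lemma coordinate_measurable_\<F>:
  assumes "length u < n"
  shows "(\<lambda>z. z u) \<in> measurable (\<F> n) N"
proof -
  let ?U = "{u. length u < n}"
  have "(\<lambda>z. restrict z ?U) \<in> measurable (\<F> n) (\<Pi>\<^sub>M u\<in>?U. N)"
    unfolding \<F>_def
    by (rule measurable_vimage_algebra1) (auto simp: space_marks space_PiM)
  from measurable_compose[OF this measurable_component_singleton[of u]] assms show ?thesis
    by simp
qed

lemma subalgebra_\<F>I:
  assumes "space R = space marks" "\<And>u. length u < n \<Longrightarrow> (\<lambda>z. z u) \<in> measurable R N"
  shows "subalgebra R (\<F> n)"
  unfolding subalgebra_def
proof
  show "space (\<F> n) = space R" by (simp add: assms)
  show "sets (\<F> n) \<subseteq> sets R"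
    unfolding \<F>_def
    by (rule sets_image_in_sets[OF assms(1)]) (rule measurable_restrict, use assms in simp)
qed

lemma subalgebra_\<F>: "subalgebra marks (\<F> n)" "subalgebra (\<F> (Suc n)) (\<F> n)"
  by (rule subalgebra_\<F>I; simp add: coordinate_measurable_\<F>)+

text \<open>A level set of \<open>G\<close> is a preimage under restriction to the words shorter
  than \<open>n\<close>, so changing the mark of a longer word cannot leave it.\<close>

lemma \<F>_invariant:
  fixes G :: "(nat list \<Rightarrow> 'a) \<Rightarrow> real"
  assumes G: "G \<in> borel_measurable (\<F> n)" and "z \<in> space marks" "x \<in> space N" "n \<le> length v"
  shows "G (z(v := x)) = G z"
proof -
  let ?U = "{u. length u < n}"
  have "G -` {G z} \<inter> space marks \<in> sets (\<F> n)"
    using measurable_sets[OF G, of "{G z}"] by simp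
  then obtain B where B: "G -` {G z} \<inter> space marks = (\<lambda>z. restrict z ?U) -` B \<inter> space marks"
    unfolding \<F>_def by (subst (asm) sets_vimage_algebra2) (auto simp: space_marks space_PiM)
  have "restrict (z(v := x)) ?U = restrict z ?U"
    using assms(4) by (auto simp: restrict_def fun_eq_iff)
  moreover have "z(v := x) \<in> space marks"
    using assms by (auto simp: space_marks)
  moreover have "z \<in> G -` {G z} \<inter> space marks" using assms by simp
  ultimately have "z(v := x) \<in> G -` {G z} \<inter> space marks"
    unfolding B by simp
  then show ?thesis by simp
qed

text \<open>Replacing one coordinate by an independent copy preserves the product measure; this
  takes the place of conditioning on all other marks.\<close>

lemma integral_marks_fun_upd:
  fixes Q :: "(nat list \<Rightarrow> 'a) \<Rightarrow> real"
  assumes Q [measurable]: "Q \<in> borel_measurable marks" and bound: "\<And>z. z \<in> space marks \<Longrightarrow> \<bar>Q z\<bar> \<le> 1"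
  shows "(\<integral>z. Q z \<partial>marks) = (\<integral>z. (\<integral>x. Q (z(v := x)) \<partial>N) \<partial>marks)"
proof -
  interpret NQ: pair_prob_space N marks ..
  have eq: "distr (N \<Otimes>\<^sub>M marks) marks (\<lambda>(x, z). z(v := x)) = marks"
    using distr_pair_PiM_eq_PiM[of UNIV "\<lambda>_. N" v] prob_space_axioms
    by (simp add: marks_def)
  have upd [measurable]: "(\<lambda>(x, z). z(v := x)) \<in> measurable (N \<Otimes>\<^sub>M marks) marks"
    unfolding marks_def case_prod_unfold
    by (rule measurable_fun_upd[where J=UNIV]) auto
  have "(\<integral>z. Q z \<partial>marks) = (\<integral>y. (\<lambda>(x, z). Q (z(v := x))) y \<partial>(N \<Otimes>\<^sub>M marks))"
    by (subst eq[symmetric], subst integral_distr) (auto simp: case_prod_unfold)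
  also have "\<dots> = (\<integral>z. (\<integral>x. Q (z(v := x)) \<partial>N) \<partial>marks)"
  proof (rule NQ.integral_snd[symmetric])
    show "integrable (N \<Otimes>\<^sub>M marks) (\<lambda>(x, z). Q (z(v := x)))"
    proof (rule NQ.integrable_const_bound[where B=1])
      show "AE y in N \<Otimes>\<^sub>M marks. norm (case y of (x, z) \<Rightarrow> Q (z(v := x))) \<le> 1"
        using measurable_space[OF upd] bound by (intro AE_I2) (auto simp: case_prod_unfold)
      show "(\<lambda>(x, z). Q (z(v := x))) \<in> borel_measurable (N \<Otimes>\<^sub>M marks)"
        using measurable_compose[OF upd Q] by (simp add: case_prod_unfold)
    qed
  qed
  finally show ?thesis .
qed

text \<open>Resampling the mark at \<open>v\<close> affects only the kernel at \<open>v\<close>,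
  whose inner integral is the smoothed function. That factor is then absorbed into
  \<open>\<Gamma>\<close>, which is why the induction generalizes over
  \<open>\<Gamma>\<close>.\<close>

lemma integral_prod_smoothing_kernel:
  fixes \<Gamma> :: "(nat list \<Rightarrow> 'a) \<Rightarrow> real"
  assumes f: "unit_function f" and "finite V"
    and "\<Gamma> \<in> borel_measurable marks" "\<And>z. z \<in> space marks \<Longrightarrow> \<bar>\<Gamma> z\<bar> \<le> 1"
    and "\<And>v z x. v \<in> V \<Longrightarrow> z \<in> space marks \<Longrightarrow> x \<in> space N \<Longrightarrow> \<Gamma> (z(v := x)) = \<Gamma> z"
    and X: "\<And>v. v \<in> V \<Longrightarrow> X v \<in> borel_measurable marks"
      "\<And>u v z x. u \<in> V \<Longrightarrow> v \<in> V \<Longrightarrow> z \<in> space marks \<Longrightarrow> x \<in> space N \<Longrightarrow> X u (z(v := x)) = X u z"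
  shows "(\<integral>z. \<Gamma> z * (\<Prod>v\<in>V. smoothing_kernel c \<tau> f (X v z) (z v)) \<partial>marks)
    = (\<integral>z. \<Gamma> z * (\<Prod>v\<in>V. smoothing N c \<tau> f (X v z)) \<partial>marks)"
  using assms(2-)
proof (induction V arbitrary: \<Gamma> rule: finite_induct)
  case (insert v V)
  note f' = unit_functionD[OF unit_function_smoothing[OF f]]
  note k = smoothing_kernel_bounds[of f \<tau> _ _ c, OF unit_functionD(2,3)[OF f]]
  note [measurable] = insert.prems(1) f'(1) f
  have X_meas [measurable]: "X u \<in> borel_measurable marks" if "u \<in> insert v V" for u
    using insert.prems(4)[OF that] .
  let ?P = "\<lambda>z. \<Prod>u\<in>V. smoothing_kernel c \<tau> f (X u z) (z u)"
  have P: "0 \<le> ?P z" "?P z \<le> 1" for z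
    using k by (auto intro!: prod_nonneg prod_le_1)
  have P_meas [measurable]: "?P \<in> borel_measurable marks"
    using f by (intro borel_measurable_prod smoothing_kernel_measurable') auto
  have v_meas [measurable]: "X v \<in> borel_measurable marks" by simp
  have "(\<integral>z. \<Gamma> z * (\<Prod>u\<in>insert v V. smoothing_kernel c \<tau> f (X u z) (z u)) \<partial>marks)
      = (\<integral>z. \<Gamma> z * smoothing_kernel c \<tau> f (X v z) (z v) * ?P z \<partial>marks)"
    using insert.hyps by (simp add: mult.assoc)
  also have "\<dots> = (\<integral>z. (\<integral>x. \<Gamma> (z(v := x)) * smoothing_kernel c \<tau> f (X v (z(v := x))) ((z(v := x)) v)
      * ?P (z(v := x)) \<partial>N) \<partial>marks)"
  proof (rule integral_marks_fun_upd)
    show "(\<lambda>z. \<Gamma> z * smoothing_kernel c \<tau> f (X v z) (z v) * ?P z) \<in> borel_measurable marks"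
      using smoothing_kernel_measurable'[OF f v_meas coordinate_measurable[of v]] P_meas by measurable
    show "\<bar>\<Gamma> z * smoothing_kernel c \<tau> f (X v z) (z v) * ?P z\<bar> \<le> 1" if "z \<in> space marks" for z
      using insert.prems(2)[OF that] k P by (auto simp: abs_mult intro!: mult_le_one mult_nonneg_nonneg)
  qed
  also have "\<dots> = (\<integral>z. (\<integral>x. (\<Gamma> z * ?P z) * smoothing_kernel c \<tau> f (X v z) x \<partial>N) \<partial>marks)"
  proof (intro Bochner_Integration.integral_cong refl)
    fix z x assume z: "z \<in> space marks" and x: "x \<in> space N"
    have "?P (z(v := x)) = ?P z"
    proof (intro prod.cong refl)
      fix u assume "u \<in> V"
      then have "X u (z(v := x)) = X u z" "(z(v := x)) u = z u"
        using insert.hyps insert.prems(5)[of u v, OF _ _ z x] by (blast, auto)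
      then show "smoothing_kernel c \<tau> f (X u (z(v := x))) ((z(v := x)) u)
          = smoothing_kernel c \<tau> f (X u z) (z u)"
        by (simp only:)
    qed
    moreover have "\<Gamma> (z(v := x)) = \<Gamma> z" "X v (z(v := x)) = X v z"
      by (rule insert.prems(3)[OF _ z x] insert.prems(5)[OF _ _ z x]; simp)+
    ultimately show "\<Gamma> (z(v := x)) * smoothing_kernel c \<tau> f (X v (z(v := x))) ((z(v := x)) v) * ?P (z(v := x))
        = (\<Gamma> z * ?P z) * smoothing_kernel c \<tau> f (X v z) x"
      by (simp only: fun_upd_same mult.assoc mult.commute[of _ "?P z"])
  qed
  also have "\<dots> = (\<integral>z. (\<Gamma> z * smoothing N c \<tau> f (X v z)) * ?P z \<partial>marks)"
    by (simp add: smoothing_def mult_ac)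
  also have "\<dots> = (\<integral>z. (\<Gamma> z * smoothing N c \<tau> f (X v z)) * (\<Prod>u\<in>V. smoothing N c \<tau> f (X u z)) \<partial>marks)"
  proof (rule insert.IH)
    show "(\<lambda>z. \<Gamma> z * smoothing N c \<tau> f (X v z)) \<in> borel_measurable marks"
      by measurable
    show "\<bar>\<Gamma> z * smoothing N c \<tau> f (X v z)\<bar> \<le> 1" if "z \<in> space marks" for z
      using insert.prems(2)[OF that] f' by (auto simp: abs_mult intro!: mult_le_one)
  qed (use insert.prems in auto)
  also have "\<dots> = (\<integral>z. \<Gamma> z * (\<Prod>u\<in>insert v V. smoothing N c \<tau> f (X u z)) \<partial>marks)"
    using insert.hyps by (simp add: mult.assoc)
  finally show ?case .
qed simp

text \<open>The marks can be integrated out for finitely many nodes of the generation only; both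
  infinite products are reached as limits along \<open>first_elements\<close>.\<close>

lemma integral_D_Suc:
  assumes f: "unit_function f" and t: "0 \<le> t"
    and G: "G \<in> borel_measurable (\<F> n)" "\<And>z. z \<in> space marks \<Longrightarrow> \<bar>G z\<bar> \<le> 1"
  shows "(\<integral>z. G z * D (Suc n) f t z \<partial>marks) = (\<integral>z. G z * D n (smoothing N c \<tau> f) t z \<partial>marks)"
proof -
  let ?A = "{v :: nat list. length v = n}"
  let ?\<Gamma> = "\<lambda>z. G z * exp_neg (ennreal t * partial_weight n z)"
  let ?X = "\<lambda>v z. weight v z * t"
  note f' = unit_functionD[OF unit_function_smoothing[OF f]]
  note k = smoothing_kernel_bounds[of f \<tau> _ _ c, OF unit_functionD(2,3)[OF f]]
  have \<Gamma>_\<F>: "?\<Gamma> \<in> borel_measurable (\<F> n)"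
    using G(1) partial_weight_measurable[OF coordinate_measurable_\<F>] by measurable
  have X_\<F>: "?X v \<in> borel_measurable (\<F> n)" if "v \<in> ?A" for v
    using weight_measurable[OF coordinate_measurable_\<F>[of _ n], of v] that by simp
  have \<Gamma> [measurable]: "?\<Gamma> \<in> borel_measurable marks"
    by (rule measurable_from_subalg[OF subalgebra_\<F>(1) \<Gamma>_\<F>])
  have X: "?X v \<in> borel_measurable marks" if "v \<in> ?A" for v
    by (rule measurable_from_subalg[OF subalgebra_\<F>(1) X_\<F>[OF that]])
  have \<Gamma>_le: "\<bar>?\<Gamma> z\<bar> \<le> 1" if "z \<in> space marks" for z
    using G(2)[OF that] by (auto simp: abs_mult intro!: mult_le_one)
  have limit: "(\<lambda>m. \<integral>z. ?\<Gamma> z * (\<Prod>v\<in>first_elements ?A m. h v z) \<partial>marks)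
      \<longlonglongrightarrow> (\<integral>z. ?\<Gamma> z * infprod (\<lambda>v. h v z) ?A \<partial>marks)"
    if h: "\<And>v. v \<in> ?A \<Longrightarrow> h v \<in> borel_measurable marks" "\<And>v z. 0 \<le> h v z" "\<And>v z. h v z \<le> 1" for h
  proof (rule integral_dominated_convergence[where w="\<lambda>_. 1"])
    have "(\<lambda>z. infprod (\<lambda>v. h v z) ?A) \<in> borel_measurable marks"
      using h by (intro borel_measurable_infprod) auto
    then show "(\<lambda>z. ?\<Gamma> z * infprod (\<lambda>v. h v z) ?A) \<in> borel_measurable marks"
      using \<Gamma> by measurable
    have "(\<lambda>z. \<Prod>v\<in>first_elements ?A m. h v z) \<in> borel_measurable marks" for m
      using h first_elements_subset[of ?A m] by (intro borel_measurable_prod) auto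
    then show "(\<lambda>z. ?\<Gamma> z * (\<Prod>v\<in>first_elements ?A m. h v z)) \<in> borel_measurable marks" for m
      using \<Gamma> by measurable
    show "AE z in marks. (\<lambda>m. ?\<Gamma> z * (\<Prod>v\<in>first_elements ?A m. h v z))
        \<longlonglongrightarrow> ?\<Gamma> z * infprod (\<lambda>v. h v z) ?A"
      using h by (intro AE_I2 tendsto_intros prod_first_elements_tendsto)
    have "\<bar>\<Prod>v\<in>first_elements ?A m. h v z\<bar> \<le> 1" for m z
      using h by (simp add: abs_of_nonneg prod_nonneg prod_le_1)
    then show "AE z in marks. norm (?\<Gamma> z * (\<Prod>v\<in>first_elements ?A m. h v z)) \<le> 1" for m
      using \<Gamma>_le by (intro AE_I2) (subst real_norm_def, subst abs_mult, rule mult_le_one, auto)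
  qed simp
  have "(\<integral>z. ?\<Gamma> z * (\<Prod>v\<in>first_elements ?A m. smoothing_kernel c \<tau> f (?X v z) (z v)) \<partial>marks)
      = (\<integral>z. ?\<Gamma> z * (\<Prod>v\<in>first_elements ?A m. smoothing N c \<tau> f (?X v z)) \<partial>marks)" for m
  proof (rule integral_prod_smoothing_kernel[OF f _ \<Gamma> \<Gamma>_le])
    fix v z x assume "v \<in> first_elements ?A m" and z: "z \<in> space marks" and x: "x \<in> space N"
    then have v: "n \<le> length v" using first_elements_subset[of ?A m] by auto
    show "?\<Gamma> (z(v := x)) = ?\<Gamma> z"
      using \<F>_invariant[OF \<Gamma>_\<F> z x v] .
    show "?X u (z(v := x)) = ?X u z" if "u \<in> first_elements ?A m" for u
      using \<F>_invariant[OF X_\<F> z x v, of u] that first_elements_subset[of ?A m] by auto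
  qed (use X first_elements_subset[of ?A m] in auto)
  moreover have "(\<lambda>m. \<integral>z. ?\<Gamma> z * (\<Prod>v\<in>first_elements ?A m. smoothing_kernel c \<tau> f (?X v z) (z v)) \<partial>marks)
      \<longlonglongrightarrow> (\<integral>z. ?\<Gamma> z * infprod (\<lambda>v. smoothing_kernel c \<tau> f (?X v z) (z v)) ?A \<partial>marks)"
    using k X by (intro limit smoothing_kernel_measurable' f coordinate_measurable) auto
  moreover have "(\<lambda>m. \<integral>z. ?\<Gamma> z * (\<Prod>v\<in>first_elements ?A m. smoothing N c \<tau> f (?X v z)) \<partial>marks)
      \<longlonglongrightarrow> (\<integral>z. ?\<Gamma> z * infprod (\<lambda>v. smoothing N c \<tau> f (?X v z)) ?A \<partial>marks)"
    using f' X by (intro limit measurable_compose[OF _ f'(1)]) auto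
  ultimately have "(\<integral>z. ?\<Gamma> z * infprod (\<lambda>v. smoothing_kernel c \<tau> f (?X v z) (z v)) ?A \<partial>marks)
      = (\<integral>z. ?\<Gamma> z * infprod (\<lambda>v. smoothing N c \<tau> f (?X v z)) ?A \<partial>marks)"
    using LIMSEQ_unique by simp
  moreover have "(\<integral>z. G z * D (Suc n) f t z \<partial>marks)
      = (\<integral>z. ?\<Gamma> z * infprod (\<lambda>v. smoothing_kernel c \<tau> f (?X v z) (z v)) ?A \<partial>marks)"
    by (intro Bochner_Integration.integral_cong refl) (simp add: D_Suc[OF f t])
  ultimately show ?thesis
    by (simp add: D_eq mult.assoc)
qed

lemma unit_function_iterate: "unit_function f \<Longrightarrow> unit_function ((smoothing N c \<tau> ^^ m) f)"
  by (induction m) (auto intro: unit_function_smoothing)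

text \<open>Each step removes the last generation at the price of replacing \<open>f\<close> by its
  smoothing, so the induction generalizes over \<open>f\<close>; the test function stays admissible
  because the filtration increases.\<close>

lemma integral_D_add:
  assumes f: "unit_function f" and t: "0 \<le> t"
    and G: "G \<in> borel_measurable (\<F> n)" "\<And>z. z \<in> space marks \<Longrightarrow> \<bar>G z\<bar> \<le> 1"
  shows "(\<integral>z. G z * D (n + m) f t z \<partial>marks) = (\<integral>z. G z * D n ((smoothing N c \<tau> ^^ m) f) t z \<partial>marks)"
  using f
proof (induction m arbitrary: f)
  case (Suc m)
  have "subalgebra (\<F> (n + m)) (\<F> n)"
    by (rule subalgebra_\<F>I) (auto intro: coordinate_measurable_\<F>)
  then have "G \<in> borel_measurable (\<F> (n + m))"
    using G(1) measurable_from_subalg by blast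
  from integral_D_Suc[OF Suc.prems t this G(2)]
  have "(\<integral>z. G z * D (n + Suc m) f t z \<partial>marks) = (\<integral>z. G z * D (n + m) (smoothing N c \<tau> f) t z \<partial>marks)"
    by simp
  also have "\<dots> = (\<integral>z. G z * D n ((smoothing N c \<tau> ^^ m) (smoothing N c \<tau> f)) t z \<partial>marks)"
    by (rule Suc.IH[OF unit_function_smoothing[OF Suc.prems]])
  finally show ?case by (simp add: funpow_swap1)
qed simp

lemma integral_D:
  assumes "unit_function f" "0 \<le> t"
  shows "(\<integral>z. D n f t z \<partial>marks) = (smoothing N c \<tau> ^^ n) f t"
  using integral_D_add[OF assms, of "\<lambda>_. 1" 0 n] by (simp add: D_0 marks.prob_space)

end

section \<open>Disintegrations of fixed points\<close>

lemma nn_integral_count_space_length_tendsto: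
  "(\<lambda>n. \<integral>\<^sup>+u. g u \<partial>count_space {u :: 'b list. length u < n}) \<longlonglongrightarrow> (\<integral>\<^sup>+u. g u \<partial>count_space UNIV)"
proof -
  have "(\<lambda>n. \<integral>\<^sup>+u. g u * indicator {u. length u < n} u \<partial>count_space UNIV) \<longlonglongrightarrow> (\<integral>\<^sup>+u. g u \<partial>count_space UNIV)"
  proof (rule nn_integral_LIMSEQ)
    show "incseq (\<lambda>n u. g u * indicator {u :: 'b list. length u < n} u)"
      by (auto simp: incseq_def le_fun_def indicator_def)
    fix u :: "'b list"
    have "\<forall>\<^sub>F n in sequentially. g u * indicator {u. length u < n} u = g u"
      using eventually_gt_at_top[of "length u"] by eventually_elim (auto simp: indicator_def)
    then show "(\<lambda>n. g u * indicator {u. length u < n} u) \<longlonglongrightarrow> g u"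
      by (rule tendsto_eventually)
  qed auto
  then show ?thesis
    by (simp add: nn_integral_count_space_indicator)
qed

lemma disintegration_eqI:
  assumes "(\<lambda>n. disintegration_step C T f n t \<omega>) \<longlonglongrightarrow> l"
  shows "disintegration C T f t \<omega> = l"
proof -
  have "(\<lambda>n. ereal (disintegration_step C T f n t \<omega>)) \<longlonglongrightarrow> ereal l"
    using assms by simp
  then have "liminf (\<lambda>n. ereal (disintegration_step C T f n t \<omega>)) = ereal l"
    by (rule lim_imp_Liminf[rotated]) simp
  then show ?thesis by (simp add: disintegration_def)
qed

context random_weights
begin

abbreviation total :: "(nat list \<Rightarrow> 'a) \<Rightarrow> ennreal" where
  "total \<equiv> total_weight (\<lambda>v z. c (z v)) (\<lambda>v i z. \<tau> i (z v))"

abbreviation \<Phi> :: "nat \<Rightarrow> (real \<Rightarrow> real) \<Rightarrow> real \<Rightarrow> (nat list \<Rightarrow> 'a) \<Rightarrow> real" where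
  "\<Phi> n f \<equiv> disintegration_step (\<lambda>_ _. 0) (\<lambda>v i z. \<tau> i (z v)) f n"

lemma random_weights_0: "random_weights N (\<lambda>_. 0) \<tau>"
  by unfold_locales (auto simp: \<tau>_nonneg)

lemma \<Phi>_eq: "\<Phi> n f t z = infprod (\<lambda>v. f (weight v z * t)) {v. length v = n}"
  by (simp add: random_weights.D_eq[OF random_weights_0])

lemma D_eq_\<Phi>: "D n f t z = exp_neg (ennreal t * partial_weight n z) * \<Phi> n f t z"
  by (simp add: D_eq \<Phi>_eq)

lemma partial_weight_tendsto: "(\<lambda>n. partial_weight n z) \<longlonglongrightarrow> total z"
  unfolding total_weight_def infsum_eq_nn_integral_count_space
  by (rule nn_integral_count_space_length_tendsto)

lemma exp_neg_partial_weight_tendsto: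
  "(\<lambda>n. exp_neg (ennreal t * partial_weight n z)) \<longlonglongrightarrow> exp_neg (ennreal t * total z)"
  by (intro tendsto_exp_neg ennreal_tendsto_cmult partial_weight_tendsto) simp

lemma partial_weight_measurable' [measurable]: "partial_weight n \<in> borel_measurable marks"
  by (intro partial_weight_measurable coordinate_measurable)

lemma total_measurable [measurable]: "total \<in> borel_measurable marks"
  by (rule borel_measurable_LIMSEQ_order[OF partial_weight_tendsto partial_weight_measurable'])

lemma D_measurable' [measurable (raw)]: "unit_function f \<Longrightarrow> D n f t \<in> borel_measurable marks"
  by (intro D_measurable coordinate_measurable)

lemma integrable_marks:
  fixes g :: "(nat list \<Rightarrow> 'a) \<Rightarrow> real"
  assumes "g \<in> borel_measurable marks" "\<And>z. z \<in> space marks \<Longrightarrow> \<bar>g z\<bar> \<le> 1"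
  shows "integrable marks g"
  using assms by (intro marks.integrable_const_bound[where B=1]) auto

text \<open>The fixed-point property holds on the half-line only, so functions cannot be rewritten
  as a whole; \<open>smoothing_cong\<close> compares them where the operator evaluates them.\<close>

lemma iterate_eq:
  assumes "\<forall>s\<ge>0. smoothing N c \<tau> f s = f s" "0 \<le> t"
  shows "(smoothing N c \<tau> ^^ n) f t = f t"
  using assms(2)
proof (induction n arbitrary: t)
  case (Suc n)
  have "smoothing N c \<tau> ((smoothing N c \<tau> ^^ n) f) t = smoothing N c \<tau> f t"
    by (rule smoothing_cong[OF Suc.IH Suc.prems])
  then show ?case using assms(1) Suc.prems by simp
qed simp

lemma integral_D_fixed:
  assumes "unit_function f" "\<forall>s\<ge>0. smoothing N c \<tau> f s = f s" "0 \<le> t"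
  shows "(\<integral>z. D n f t z \<partial>marks) = f t"
  by (simp add: integral_D assms iterate_eq)

lemma D_AE_convergent:
  assumes f: "unit_function f" and fixed: "\<forall>s\<ge>0. smoothing N c \<tau> f s = f s" and t: "0 \<le> t"
  shows "AE z in marks. convergent (\<lambda>n. D n f t z)"
proof (rule marks.bounded_martingale_AE_convergent[where F=\<F>])
  fix n and G :: "(nat list \<Rightarrow> 'a) \<Rightarrow> real" assume G: "G \<in> borel_measurable (\<F> n)" "\<And>z. z \<in> space marks \<Longrightarrow> \<bar>G z\<bar> \<le> 1"
  show "(\<integral>z. G z * D (Suc n) f t z \<partial>marks) = (\<integral>z. G z * D n f t z \<partial>marks)"
  proof -
    have "(\<integral>z. G z * D (Suc n) f t z \<partial>marks) = (\<integral>z. G z * D n (smoothing N c \<tau> f) t z \<partial>marks)"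
      using G by (intro integral_D_Suc f t)
    also have "\<dots> = (\<integral>z. G z * D n f t z \<partial>marks)"
      using fixed t by (intro Bochner_Integration.integral_cong refl arg_cong2[where f="(*)"] D_cong) auto
    finally show ?thesis .
  qed
qed (use f in \<open>simp_all add: subalgebra_\<F> D_measurable coordinate_measurable_\<F> D_bounds\<close>)

lemma fixed_pointD:
  assumes "P \<in> fixed_points N c \<tau>"
  defines "f \<equiv> \<lambda>s. laplace_transform P \<bar>s\<bar>"
  shows "nonneg_distribution P" "unit_function f" "\<forall>s\<ge>0. smoothing N c \<tau> f s = f s"
proof -
  have P: "nonneg_distribution P"
    and eq: "\<And>s. 0 \<le> s \<Longrightarrow> smoothing N c \<tau> (laplace_transform P) s = laplace_transform P s"
    using assms(1) by (auto simp: fixed_points_iff_smoothing)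
  show "nonneg_distribution P" by fact
  show "unit_function f"
    unfolding f_def by (rule nonneg_distribution.unit_function_laplace_transform[OF P])
  show "\<forall>s\<ge>0. smoothing N c \<tau> f s = f s"
    using eq smoothing_cong[of f "laplace_transform P"] by (simp add: f_def)
qed

section \<open>Finiteness consequences of the existence of a fixed point\<close>

lemma total_AE_finite:
  assumes "P \<in> fixed_points N c \<tau>"
  shows "AE z in marks. total z < \<infinity>"
proof (rule marks.AE_finite_if_laplace_transform_tendsto_1)
  interpret hom: random_weights N "\<lambda>_. 0" \<tau> by (rule random_weights_0)
  note P = fixed_pointD[OF assms]
  let ?f = "\<lambda>s. laplace_transform P \<bar>s\<bar>"
  show "(\<lambda>k. laplace_transform P (1 / 2 ^ k)) \<longlonglongrightarrow> 1"
    using nonneg_distribution.laplace_transform_tendsto_1[OF P(1), of 1] by simp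
  fix k :: nat
  let ?t = "1 / 2 ^ k :: real"
  have "?f ?t \<le> (\<integral>z. exp_neg (ennreal ?t * partial_weight n z) \<partial>marks)" for n
  proof -
    have "?f ?t = (\<integral>z. D n ?f ?t z \<partial>marks)"
      by (rule integral_D_fixed[OF P(2,3), symmetric]) auto
    also have "\<dots> \<le> (\<integral>z. exp_neg (ennreal ?t * partial_weight n z) \<partial>marks)"
      using D_bounds[OF P(2)] hom.D_bounds[OF P(2)]
      by (intro integral_mono integrable_marks D_measurable' P(2))
         (auto simp: D_eq_\<Phi> intro!: mult_left_le)
    finally show ?thesis .
  qed
  moreover have "(\<lambda>n. \<integral>z. exp_neg (ennreal ?t * partial_weight n z) \<partial>marks)
      \<longlonglongrightarrow> (\<integral>z. exp_neg (ennreal ?t * total z) \<partial>marks)"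
    by (rule integral_dominated_convergence[where w="\<lambda>_. 1"])
       (auto intro!: exp_neg_partial_weight_tendsto simp del: ennreal_1)
  ultimately have "?f ?t \<le> (\<integral>z. exp_neg (ennreal ?t * total z) \<partial>marks)"
    by (intro LIMSEQ_le_const) auto
  then show "laplace_transform P ?t \<le> (\<integral>z. exp_neg (ennreal ?t * total z) \<partial>marks)" by simp
qed measurable

text \<open>Dropping the exponential factor from the martingale gives the required lower bound on
  the mean product. The result justifies limits inside the product over a fixed generation.\<close>

lemma sum_over_generation_finite:
  assumes "P \<in> fixed_points N c \<tau>" and t: "0 \<le> t"
  shows "AE z in marks. (\<integral>\<^sup>+v. ennreal (1 - laplace_transform P (weight v z * t)) \<partial>count_space {v. length v = n}) < \<infinity>"
proof (rule marks.sum_one_minus_laplace_transform_finite)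
  interpret hom: random_weights N "\<lambda>_. 0" \<tau> by (rule random_weights_0)
  note P = fixed_pointD[OF assms(1)]
  let ?f = "\<lambda>s. laplace_transform P \<bar>s\<bar>"
  show "nonneg_distribution P" by (rule P(1))
  fix s :: real assume s: "0 \<le> s"
  have "laplace_transform P s = (\<integral>z. D n ?f s z \<partial>marks)"
    using integral_D_fixed[OF P(2,3) s] s by simp
  also have "\<dots> \<le> (\<integral>z. \<Phi> n ?f s z \<partial>marks)"
    using D_bounds[OF P(2)] hom.D_bounds[OF P(2)]
    by (intro integral_mono integrable_marks D_measurable' hom.D_measurable' P(2))
       (auto simp: D_eq_\<Phi> intro!: mult_left_le_one_le)
  also have "\<dots> = (\<integral>z. infprod (\<lambda>v. laplace_transform P (weight v z * s)) {v. length v = n} \<partial>marks)"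
    unfolding \<Phi>_eq using weight_nonneg s
    by (intro Bochner_Integration.integral_cong infprod_cong) auto
  finally show "laplace_transform P s
      \<le> (\<integral>z. infprod (\<lambda>v. laplace_transform P (weight v z * s)) {v. length v = n} \<partial>marks)" .
qed (auto intro: weight_measurable coordinate_measurable weight_nonneg t)

text \<open>The analogue for a single node on \<open>N\<close>, as needed for limits under the
  operator itself.\<close>

lemma sum_over_children_finite:
  assumes "P \<in> fixed_points N c \<tau>" and t: "0 \<le> t"
  shows "AE x in N. (\<integral>\<^sup>+i. ennreal (1 - laplace_transform P (\<tau> i x * t)) \<partial>count_space UNIV) < \<infinity>"
proof (rule sum_one_minus_laplace_transform_finite)
  interpret hom: random_weights N "\<lambda>_. 0" \<tau> by (rule random_weights_0)
  note P = fixed_pointD[OF assms(1)]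
  let ?f = "\<lambda>s. laplace_transform P \<bar>s\<bar>"
  show "nonneg_distribution P" by (rule P(1))
  fix s :: real assume s: "0 \<le> s"
  have bounds: "0 \<le> infprod (\<lambda>i. ?f (\<tau> i x * s)) UNIV" for x
    by (rule infprod_bounds) (auto simp: unit_functionD[OF P(2)])
  have "laplace_transform P s = smoothing N c \<tau> ?f s"
    using P(3) s by simp
  also have "\<dots> \<le> smoothing N (\<lambda>_. 0) \<tau> ?f s"
    unfolding smoothing_def
    by (intro integral_mono integrable_smoothing_kernel hom.integrable_smoothing_kernel P(2))
       (auto simp: smoothing_kernel_def intro!: mult_left_le_one_le bounds)
  also have "\<dots> = (\<integral>x. infprod (\<lambda>i. laplace_transform P (\<tau> i x * s)) UNIV \<partial>N)"
    unfolding smoothing_def smoothing_kernel_def using \<tau>_nonneg s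
    by (intro Bochner_Integration.integral_cong) (auto intro!: infprod_cong)
  finally show "laplace_transform P s \<le> (\<integral>x. infprod (\<lambda>i. laplace_transform P (\<tau> i x * s)) UNIV \<partial>N)" .
qed (auto simp: \<tau>_nonneg t)

lemma disintegration_0_measurable:
  assumes f: "unit_function f"
  shows "disintegration (\<lambda>_ _. 0) (\<lambda>v i z. \<tau> i (z v)) f t \<in> borel_measurable marks"
proof -
  interpret hom: random_weights N "\<lambda>_. 0" \<tau> by (rule random_weights_0)
  note [measurable] = hom.D_measurable'[OF f]
  show ?thesis unfolding disintegration_def[abs_def] by measurable
qed

lemma disintegration_cong:
  assumes "\<And>s. 0 \<le> s \<Longrightarrow> f s = g s" "0 \<le> t" "z \<in> space marks"
  shows "disintegration (\<lambda>v z. c (z v)) (\<lambda>v i z. \<tau> i (z v)) f t z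
    = disintegration (\<lambda>v z. c (z v)) (\<lambda>v i z. \<tau> i (z v)) g t z"
  unfolding disintegration_def using D_cong[OF assms] by simp

text \<open>\<open>P\<close> serves only as a control: it bounds the mean loss in the exponential
  factor, as \<open>Q\<close> does for the product. The fixed point obtained does not otherwise
  depend on \<open>P\<close>.\<close>

theorem fixed_point_from_homogeneous:
  assumes P: "P \<in> fixed_points N c \<tau>" and Q: "Q \<in> fixed_points N (\<lambda>_. 0) \<tau>"
  shows "\<exists>R\<in>fixed_points N c \<tau>. \<forall>t\<ge>0. laplace_transform R t =
    (\<integral>z. exp_neg (ennreal t * total z) *
      disintegration (\<lambda>_ _. 0) (\<lambda>v i z. \<tau> i (z v)) (laplace_transform Q) t z \<partial>marks)"
proof -
  interpret hom: random_weights N "\<lambda>_. 0" \<tau> by (rule random_weights_0)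
  note P' = fixed_pointD[OF P] and Q' = hom.fixed_pointD[OF Q]
  interpret P: nonneg_distribution P by (rule P'(1))
  interpret Q: nonneg_distribution Q by (rule Q'(1))
  let ?f = "\<lambda>s. laplace_transform P \<bar>s\<bar>" and ?q = "\<lambda>s. laplace_transform Q \<bar>s\<bar>"
  let ?b = "\<lambda>s. (1 - laplace_transform P s) + (1 - laplace_transform Q s)"
  let ?M = "disintegration (\<lambda>_ _. 0) (\<lambda>v i z. \<tau> i (z v))"
  define g where "g t = (\<integral>z. exp_neg (ennreal t * total z) * ?M ?q t z \<partial>marks)" for t
  have g_eq: "g t = (\<integral>z. exp_neg (ennreal t * total z) * ?M (laplace_transform Q) t z \<partial>marks)" if "0 \<le> t" for t
    unfolding g_def using that
    by (intro Bochner_Integration.integral_cong refl arg_cong2[where f="(*)"] hom.disintegration_cong) auto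
  have lim: "(\<lambda>n. (smoothing N c \<tau> ^^ n) ?q t) \<longlonglongrightarrow> g t" if t: "0 \<le> t" for t
  proof -
    have "(\<lambda>n. \<integral>z. D n ?q t z \<partial>marks) \<longlonglongrightarrow> g t"
      unfolding g_def
    proof (rule integral_dominated_convergence[where w="\<lambda>_. 1"])
      show "AE z in marks. (\<lambda>n. D n ?q t z) \<longlonglongrightarrow> exp_neg (ennreal t * total z) * ?M ?q t z"
        using hom.D_AE_convergent[OF Q'(2,3) t]
      proof eventually_elim
        case (elim z)
        then obtain l where l: "(\<lambda>n. \<Phi> n ?q t z) \<longlonglongrightarrow> l" by (auto simp: convergent_def)
        then show ?case
          unfolding D_eq_\<Phi> disintegration_eqI[OF l] by (intro tendsto_intros exp_neg_partial_weight_tendsto)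
      qed
      show "(\<lambda>z. exp_neg (ennreal t * total z) * ?M ?q t z) \<in> borel_measurable marks"
        using disintegration_0_measurable[OF Q'(2)] by measurable
      show "AE z in marks. norm (D n ?q t z) \<le> 1" for n
        using D_bounds[OF Q'(2)] by simp
    qed (use D_measurable'[OF Q'(2)] in auto)
    then show ?thesis by (simp add: integral_D[OF Q'(2) t])
  qed
  have dom: "1 - (smoothing N c \<tau> ^^ n) ?q t \<le> ?b t" if t: "0 \<le> t" for n t
  proof -
    let ?e = "\<lambda>z. exp_neg (ennreal t * partial_weight n z)"
    have int: "integrable marks ?e" "integrable marks (\<Phi> n ?q t)" "integrable marks (D n ?q t)" "integrable marks (D n ?f t)"
      using D_bounds[OF P'(2)] D_bounds[OF Q'(2)] hom.D_bounds[OF Q'(2)]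
      by (intro integrable_marks D_measurable' hom.D_measurable' P'(2) Q'(2); auto)+
    have "laplace_transform P t = (\<integral>z. D n ?f t z \<partial>marks)"
      using integral_D_fixed[OF P'(2,3) t] t by simp
    also have "\<dots> \<le> (\<integral>z. ?e z \<partial>marks)"
      using hom.D_bounds[OF P'(2)]
      by (intro integral_mono int) (auto simp: D_eq_\<Phi> intro!: mult_left_le)
    finally have "laplace_transform P t \<le> (\<integral>z. ?e z \<partial>marks)" .
    moreover have "laplace_transform Q t = (\<integral>z. \<Phi> n ?q t z \<partial>marks)"
      using hom.integral_D_fixed[OF Q'(2,3) t] t by simp
    moreover have "(\<integral>z. ?e z + \<Phi> n ?q t z - 1 \<partial>marks) \<le> (\<integral>z. D n ?q t z \<partial>marks)"
    proof (rule integral_mono)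
      fix z
      \<comment> \<open>The two factors are dependent, so the mean of their product does not split.
        This inequality bounds it below by the sum of the means minus 1, which yields the two terms
        of \<open>?b\<close>.\<close>
      have "0 \<le> (1 - ?e z) * (1 - \<Phi> n ?q t z)"
        using hom.D_bounds(2)[OF Q'(2)] by (intro mult_nonneg_nonneg) auto
      then show "?e z + \<Phi> n ?q t z - 1 \<le> D n ?q t z"
        unfolding D_eq_\<Phi> by (simp add: algebra_simps)
    qed (use int in auto)
    ultimately show ?thesis
      using int by (simp add: integral_D[OF Q'(2) t] marks.prob_space)
  qed
  have "\<exists>R\<in>fixed_points N c \<tau>. \<forall>t\<ge>0. g t = laplace_transform R t"
  proof (rule limit_of_iterates_is_fixed_point[OF Q'(1) _ _ refl dom lim])
    show "(\<lambda>k. ?b (1 / 2 ^ k)) \<longlonglongrightarrow> 0"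
      using tendsto_add[OF tendsto_diff[OF tendsto_const[of 1] P.laplace_transform_tendsto_1[of 1]]
          tendsto_diff[OF tendsto_const[of 1] Q.laplace_transform_tendsto_1[of 1]]] by simp
    fix t :: real assume t: "0 \<le> t"
    show "AE x in N. (\<integral>\<^sup>+i. ennreal (?b (\<tau> i x * t)) \<partial>count_space UNIV) < \<infinity>"
      using sum_over_children_finite[OF P t] hom.sum_over_children_finite[OF Q t] AE_space
    proof eventually_elim
      case (elim x)
      have "ennreal (?b (\<tau> i x * t))
          = ennreal (1 - laplace_transform P (\<tau> i x * t)) + ennreal (1 - laplace_transform Q (\<tau> i x * t))" for i
        using elim t \<tau>_nonneg P.laplace_transform_le_1 Q.laplace_transform_le_1 by (intro ennreal_plus) auto
      then show ?case using elim by (simp add: nn_integral_add)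
    qed
  qed
  then obtain R where "R \<in> fixed_points N c \<tau>" and R: "\<And>t. 0 \<le> t \<Longrightarrow> laplace_transform R t = g t"
    by force
  then show ?thesis
    by (intro bexI[of _ R] allI impI trans[OF R g_eq])
qed

text \<open>
  The homogeneous products \<open>\<Phi> n f\<close> converge because \<open>D n f\<close> and the partial sums of the total weight
  do. Since \<open>\<Phi> n q\<close> is the conditional expectation of the limit given \<open>\<F> n\<close>, it approximates the
  limit in mean square at least as well as \<open>\<Phi> n f\<close> does.
\<close>
theorem disintegration_factorization:
  assumes P: "P \<in> fixed_points N c \<tau>"
  shows "\<exists>Q\<in>fixed_points N (\<lambda>_. 0) \<tau>. \<forall>t\<ge>0. AE z in marks.
    disintegration (\<lambda>v z. c (z v)) (\<lambda>v i z. \<tau> i (z v)) (laplace_transform P) t z =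
    exp_neg (ennreal t * total z) *
      disintegration (\<lambda>_ _. 0) (\<lambda>v i z. \<tau> i (z v)) (laplace_transform Q) t z"
proof -
  interpret hom: random_weights N "\<lambda>_. 0" \<tau> by (rule random_weights_0)
  let ?S = "smoothing N (\<lambda>_. 0) \<tau>"
  note P' = fixed_pointD[OF P]
  interpret P: nonneg_distribution P by (rule P'(1))
  let ?f = "\<lambda>s. laplace_transform P \<bar>s\<bar>"
  have [measurable]: "\<Phi> n ?f t \<in> borel_measurable marks" for n t
    by (rule hom.D_measurable'[OF P'(2)])
  define L where "L t z = lim (\<lambda>n. \<Phi> n ?f t z)" for t z
  have [measurable]: "L t \<in> borel_measurable marks" for t
    unfolding L_def by measurable
  have L: "AE z in marks. (\<lambda>n. \<Phi> n ?f t z) \<longlonglongrightarrow> L t z \<and>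
      (\<lambda>n. D n ?f t z) \<longlonglongrightarrow> exp_neg (ennreal t * total z) * L t z" if t: "0 \<le> t" for t
    using D_AE_convergent[OF P'(2,3) t] total_AE_finite[OF P]
  proof eventually_elim
    case (elim z)
    then obtain l where l: "(\<lambda>n. D n ?f t z) \<longlonglongrightarrow> l" by (auto simp: convergent_def)
    let ?e = "\<lambda>n. exp_neg (ennreal t * partial_weight n z)"
    have e: "?e \<longlonglongrightarrow> exp_neg (ennreal t * total z)"
      by (rule exp_neg_partial_weight_tendsto)
    \<comment> \<open>Dividing out the exponential requires a nonzero limit; here the almost sure
      finiteness of the total weight enters.\<close>
    have pos: "exp_neg (ennreal t * total z) \<noteq> 0"
      using elim(2) by (simp add: exp_neg_eq_0_iff ennreal_mult_eq_top_iff)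
    have "(\<lambda>n. D n ?f t z / ?e n) \<longlonglongrightarrow> l / exp_neg (ennreal t * total z)"
      by (intro tendsto_divide l e pos)
    moreover have "\<forall>\<^sub>F n in sequentially. D n ?f t z / ?e n = \<Phi> n ?f t z"
      using tendsto_imp_eventually_ne[OF e pos] by eventually_elim (simp add: D_eq_\<Phi>)
    ultimately have "(\<lambda>n. \<Phi> n ?f t z) \<longlonglongrightarrow> l / exp_neg (ennreal t * total z)"
      by (rule Lim_transform_eventually)
    then have \<Phi>: "(\<lambda>n. \<Phi> n ?f t z) \<longlonglongrightarrow> L t z"
      unfolding L_def by (simp add: limI)
    moreover have "(\<lambda>n. D n ?f t z) \<longlonglongrightarrow> exp_neg (ennreal t * total z) * L t z"
      unfolding D_eq_\<Phi> by (intro tendsto_intros e \<Phi>)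
    ultimately show ?case by blast
  qed
  have \<Phi>_bounds: "\<bar>\<Phi> n g t z\<bar> \<le> 1" if "unit_function g" for g n t z
    using hom.D_bounds[OF that] by (simp add: abs_of_nonneg)
  have diff_le_1: "\<bar>x - y\<bar> \<le> 1" if "0 \<le> x" "x \<le> 1" "0 \<le> y" "y \<le> 1" for x y :: real
    using that by linarith
  have lim_bounds: "0 \<le> l \<and> l \<le> 1" if "X \<longlonglongrightarrow> l" "\<And>n. 0 \<le> X n" "\<And>n. X n \<le> 1" for X and l :: real
    using LIMSEQ_le_const[OF that(1), of 0] LIMSEQ_le_const2[OF that(1), of 1] that(2,3) by simp
  have L_bounds: "AE z in marks. 0 \<le> L t z \<and> L t z \<le> 1" if t: "0 \<le> t" for t
    using L[OF t] by eventually_elim (rule lim_bounds[OF conjunct1], auto simp: hom.D_bounds[OF P'(2)])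
  define g where "g t = (\<integral>z. L t z \<partial>marks)" for t
  have lim: "(\<lambda>n. (?S ^^ n) ?f t) \<longlonglongrightarrow> g t" if t: "0 \<le> t" for t
  proof -
    have "(\<lambda>n. \<integral>z. \<Phi> n ?f t z \<partial>marks) \<longlonglongrightarrow> g t"
      unfolding g_def
      using L[OF t] \<Phi>_bounds[OF P'(2)]
      by (intro integral_dominated_convergence[where w="\<lambda>_. 1"]) (auto elim!: eventually_mono)
    then show ?thesis by (simp add: hom.integral_D[OF P'(2) t])
  qed
  \<comment> \<open>Omitting the exponential factor can only raise the mean, so the defect of
    \<open>P\<close> itself bounds those of all homogeneous iterates.\<close>
  have lower: "1 - (?S ^^ n) ?f t \<le> 1 - laplace_transform P t" if t: "0 \<le> t" for n t
  proof -
    have "laplace_transform P t = (\<integral>z. D n ?f t z \<partial>marks)"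
      using integral_D_fixed[OF P'(2,3) t] t by simp
    also have "\<dots> \<le> (\<integral>z. \<Phi> n ?f t z \<partial>marks)"
      using D_bounds[OF P'(2)] hom.D_bounds[OF P'(2)]
      by (intro integral_mono integrable_marks D_measurable' hom.D_measurable' P'(2))
         (auto simp: D_eq_\<Phi> intro!: mult_left_le_one_le)
    finally show ?thesis by (simp add: hom.integral_D[OF P'(2) t])
  qed
  have "\<exists>Q\<in>fixed_points N (\<lambda>_. 0) \<tau>. \<forall>t\<ge>0. g t = laplace_transform Q t"
  proof (rule hom.limit_of_iterates_is_fixed_point[OF P'(1) _ _ refl lower lim])
    show "(\<lambda>k. 1 - laplace_transform P (1 / 2 ^ k)) \<longlonglongrightarrow> 0"
      using tendsto_diff[OF tendsto_const[of 1] P.laplace_transform_tendsto_1[of 1]] by simp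
  qed (rule sum_over_children_finite[OF P])
  then obtain Q where Q: "Q \<in> fixed_points N (\<lambda>_. 0) \<tau>" and g: "\<And>t. 0 \<le> t \<Longrightarrow> g t = laplace_transform Q t"
    by blast
  note Q' = hom.fixed_pointD[OF Q]
  let ?q = "\<lambda>s. laplace_transform Q \<bar>s\<bar>"
  have [measurable]: "\<Phi> n ?q t \<in> borel_measurable marks" for n t
    by (rule hom.D_measurable'[OF Q'(2)])
  \<comment> \<open>The integral against \<open>\<Phi> (n + m) ?f\<close> has two limits in
    \<open>m\<close>: directly it leads to \<open>L\<close>, while integrating out the last
    \<open>m\<close> generations first leads to \<open>?q\<close> inside the product over generation
    \<open>n\<close>.\<close>
  have projection: "(\<integral>z. G z * L t z \<partial>marks) = (\<integral>z. G z * \<Phi> n ?q t z \<partial>marks)"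
    if t: "0 \<le> t" and G: "G \<in> borel_measurable (\<F> n)" "\<And>z. z \<in> space marks \<Longrightarrow> \<bar>G z\<bar> \<le> 1" for t n G
  proof (rule LIMSEQ_unique)
    have [measurable]: "G \<in> borel_measurable marks"
      by (rule measurable_from_subalg[OF subalgebra_\<F>(1) G(1)])
    have [measurable]: "\<Phi> n ((?S ^^ m) ?f) t \<in> borel_measurable marks" for m
      by (intro hom.D_measurable' hom.unit_function_iterate P'(2))
    have bound: "AE z in marks. \<bar>G z * x z\<bar> \<le> 1" if "\<And>z. \<bar>x z\<bar> \<le> 1" for x
      using G(2) that by (intro AE_I2) (auto simp: abs_mult intro!: mult_le_one)
    have "(\<lambda>m. \<integral>z. G z * \<Phi> m ?f t z \<partial>marks) \<longlonglongrightarrow> (\<integral>z. G z * L t z \<partial>marks)"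
    proof (rule integral_dominated_convergence[where w="\<lambda>_. 1"])
      show "AE z in marks. (\<lambda>m. G z * \<Phi> m ?f t z) \<longlonglongrightarrow> G z * L t z"
        using L[OF t] by eventually_elim (auto intro!: tendsto_intros)
    qed (simp_all add: bound \<Phi>_bounds[OF P'(2)])
    from LIMSEQ_ignore_initial_segment[OF this, of n]
    show "(\<lambda>m. \<integral>z. G z * \<Phi> (n + m) ?f t z \<partial>marks) \<longlonglongrightarrow> (\<integral>z. G z * L t z \<partial>marks)"
      by (simp add: add.commute)
    have "(\<lambda>m. \<integral>z. G z * \<Phi> n ((?S ^^ m) ?f) t z \<partial>marks) \<longlonglongrightarrow> (\<integral>z. G z * \<Phi> n ?q t z \<partial>marks)"
    proof (rule integral_dominated_convergence[where w="\<lambda>_. 1"])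
      show "AE z in marks. (\<lambda>m. G z * \<Phi> n ((?S ^^ m) ?f) t z) \<longlonglongrightarrow> G z * \<Phi> n ?q t z"
        using sum_over_generation_finite[OF P t, of n] AE_space
      proof eventually_elim
        case (elim z)
        show ?case
          unfolding \<Phi>_eq
        proof (intro tendsto_intros infprod_dominated_convergence[OF _ _ _ elim(1)])
          fix v m
          have s: "0 \<le> weight v z * t" using weight_nonneg[OF elim(2)] t by simp
          show "1 - (?S ^^ m) ?f (weight v z * t) \<le> 1 - laplace_transform P (weight v z * t)"
            by (rule lower[OF s])
          show "(\<lambda>m. (?S ^^ m) ?f (weight v z * t)) \<longlonglongrightarrow> ?q (weight v z * t)"
            using lim[OF s] g[OF s] s by simp
        qed (simp_all add: unit_functionD[OF hom.unit_function_iterate[OF P'(2)]])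
      qed
    qed (simp_all add: bound \<Phi>_bounds hom.unit_function_iterate[OF P'(2)])
    then show "(\<lambda>m. \<integral>z. G z * \<Phi> (n + m) ?f t z \<partial>marks) \<longlonglongrightarrow> (\<integral>z. G z * \<Phi> n ?q t z \<partial>marks)"
      using hom.integral_D_add[OF P'(2) t G] by simp
  qed
  have q_lim: "AE z in marks. (\<lambda>n. \<Phi> n ?q t z) \<longlonglongrightarrow> L t z" if t: "0 \<le> t" for t
  proof -
    have int: "integrable marks h" if [measurable]: "h \<in> borel_measurable marks"
      and "AE z in marks. \<bar>h z\<bar> \<le> 1" for h :: "(nat list \<Rightarrow> 'a) \<Rightarrow> real"
      using that by (intro marks.integrable_const_bound[where B=1]) auto
    have L_diff: "AE z in marks. \<bar>L t z - \<Phi> n h t z\<bar> \<le> 1" if "unit_function h" for h n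
      using L_bounds[OF t] by eventually_elim (use hom.D_bounds[OF that] in \<open>auto intro: diff_le_1\<close>)
    have sq: "AE z in marks. \<bar>(L t z - \<Phi> n h t z)\<^sup>2\<bar> \<le> 1" if "unit_function h" for h n
      using L_diff[OF that] by eventually_elim (simp add: abs_square_le_1)
    have closer: "(\<integral>z. (L t z - \<Phi> n ?q t z)\<^sup>2 \<partial>marks) \<le> (\<integral>z. (L t z - \<Phi> n ?f t z)\<^sup>2 \<partial>marks)" for n
    proof -
      let ?G = "\<lambda>z. \<Phi> n ?q t z - \<Phi> n ?f t z"
      have G_\<F>: "?G \<in> borel_measurable (\<F> n)"
        by (intro borel_measurable_diff hom.D_measurable coordinate_measurable_\<F> P'(2) Q'(2))
      have G: "\<bar>?G z\<bar> \<le> 1" for z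
        using hom.D_bounds[OF P'(2)] hom.D_bounds[OF Q'(2)] by (intro diff_le_1) auto
      have int_L: "integrable marks (\<lambda>z. ?G z * L t z)"
      proof (rule int)
        show "AE z in marks. \<bar>?G z * L t z\<bar> \<le> 1"
          using L_bounds[OF t] by eventually_elim (use G in \<open>auto simp: abs_mult intro!: mult_le_one\<close>)
      qed measurable
      have int_\<Phi>: "integrable marks (\<lambda>z. ?G z * \<Phi> n ?q t z)"
        using G \<Phi>_bounds[OF Q'(2)] by (intro int AE_I2) (auto simp: abs_mult intro!: mult_le_one)
      have "(\<integral>z. (L t z - \<Phi> n ?q t z)\<^sup>2 \<partial>marks)
          = (\<integral>z. (L t z - \<Phi> n ?q t z)\<^sup>2 + 2 * (?G z * L t z - ?G z * \<Phi> n ?q t z) \<partial>marks)"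
        using projection[OF t G_\<F> G] int_L int_\<Phi> int[OF _ sq[OF Q'(2)]] by simp
      also have "\<dots> \<le> (\<integral>z. (L t z - \<Phi> n ?f t z)\<^sup>2 \<partial>marks)"
      proof (rule integral_mono)
        show "integrable marks (\<lambda>z. (L t z - \<Phi> n ?q t z)\<^sup>2 + 2 * (?G z * L t z - ?G z * \<Phi> n ?q t z))"
          using int_L int_\<Phi> int[OF _ sq[OF Q'(2)]] by simp
        show "integrable marks (\<lambda>z. (L t z - \<Phi> n ?f t z)\<^sup>2)"
          using int[OF _ sq[OF P'(2)]] by simp
        fix z
        \<comment> \<open>The square expands along
          \<open>L - \<Phi> n ?f = (L - \<Phi> n ?q) + ?G\<close>; the cross term is the one added
          above, whose integral is 0 by \<open>projection\<close>.\<close>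
        have "0 \<le> (?G z)\<^sup>2" by simp
        then show "(L t z - \<Phi> n ?q t z)\<^sup>2 + 2 * (?G z * L t z - ?G z * \<Phi> n ?q t z) \<le> (L t z - \<Phi> n ?f t z)\<^sup>2"
          by (simp add: power2_eq_square algebra_simps)
      qed
      finally show ?thesis .
    qed
    have "(\<lambda>n. \<integral>z. (L t z - \<Phi> n ?f t z)\<^sup>2 \<partial>marks) \<longlonglongrightarrow> (\<integral>z. 0 \<partial>marks)"
    proof (rule integral_dominated_convergence[where w="\<lambda>_. 1"])
      show "AE z in marks. (\<lambda>n. (L t z - \<Phi> n ?f t z)\<^sup>2) \<longlonglongrightarrow> 0"
        using L[OF t] by eventually_elim (auto intro!: tendsto_eq_intros)
    qed (use sq[OF P'(2)] in simp_all)
    then have f_0: "(\<lambda>n. \<integral>z. (L t z - \<Phi> n ?f t z)\<^sup>2 \<partial>marks) \<longlonglongrightarrow> 0"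
      by simp
    have q_0: "(\<lambda>n. \<integral>z. (L t z - \<Phi> n ?q t z)\<^sup>2 \<partial>marks) \<longlonglongrightarrow> 0"
      by (rule tendsto_sandwich[OF _ _ tendsto_const f_0]) (simp_all add: closer)
    \<comment> \<open>Mean-square convergence alone does not give almost sure convergence of the
      whole sequence. The martingale theorem supplies an almost sure limit \<open>Y\<close>, which
      must then agree with \<open>L\<close>.\<close>
    define Y where "Y z = lim (\<lambda>n. \<Phi> n ?q t z)" for z
    have [measurable]: "Y \<in> borel_measurable marks"
      unfolding Y_def by measurable
    have Y: "AE z in marks. (\<lambda>n. \<Phi> n ?q t z) \<longlonglongrightarrow> Y z"
      using hom.D_AE_convergent[OF Q'(2,3) t] by eventually_elim (simp add: Y_def convergent_LIMSEQ_iff)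
    have "(\<lambda>n. \<integral>z. (L t z - \<Phi> n ?q t z)\<^sup>2 \<partial>marks) \<longlonglongrightarrow> (\<integral>z. (L t z - Y z)\<^sup>2 \<partial>marks)"
    proof (rule integral_dominated_convergence[where w="\<lambda>_. 1"])
      show "AE z in marks. (\<lambda>n. (L t z - \<Phi> n ?q t z)\<^sup>2) \<longlonglongrightarrow> (L t z - Y z)\<^sup>2"
        using Y by eventually_elim (auto intro!: tendsto_intros)
    qed (use sq[OF Q'(2)] in simp_all)
    with q_0 have "(\<integral>z. (L t z - Y z)\<^sup>2 \<partial>marks) = 0"
      by (rule LIMSEQ_unique[rotated])
    moreover have "integrable marks (\<lambda>z. (L t z - Y z)\<^sup>2)"
    proof (rule int)
      show "AE z in marks. \<bar>(L t z - Y z)\<^sup>2\<bar> \<le> 1"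
        using Y L_bounds[OF t]
      proof eventually_elim
        case (elim z)
        have "0 \<le> Y z" "Y z \<le> 1"
          using lim_bounds[OF elim(1)] hom.D_bounds[OF Q'(2)] by simp_all
        then show ?case using elim(2) by (simp add: abs_square_le_1 diff_le_1)
      qed
    qed measurable
    ultimately have "AE z in marks. (L t z - Y z)\<^sup>2 = 0"
      by (subst (asm) integral_nonneg_eq_0_iff_AE) auto
    with Y show ?thesis by eventually_elim simp
  qed
  have "AE z in marks.
      disintegration (\<lambda>v z. c (z v)) (\<lambda>v i z. \<tau> i (z v)) (laplace_transform P) t z =
      exp_neg (ennreal t * total z) *
        disintegration (\<lambda>_ _. 0) (\<lambda>v i z. \<tau> i (z v)) (laplace_transform Q) t z" if t: "0 \<le> t" for t
    using q_lim[OF t] L[OF t] AE_space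
  proof eventually_elim
    case (elim z)
    have "disintegration (\<lambda>v z. c (z v)) (\<lambda>v i z. \<tau> i (z v)) (laplace_transform P) t z
        = disintegration (\<lambda>v z. c (z v)) (\<lambda>v i z. \<tau> i (z v)) ?f t z"
      using t elim(3) by (intro disintegration_cong) auto
    moreover have "disintegration (\<lambda>_ _. 0) (\<lambda>v i z. \<tau> i (z v)) (laplace_transform Q) t z
        = disintegration (\<lambda>_ _. 0) (\<lambda>v i z. \<tau> i (z v)) ?q t z"
      using t elim(3) by (intro hom.disintegration_cong) auto
    ultimately show ?case
      using elim disintegration_eqI by metis
  qed
  then show ?thesis using Q by blast
qed

end

section \<open>Transfer from the canonical space of marks to an arbitrary model\<close>

lemma fixed_points_distr:
  assumes "random_weights M c' \<tau>'" "random_weights N c \<tau>"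
    and N: "N = distr M S X" and X: "X \<in> measurable M S"
    and eq: "\<And>\<omega>. \<omega> \<in> space M \<Longrightarrow> c' \<omega> = c (X \<omega>)" "\<And>i \<omega>. \<omega> \<in> space M \<Longrightarrow> \<tau>' i \<omega> = \<tau> i (X \<omega>)"
  shows "fixed_points M c' \<tau>' = fixed_points N c \<tau>"
proof -
  interpret M: random_weights M c' \<tau>' by fact
  interpret N: random_weights N c \<tau> by fact
  \<comment> \<open>Through the functional equation, being a fixed point depends only on the law of
    the weights.\<close>
  have "smoothing M c' \<tau>' (laplace_transform P) t = smoothing N c \<tau> (laplace_transform P) t"
    if P: "nonneg_distribution P" and t: "0 \<le> t" for P t
  proof -
    let ?f = "\<lambda>s. laplace_transform P \<bar>s\<bar>"
    have f: "unit_function ?f"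
      by (rule nonneg_distribution.unit_function_laplace_transform[OF P])
    have kernel: "smoothing_kernel c \<tau> ?f t \<in> borel_measurable S"
      using borel_measurable_integrable[OF N.integrable_smoothing_kernel[OF f]] by (simp add: N)
    have "smoothing M c' \<tau>' (laplace_transform P) t = smoothing M c' \<tau>' ?f t"
      by (rule M.smoothing_cong[OF _ t]) simp
    also have "\<dots> = (\<integral>\<omega>. smoothing_kernel c \<tau> ?f t (X \<omega>) \<partial>M)"
      unfolding smoothing_def
      by (intro Bochner_Integration.integral_cong refl) (simp add: smoothing_kernel_def eq)
    also have "\<dots> = smoothing N c \<tau> ?f t"
      by (simp add: smoothing_def N integral_distr[OF X kernel])
    also have "\<dots> = smoothing N c \<tau> (laplace_transform P) t"
      by (rule N.smoothing_cong[OF _ t]) simp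
    finally show ?thesis .
  qed
  then show ?thesis
    by (auto simp: M.fixed_points_iff_smoothing N.fixed_points_iff_smoothing)
qed

theorem theorem4p4:
  fixes M :: "'a measure"
    and C :: "nat list \<Rightarrow> 'a \<Rightarrow> real" and T :: "nat list \<Rightarrow> nat \<Rightarrow> 'a \<Rightarrow> real"
  assumes "weighted_branching M C T"
    and "fixed_points M (C []) (T []) \<noteq> {}"
  shows "(\<forall>\<psi>\<in>fixed_point_transforms M (C []) (T []).
           \<exists>\<phi>\<in>fixed_point_transforms M (\<lambda>_. 0) (T []).
             \<forall>t\<ge>0. AE \<omega> in M.
               disintegration C T \<psi> t \<omega> =
               exp_neg (ennreal t * total_weight C T \<omega>) * disintegration (\<lambda>_ _. 0) T \<phi> t \<omega>) \<and>
         (\<forall>\<phi>\<in>fixed_point_transforms M (\<lambda>_. 0) (T []).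
           (\<lambda>t. \<integral>\<omega>. exp_neg (ennreal t * total_weight C T \<omega>) *
                    disintegration (\<lambda>_ _. 0) T \<phi> t \<omega> \<partial>M)
             \<in> fixed_point_transforms M (C []) (T []))"
proof -
  interpret weighted_branching M C T by fact
  let ?S = "borel \<Otimes>\<^sub>M (\<Pi>\<^sub>M i\<in>UNIV. borel) :: (real \<times> (nat \<Rightarrow> real)) measure"
  let ?X = "\<lambda>v \<omega>. (C v \<omega>, \<lambda>i. T v i \<omega>)"
  define N where "N = distr M ?S (?X [])"
  \<comment> \<open>\<open>N\<close> lives on all real sequences, where coordinates may be negative.
    Truncation gives non-negativity at every point and changes nothing on the values taken by the
    model.\<close>
  define c where "c x = max 0 (fst x)" for x :: "real \<times> (nat \<Rightarrow> real)"
  define \<tau> where "\<tau> i x = max 0 (snd x i)" for i and x :: "real \<times> (nat \<Rightarrow> real)"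
  define Z where "Z \<omega> v = ?X v \<omega>" for \<omega> v
  have X [measurable]: "?X v \<in> measurable M ?S" for v
    using independent by (auto simp: indep_vars_def)
  interpret N: random_weights N c \<tau>
  proof -
    have "prob_space N" unfolding N_def by (rule prob_space_distr) measurable
    moreover have "c \<in> borel_measurable N" "\<tau> i \<in> borel_measurable N" for i
      unfolding c_def[abs_def] \<tau>_def[abs_def] N_def measurable_distr_eq1 by measurable
    ultimately show "random_weights N c \<tau>"
      by (auto simp: random_weights_def random_weights_axioms_def c_def \<tau>_def)
  qed
  interpret hom: random_weights N "\<lambda>_. 0" \<tau> by (rule N.random_weights_0)
  have C_eq: "C v \<omega> = c (Z \<omega> v)" and T_eq: "T v i \<omega> = \<tau> i (Z \<omega> v)" if "\<omega> \<in> space M" for v i \<omega>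
    using C_nonneg[OF that] T_nonneg[OF that] by (simp_all add: c_def \<tau>_def Z_def)
  have sets_N: "sets N = sets ?S" by (simp add: N_def)
  have sets_marks: "sets N.marks = sets (\<Pi>\<^sub>M v\<in>UNIV. ?S)"
    unfolding N.marks_def by (intro sets_PiM_cong refl sets_N)
  have Z: "Z \<in> measurable M N.marks"
    unfolding N.marks_def Z_def
    by (rule measurable_PiM_single') (auto simp: measurable_cong_sets[OF refl sets_N] N_def space_pair_measure space_PiM)
  \<comment> \<open>Independence and equality of the laws say precisely that the family of marks has
    the product law.\<close>
  have marks: "distr M N.marks Z = N.marks"
  proof -
    have "distr M (\<Pi>\<^sub>M v\<in>UNIV. ?S) (\<lambda>\<omega>. \<lambda>v\<in>UNIV. ?X v \<omega>) = (\<Pi>\<^sub>M v\<in>UNIV. distr M ?S (?X v))"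
      using independent by (subst (asm) indep_vars_iff_distr_eq_PiM') auto
    moreover have "distr M ?S (?X v) = N" for v
      unfolding N_def by (rule identically_distributed)
    ultimately have "distr M (\<Pi>\<^sub>M v\<in>UNIV. ?S) Z = N.marks"
      by (simp add: N.marks_def Z_def[abs_def] restrict_UNIV)
    then show ?thesis
      using distr_cong[OF refl sets_marks, of M Z Z] by simp
  qed
  have AE_Z: "AE \<omega> in M. Q (Z \<omega>)" if "AE z in N.marks. Q z" for Q
    by (rule AE_distrD[OF Z]) (unfold marks, rule that)
  have fixed: "fixed_points M (C []) (T []) = fixed_points N c \<tau>"
    and fixed_0: "fixed_points M (\<lambda>_. 0) (T []) = fixed_points N (\<lambda>_. 0) \<tau>"
  proof -
    have "random_weights M (\<lambda>\<omega>. fst (?X [] \<omega>)) (\<lambda>i \<omega>. snd (?X [] \<omega>) i)"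
    proof
      show "(\<lambda>\<omega>. fst (?X [] \<omega>)) \<in> borel_measurable M"
        by (rule measurable_compose[OF X measurable_fst])
      show "(\<lambda>\<omega>. snd (?X [] \<omega>) i) \<in> borel_measurable M" for i
        by (rule measurable_compose[OF measurable_compose[OF X measurable_snd] measurable_component_singleton]) simp
    qed (simp_all add: C_nonneg T_nonneg)
    then have M: "random_weights M (C []) (T [])" by simp
    show "fixed_points M (C []) (T []) = fixed_points N c \<tau>"
      by (rule fixed_points_distr[OF M N.random_weights_axioms N_def X])
         (auto intro: C_eq[unfolded Z_def] T_eq[unfolded Z_def])
    show "fixed_points M (\<lambda>_. 0) (T []) = fixed_points N (\<lambda>_. 0) \<tau>"
      by (rule fixed_points_distr[OF random_weights.random_weights_0[OF M] hom.random_weights_axioms N_def X])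
         (auto intro: T_eq[unfolded Z_def])
  qed
  have weight: "branch_weight T v \<omega> = branch_weight (\<lambda>v i z. \<tau> i (z v)) v (Z \<omega>)" if "\<omega> \<in> space M" for v \<omega>
    by (simp add: branch_weight_def T_eq[OF that])
  have total: "total_weight C T \<omega> = N.total (Z \<omega>)" if "\<omega> \<in> space M" for \<omega>
    by (simp add: total_weight_def weight[OF that] C_eq[OF that])
  have Z_space: "Z \<omega> \<in> space N.marks" if "\<omega> \<in> space M" for \<omega>
    using measurable_space[OF Z that] .
  \<comment> \<open>\<open>f\<close> and \<open>g\<close> need to agree on the half-line only,
    because all weights and \<open>t\<close> are non-negative.\<close>
  have dis: "disintegration C T f t \<omega> = disintegration (\<lambda>v z. c (z v)) (\<lambda>v i z. \<tau> i (z v)) g t (Z \<omega>)"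
    and dis_0: "disintegration (\<lambda>_ _. 0) T f t \<omega> = disintegration (\<lambda>_ _. 0) (\<lambda>v i z. \<tau> i (z v)) g t (Z \<omega>)"
    if "\<omega> \<in> space M" "0 \<le> t" "\<And>s. 0 \<le> s \<Longrightarrow> f s = g s" for f g t \<omega>
  proof -
    have "disintegration C T f t \<omega> = disintegration (\<lambda>v z. c (z v)) (\<lambda>v i z. \<tau> i (z v)) f t (Z \<omega>)"
      by (simp add: disintegration_def disintegration_step_def weight[OF that(1)] C_eq[OF that(1)])
    also have "\<dots> = disintegration (\<lambda>v z. c (z v)) (\<lambda>v i z. \<tau> i (z v)) g t (Z \<omega>)"
      by (rule N.disintegration_cong[OF that(3,2) Z_space[OF that(1)]])
    finally show "disintegration C T f t \<omega> = disintegration (\<lambda>v z. c (z v)) (\<lambda>v i z. \<tau> i (z v)) g t (Z \<omega>)" .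
    have "disintegration (\<lambda>_ _. 0) T f t \<omega> = disintegration (\<lambda>_ _. 0) (\<lambda>v i z. \<tau> i (z v)) f t (Z \<omega>)"
      by (simp add: disintegration_def disintegration_step_def weight[OF that(1)])
    also have "\<dots> = disintegration (\<lambda>_ _. 0) (\<lambda>v i z. \<tau> i (z v)) g t (Z \<omega>)"
      by (rule hom.disintegration_cong[OF that(3,2) Z_space[OF that(1)]])
    finally show "disintegration (\<lambda>_ _. 0) T f t \<omega> = disintegration (\<lambda>_ _. 0) (\<lambda>v i z. \<tau> i (z v)) g t (Z \<omega>)" .
  qed
  show ?thesis
  proof (intro conjI ballI)
    fix \<psi> assume "\<psi> \<in> fixed_point_transforms M (C []) (T [])"
    then obtain P where P: "P \<in> fixed_points N c \<tau>" and \<psi>: "\<And>t. 0 \<le> t \<Longrightarrow> \<psi> t = laplace_transform P t"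
      by (auto simp: fixed_point_transforms_def fixed)
    from N.disintegration_factorization[OF P] obtain Q where Q: "Q \<in> fixed_points N (\<lambda>_. 0) \<tau>"
      and eq: "\<And>t. 0 \<le> t \<Longrightarrow> AE z in N.marks.
        disintegration (\<lambda>v z. c (z v)) (\<lambda>v i z. \<tau> i (z v)) (laplace_transform P) t z =
        exp_neg (ennreal t * N.total z) *
          disintegration (\<lambda>_ _. 0) (\<lambda>v i z. \<tau> i (z v)) (laplace_transform Q) t z"
      by blast
    have "AE \<omega> in M. disintegration C T \<psi> t \<omega> =
        exp_neg (ennreal t * total_weight C T \<omega>) * disintegration (\<lambda>_ _. 0) T (laplace_transform Q) t \<omega>"
      if t: "0 \<le> t" for t
      using AE_Z[OF eq[OF t]] AE_space
    proof eventually_elim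
      case (elim \<omega>)
      then show ?case
        using dis[OF elim(2) t \<psi>] dis_0[OF elim(2) t refl, of "laplace_transform Q"] total[OF elim(2)] by simp
    qed
    moreover have "laplace_transform Q \<in> fixed_point_transforms M (\<lambda>_. 0) (T [])"
      using Q by (auto simp: fixed_point_transforms_def fixed_0)
    ultimately show "\<exists>\<phi>\<in>fixed_point_transforms M (\<lambda>_. 0) (T []). \<forall>t\<ge>0. AE \<omega> in M.
        disintegration C T \<psi> t \<omega> =
        exp_neg (ennreal t * total_weight C T \<omega>) * disintegration (\<lambda>_ _. 0) T \<phi> t \<omega>"
      by blast
  next
    fix \<phi> assume "\<phi> \<in> fixed_point_transforms M (\<lambda>_. 0) (T [])"
    then obtain Q where Q: "Q \<in> fixed_points N (\<lambda>_. 0) \<tau>" and \<phi>: "\<And>t. 0 \<le> t \<Longrightarrow> \<phi> t = laplace_transform Q t"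
      by (auto simp: fixed_point_transforms_def fixed_0)
    \<comment> \<open>Non-emptiness supplies the control distribution for the converse; in the first
      direction the fixed point is given.\<close>
    obtain P where P: "P \<in> fixed_points N c \<tau>" using assms(2) fixed by auto
    \<comment> \<open>Measurability of the disintegration is available for functions into [0,1] on
      the whole line, hence the absolute value.\<close>
    let ?q = "\<lambda>s. laplace_transform Q \<bar>s\<bar>"
    let ?g = "\<lambda>t z. exp_neg (ennreal t * N.total z) * disintegration (\<lambda>_ _. 0) (\<lambda>v i z. \<tau> i (z v)) ?q t z"
    from N.fixed_point_from_homogeneous[OF P Q] obtain R where R: "R \<in> fixed_points N c \<tau>"
      and eq: "\<And>t. 0 \<le> t \<Longrightarrow> laplace_transform R t = (\<integral>z. exp_neg (ennreal t * N.total z) *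
        disintegration (\<lambda>_ _. 0) (\<lambda>v i z. \<tau> i (z v)) (laplace_transform Q) t z \<partial>N.marks)"
      by blast
    have "(\<integral>\<omega>. exp_neg (ennreal t * total_weight C T \<omega>) * disintegration (\<lambda>_ _. 0) T \<phi> t \<omega> \<partial>M)
        = laplace_transform R t" if t: "0 \<le> t" for t
    proof -
      have [measurable]: "disintegration (\<lambda>_ _. 0) (\<lambda>v i z. \<tau> i (z v)) ?q t \<in> borel_measurable N.marks"
        by (rule N.disintegration_0_measurable[OF hom.fixed_pointD(2)[OF Q]])
      have "(\<integral>\<omega>. exp_neg (ennreal t * total_weight C T \<omega>) * disintegration (\<lambda>_ _. 0) T \<phi> t \<omega> \<partial>M)
          = (\<integral>\<omega>. ?g t (Z \<omega>) \<partial>M)"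
        by (intro Bochner_Integration.integral_cong refl arg_cong2[where f="(*)"] dis_0 t)
           (simp_all add: total \<phi>)
      also have "\<dots> = (\<integral>z. ?g t z \<partial>N.marks)"
      proof -
        have "?g t \<in> borel_measurable N.marks" by measurable
        from integral_distr[OF Z this] show ?thesis
          unfolding marks by (rule sym)
      qed
      also have "\<dots> = laplace_transform R t"
        unfolding eq[OF t]
        by (intro Bochner_Integration.integral_cong refl arg_cong2[where f="(*)"] hom.disintegration_cong t) simp
      finally show ?thesis .
    qed
    then show "(\<lambda>t. \<integral>\<omega>. exp_neg (ennreal t * total_weight C T \<omega>) * disintegration (\<lambda>_ _. 0) T \<phi> t \<omega> \<partial>M)
        \<in> fixed_point_transforms M (C []) (T [])"
      unfolding fixed_point_transforms_def fixed using R by blast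
  qed
qed

end
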